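(* The following promise problem $\Theta$ is $\mathbf{NP}$-complete. Instance: a planar $3$-regular graph $G$ and a number $r$ with $0<r<1$. Promise: $\sigma(G)=2$. Question: does $G$ have a sigma coloring $c$ using exactly $\sigma(G)$ distinct labels such that for some label, the set of vertices receiving that label has at most $r|V(G)|$ vertices?
   Context: All graphs are finite and simple. For a graph $G$, a vertex labeling $c: V(G)\to\mathbb{N}$ is a sigma coloring of $G$ if for every two adjacent vertices $u,v$ of $G$ we have $\sum_{w\sim u} c(w)\neq \sum_{w\sim v} c(w)$, where $w\sim x$ means $w$ is adjacent to $x$. The sigma chromatic number $\sigma(G)$ is the minimum number of distinct labels used by a sigma coloring of $G$. A graph is $3$-regular if every vertex has degree $3$. *)

theory Defs
  imports
    "HOL-Analysis.Analysis"
    "HOL-Computational_Algebra.Polynomial"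
    "Graph_Theory.Pair_Digraph"
begin

section \<open>Graphs, planarity and sigma colorings\<close>

text \<open>
  Finite simple graphs are rendered by the locale predicate \<^const>\<open>pair_graph\<close>: finite, loop-free
  and symmetric, where an edge joining \<open>u\<close> and \<open>v\<close> is represented by both pairs \<open>(u, v)\<close> and \<open>(v, u)\<close>.
  Hence the out-degree of a vertex is its degree.
\<close>

definition regular_graph :: "nat \<Rightarrow> 'a pair_pre_digraph \<Rightarrow> bool" where
  "regular_graph d G \<longleftrightarrow> (\<forall>v\<in>pverts G. out_degree (with_proj G) v = d)"

text \<open>
  A plane drawing: vertices are distinct points \<open>pos v\<close>, the edge with ends \<open>u\<close> and \<open>v\<close> is drawn as an
  arc \<open>\<gamma> {u, v}\<close> joining them and avoiding the other vertices, and different edges meet only at vertices.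
\<close>

definition plane_drawing ::
  "'a pair_pre_digraph \<Rightarrow> ('a \<Rightarrow> complex) \<Rightarrow> ('a set \<Rightarrow> real \<Rightarrow> complex) \<Rightarrow> bool" where
  "plane_drawing G pos \<gamma> \<longleftrightarrow>
     inj_on pos (pverts G) \<and>
     (\<forall>(u, v)\<in>parcs G.
        arc (\<gamma> {u, v}) \<and>
        {pathstart (\<gamma> {u, v}), pathfinish (\<gamma> {u, v})} = {pos u, pos v} \<and>
        path_image (\<gamma> {u, v}) \<inter> pos ` pverts G = {pos u, pos v}) \<and>
     (\<forall>(u, v)\<in>parcs G. \<forall>(x, y)\<in>parcs G. {u, v} \<noteq> {x, y} \<longrightarrow>
        path_image (\<gamma> {u, v}) \<inter> path_image (\<gamma> {x, y}) \<subseteq> pos ` pverts G)"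

definition planar_graph :: "'a pair_pre_digraph \<Rightarrow> bool" where
  "planar_graph G \<longleftrightarrow> (\<exists>pos \<gamma>. plane_drawing G pos \<gamma>)"

definition neighbors :: "'a pair_pre_digraph \<Rightarrow> 'a \<Rightarrow> 'a set" where
  "neighbors G v = {w. (v, w) \<in> parcs G}"

definition sigma_coloring :: "'a pair_pre_digraph \<Rightarrow> ('a \<Rightarrow> nat) \<Rightarrow> bool" where
  "sigma_coloring G c \<longleftrightarrow>
     (\<forall>(u, v)\<in>parcs G. (\<Sum>w\<in>neighbors G u. c w) \<noteq> (\<Sum>w\<in>neighbors G v. c w))"

definition sigma_chromatic_number :: "'a pair_pre_digraph \<Rightarrow> nat" where
  "sigma_chromatic_number G = (LEAST k. \<exists>c. sigma_coloring G c \<and> card (c ` pverts G) = k)"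


section \<open>Polynomial-time computation\<close>

text \<open>
  Deterministic multi-tape Turing machines. Tapes are two-way infinite, symbol \<open>0\<close> is the blank,
  computation starts in state \<open>0\<close> and halts on reaching state \<open>1\<close>. The transition function maps a state
  and the list of scanned symbols to a new state and, for each tape, a symbol to write and a head
  movement.
\<close>

record turing_machine =
  tm_tapes :: nat
  tm_states :: nat
  tm_symbols :: nat
  tm_delta :: "nat \<Rightarrow> nat list \<Rightarrow> nat \<times> (nat \<times> int) list"

definition wf_tm :: "turing_machine \<Rightarrow> bool" where
  "wf_tm M \<longleftrightarrow>
     tm_tapes M \<ge> 1 \<and> tm_states M \<ge> 2 \<and> tm_symbols M \<ge> 3 \<and>
     (\<forall>q < tm_states M. \<forall>ss. length ss = tm_tapes M \<and> set ss \<subseteq> {..<tm_symbols M} \<longrightarrow>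
        (case tm_delta M q ss of (q', acts) \<Rightarrow>
           q' < tm_states M \<and> length acts = tm_tapes M \<and>
           set acts \<subseteq> {..<tm_symbols M} \<times> {-1, 0, 1}))"

type_synonym tm_config = "nat \<times> (int \<times> (int \<Rightarrow> nat)) list"

definition tm_step :: "turing_machine \<Rightarrow> tm_config \<Rightarrow> tm_config" where
  "tm_step M = (\<lambda>(q, ts).
     if q = 1 then (q, ts)
     else case tm_delta M q (map (\<lambda>(h, t). t h) ts) of (q', acts) \<Rightarrow>
       (q', map2 (\<lambda>(s, d) (h, t). (h + d, t(h := s))) acts ts))"

definition string_tape :: "bool list \<Rightarrow> int \<Rightarrow> nat" where
  "string_tape x i =
     (if 0 \<le> i \<and> i < int (length x) then (if x ! nat i then 2 else 1) else 0)"

definition tm_init :: "turing_machine \<Rightarrow> bool list \<Rightarrow> tm_config" where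
  "tm_init M x = (0, (0, string_tape x) # replicate (tm_tapes M - 1) (0, \<lambda>_. 0))"

text \<open>Input and output are both on the first tape; final head positions are irrelevant.\<close>

definition tm_computes_within ::
  "turing_machine \<Rightarrow> (bool list \<Rightarrow> bool list) \<Rightarrow> (nat \<Rightarrow> nat) \<Rightarrow> bool" where
  "tm_computes_within M f T \<longleftrightarrow>
     (\<forall>x. \<exists>t \<le> T (length x). \<exists>ts.
        (tm_step M ^^ t) (tm_init M x) = (1, ts) \<and> snd (hd ts) = string_tape (f x))"

definition poly_time_computable :: "(bool list \<Rightarrow> bool list) \<Rightarrow> bool" where
  "poly_time_computable f \<longleftrightarrow>
     (\<exists>M (p :: nat poly). wf_tm M \<and> tm_computes_within M f (poly p))"

definition poly_time_decidable :: "(bool list \<Rightarrow> bool) \<Rightarrow> bool" where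
  "poly_time_decidable V \<longleftrightarrow> poly_time_computable (\<lambda>x. [V x])"


section \<open>NP-completeness of promise problems\<close>

definition pair_string :: "bool list \<Rightarrow> bool list \<Rightarrow> bool list" where
  "pair_string x y = concat (map (\<lambda>b. [b, b]) x) @ [False, True] @ y"

text \<open>
  A promise problem is a pair \<open>(Q, R)\<close> of sets of strings, a promise and a question: on inputs in \<open>Q\<close>
  one has to decide membership in \<open>R\<close>, and nothing is required on inputs outside \<open>Q\<close>. Its
  yes-instances are \<open>Q \<inter> R\<close> and its no-instances are \<open>Q - R\<close>. A language \<open>L\<close> is the promise problem
  \<open>(UNIV, L)\<close>.
\<close>

type_synonym promise_problem = "bool list set \<times> bool list set"

definition promise_NP :: "promise_problem set" where
  "promise_NP = {(Q, R). \<exists>V (p :: nat poly). poly_time_decidable V \<and>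
     (\<forall>x\<in>Q. x \<in> R \<longleftrightarrow> (\<exists>w. length w \<le> poly p (length x) \<and> V (pair_string x w)))}"

definition NP :: "bool list set set" where
  "NP = {L. (UNIV, L) \<in> promise_NP}"

definition NP_hard_promise :: "promise_problem \<Rightarrow> bool" where
  "NP_hard_promise = (\<lambda>(Q, R). \<forall>L\<in>NP. \<exists>f. poly_time_computable f \<and>
     (\<forall>x. f x \<in> Q \<and> (x \<in> L \<longleftrightarrow> f x \<in> R)))"

definition NP_complete_promise :: "promise_problem \<Rightarrow> bool" where
  "NP_complete_promise P \<longleftrightarrow> P \<in> promise_NP \<and> NP_hard_promise P"


section \<open>The problem \<open>\<Theta>\<close>\<close>

fun nat_string :: "nat \<Rightarrow> bool list" where
  "nat_string n = (if n = 0 then [] else odd n # nat_string (n div 2))"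

declare nat_string.simps [simp del]

text \<open>
  A graph on the vertex set \<open>{0..<n}\<close> is written as its adjacency matrix, row by row; a rational
  number is written as a fraction, not necessarily reduced, of two numbers in binary.
\<close>

definition adjacency_string :: "nat \<Rightarrow> nat rel \<Rightarrow> bool list" where
  "adjacency_string n E = map (\<lambda>k. (k div n, k mod n) \<in> E) [0..<n * n]"

definition encodes :: "bool list \<Rightarrow> nat pair_pre_digraph \<Rightarrow> rat \<Rightarrow> bool" where
  "encodes x G r \<longleftrightarrow> (\<exists>n a b.
     pverts G = {..<n} \<and> b > 0 \<and> r = of_nat a / of_nat b \<and>
     x = pair_string (adjacency_string n (parcs G)) (pair_string (nat_string a) (nat_string b)))"

definition Theta_instance :: "nat pair_pre_digraph \<Rightarrow> rat \<Rightarrow> bool" where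
  "Theta_instance G r \<longleftrightarrow>
     pair_graph G \<and> planar_graph G \<and> regular_graph 3 G \<and> 0 < r \<and> r < 1"

definition Theta_question :: "nat pair_pre_digraph \<Rightarrow> rat \<Rightarrow> bool" where
  "Theta_question G r \<longleftrightarrow>
     (\<exists>c. sigma_coloring G c \<and> card (c ` pverts G) = sigma_chromatic_number G \<and>
        (\<exists>l\<in>c ` pverts G.
           of_nat (card {v\<in>pverts G. c v = l}) \<le> r * of_nat (card (pverts G))))"

definition Theta :: promise_problem where
  "Theta =
     ({x. \<exists>G r. encodes x G r \<and> Theta_instance G r \<and> sigma_chromatic_number G = 2},
      {x. \<exists>G r. encodes x G r \<and> Theta_instance G r \<and> Theta_question G r})"

text \<open>A string encodes at most one pair of a graph and a number.\<close>

lemma pair_string_inject: "pair_string x y = pair_string x' y' \<longleftrightarrow> x = x' \<and> y = y'"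
proof (induction x arbitrary: x')
  case Nil
  then show ?case by (cases x') (auto simp: pair_string_def)
next
  case (Cons b x)
  then show ?case by (cases x') (auto simp: pair_string_def)
qed

lemma nat_string_inject: "nat_string m = nat_string n \<longleftrightarrow> m = n"
proof (induction m arbitrary: n rule: less_induct)
  case (less m)
  show ?case
  proof (cases "m = 0 \<or> n = 0")
    case True
    then show ?thesis by (auto simp: nat_string.simps[of m] nat_string.simps[of n])
  next
    case False
    have "nat_string (m div 2) = nat_string (n div 2) \<longleftrightarrow> m div 2 = n div 2"
      using False by (intro less) auto
    then have "nat_string m = nat_string n \<longleftrightarrow> (odd m \<longleftrightarrow> odd n) \<and> m div 2 = n div 2"
      using False by (subst nat_string.simps[of m], subst nat_string.simps[of n]) auto
    also have "\<dots> \<longleftrightarrow> m = n" by (auto elim!: evenE oddE)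
    finally show ?thesis .
  qed
qed

lemma adjacency_string_inject:
  assumes "adjacency_string n E = adjacency_string n' E'"
    and "E \<subseteq> {..<n} \<times> {..<n}" "E' \<subseteq> {..<n'} \<times> {..<n'}"
  shows "n = n' \<and> E = E'"
proof -
  have "n * n = n' * n'" using arg_cong[OF assms(1), of length] by (simp add: adjacency_string_def)
  then have n: "n' = n" by (metis power2_eq_square power2_eq_imp_eq zero_le)
  have "(i, j) \<in> E \<longleftrightarrow> (i, j) \<in> E'" if "i < n" "j < n" for i j
  proof -
    have "i * n + j < Suc i * n" using that by simp
    also have "\<dots> \<le> n * n" using that by (intro mult_right_mono) auto
    finally have k: "i * n + j < n * n" .
    then have "adjacency_string n E ! (i * n + j) = adjacency_string n E' ! (i * n + j)"
      using assms(1) n by simp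
    with k that show ?thesis by (simp add: adjacency_string_def)
  qed
  then show ?thesis using assms(2,3) n by auto
qed

lemma encodes_unique:
  assumes "encodes x G r" "encodes x G' r'" "pair_graph G" "pair_graph G'"
  shows "G = G' \<and> r = r'"
proof -
  have sub: "parcs H \<subseteq> {..<m} \<times> {..<m}"
    if "pair_graph H" "pverts H = {..<m}" for H :: "nat pair_pre_digraph" and m
  proof -
    interpret pair_graph H by fact
    show ?thesis using wellformed' that(2) by auto
  qed
  obtain n a b where 1: "pverts G = {..<n}" "r = of_nat a / of_nat b"
    "x = pair_string (adjacency_string n (parcs G)) (pair_string (nat_string a) (nat_string b))"
    using assms(1) by (auto simp: encodes_def)
  obtain n' a' b' where 2: "pverts G' = {..<n'}" "r' = of_nat a' / of_nat b'"
    "x = pair_string (adjacency_string n' (parcs G')) (pair_string (nat_string a') (nat_string b'))"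
    using assms(2) by (auto simp: encodes_def)
  have eq: "adjacency_string n (parcs G) = adjacency_string n' (parcs G')" "a = a'" "b = b'"
    using 1(3) 2(3) by (auto simp: pair_string_inject nat_string_inject)
  have "n = n' \<and> parcs G = parcs G'"
    using adjacency_string_inject[OF eq(1)] sub assms(3,4) 1(1) 2(1) by blast
  with 1 2 eq show ?thesis by simp
qed

end

theory Submission
  imports Defs "HOL-Library.Code_Binary_Nat"
begin

text \<open>
  In a bipartite cubic graph each of the two sides is a label class of a sigma coloring with two labels,
  so the sigma chromatic number is 2. If \<open>S\<close> is a label class of such a coloring, then the vertices
  without neighbours in \<open>S\<close> are independent, hence at most half of all vertices, and each of the others
  accounts for at least one of the \<open>3 * card S\<close> edge ends at \<open>S\<close>. So \<open>S\<close> contains at least one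
  sixth of the vertices, and equality holds iff the vertices with exactly one neighbour in \<open>S\<close> and
  those with none form a bipartition. For \<open>r = 1 / 6\<close> the question is therefore an exact cover problem.

  Hardness comes from a direct reduction. The computation tableau of a verifier becomes a CNF formula,
  and its clause-variable matrix becomes a grid of boxes with 108 vertices each: the value of a variable
  travels down its column, and the truth value of the part of a clause read so far travels along its row.
  Boxes for matrix entries 0 let the two signals cross, boxes for literals allow a row signal to be
  switched on, and the boxes in the first and last column force a row to start with false and to end
  with true. Each box is planar and bipartite, and its relevant properties are checked by computation.

  Polynomial-time computability is established for a small calculus of bounded arithmetic functions that
  is compiled to counter programs and these to Turing machines.
\<close>

section \<open>Sigma colorings of regular graphs\<close>

lemma pair_graphI:
  assumes "finite (pverts G)" "parcs G \<subseteq> pverts G \<times> pverts G"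
    and "\<And>u v. (u, v) \<in> parcs G \<Longrightarrow> (v, u) \<in> parcs G" "\<And>v. (v, v) \<notin> parcs G"
  shows "pair_graph G"
proof
  show "finite (parcs G)" using assms(1,2) finite_subset by blast
  show "symmetric (with_proj G)" using assms(3) by (auto simp: symmetric_def sym_def)
qed (use assms in auto)

lemma out_degree_eq_card_neighbors: "out_degree (with_proj G) v = card (neighbors G v)"
proof -
  have "out_arcs (with_proj G) v = Pair v ` neighbors G v"
    by (auto simp: out_arcs_def neighbors_def)
  then show ?thesis by (simp add: out_degree_def card_image inj_on_def)
qed

definition nbr_count :: "'a pair_pre_digraph \<Rightarrow> 'a set \<Rightarrow> 'a \<Rightarrow> nat" where
  "nbr_count G S u = card (neighbors G u \<inter> S)"

definition nbr_separating :: "'a pair_pre_digraph \<Rightarrow> 'a set \<Rightarrow> bool" where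
  "nbr_separating G S \<longleftrightarrow> (\<forall>(u, v)\<in>parcs G. nbr_count G S u \<noteq> nbr_count G S v)"

definition exact_cover :: "'a pair_pre_digraph \<Rightarrow> 'a set \<Rightarrow> bool" where
  "exact_cover G S \<longleftrightarrow>
     S \<subseteq> pverts G \<and> (\<forall>u\<in>pverts G. nbr_count G S u \<le> 1) \<and> nbr_separating G S"

definition bipartite :: "'a pair_pre_digraph \<Rightarrow> bool" where
  "bipartite G \<longleftrightarrow> (\<exists>side :: 'a \<Rightarrow> bool. \<forall>(u, v)\<in>parcs G. side u \<noteq> side v)"

lemma nbr_separatingD: "nbr_separating G S \<Longrightarrow> (u, v) \<in> parcs G \<Longrightarrow> nbr_count G S u \<noteq> nbr_count G S v"
  by (auto simp: nbr_separating_def)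

context pair_graph
begin

lemma arc_sym: "(u, v) \<in> parcs G \<Longrightarrow> (v, u) \<in> parcs G"
  by (rule arcs_symmetric)

lemma arc_verts: "(u, v) \<in> parcs G \<Longrightarrow> u \<in> pverts G \<and> v \<in> pverts G"
  using wellformed' by blast

lemma neighbors_subset: "neighbors G u \<subseteq> pverts G"
  using arc_verts by (auto simp: neighbors_def)

lemma finite_neighbors: "finite (neighbors G u)"
  using neighbors_subset pair_finite_verts by (rule finite_subset)

lemma sum_indicator_neighbors: "(\<Sum>w\<in>neighbors G u. of_bool (w \<in> S)) = nbr_count G S u"
  by (simp add: nbr_count_def finite_neighbors)

end

locale regular_pair_graph = pair_graph G for G :: "'a pair_pre_digraph" +
  fixes d :: nat
  assumes regular: "regular_graph d G" and degree_pos: "d > 0"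
begin

abbreviation V where "V \<equiv> pverts G"

lemma finite_V: "finite V"
  by (rule pair_finite_verts)

lemma card_neighbors: "u \<in> V \<Longrightarrow> card (neighbors G u) = d"
  using regular by (auto simp: regular_graph_def out_degree_eq_card_neighbors)

lemma neighbors_nonempty: "u \<in> V \<Longrightarrow> neighbors G u \<noteq> {}"
  using card_neighbors degree_pos by fastforce

lemma ex_arc:
  assumes "V \<noteq> {}"
  obtains u v where "(u, v) \<in> parcs G"
  using assms neighbors_nonempty that unfolding neighbors_def by blast

lemma sum_nbr_count:
  assumes "X \<subseteq> V"
  shows "(\<Sum>u\<in>V. nbr_count G X u) = d * card X"
proof -
  have "nbr_count G X u = (\<Sum>x\<in>X. of_bool (x \<in> neighbors G u))" for u
    using assms finite_subset[OF _ finite_V] by (simp add: nbr_count_def Int_commute)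
  then have "(\<Sum>u\<in>V. nbr_count G X u) = (\<Sum>x\<in>X. \<Sum>u\<in>V. of_bool (x \<in> neighbors G u))"
    by (simp only: sum.swap[of _ X])
  also have "\<dots> = (\<Sum>x\<in>X. d)"
  proof (rule sum.cong[OF refl])
    fix x assume "x \<in> X"
    have "V \<inter> {u. x \<in> neighbors G u} = neighbors G x"
      using arc_sym arc_verts by (auto simp: neighbors_def)
    then show "(\<Sum>u\<in>V. of_bool (x \<in> neighbors G u)) = d"
      using finite_V card_neighbors[of x] \<open>x \<in> X\<close> assms by auto
  qed
  finally show ?thesis by (simp add: mult.commute)
qed

lemma nbr_count_side:
  assumes "\<And>u v. (u, v) \<in> parcs G \<Longrightarrow> side u \<noteq> (side v :: bool)" and "u \<in> V"
  shows "nbr_count G {v \<in> V. side v} u = (if side u then 0 else d)"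
proof -
  have "neighbors G u \<inter> {v \<in> V. side v} = (if side u then {} else neighbors G u)"
    using assms(1) arc_verts by (auto simp: neighbors_def)
  then show ?thesis using card_neighbors[OF assms(2)] by (simp add: nbr_count_def)
qed

lemma card_sides_eq:
  assumes "\<And>u v. (u, v) \<in> parcs G \<Longrightarrow> side u \<noteq> (side v :: bool)"
  shows "card {v \<in> V. side v} = card {v \<in> V. \<not> side v}"
proof -
  have "d * card {v \<in> V. side v} = (\<Sum>u\<in>V. if side u then 0 else d)"
    using nbr_count_side[OF assms] by (subst sum_nbr_count[symmetric]) auto
  also have "\<dots> = d * card {v \<in> V. \<not> side v}"
    using finite_V by (simp add: sum.If_cases Int_def)
  finally show ?thesis using degree_pos by simp
qed

lemma card_independent_set:
  assumes "A \<subseteq> V" "\<And>u. u \<in> A \<Longrightarrow> neighbors G u \<inter> A = {}"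
  shows "2 * card A \<le> card V"
proof -
  have "nbr_count G A u + (if u \<in> A then d else 0) \<le> d" if "u \<in> V" for u
    using assms(2) card_mono[OF finite_neighbors, of "neighbors G u \<inter> A" u] card_neighbors[OF that]
    by (auto simp: nbr_count_def)
  then have "(\<Sum>u\<in>V. nbr_count G A u + (if u \<in> A then d else 0)) \<le> (\<Sum>u\<in>V. d)"
    by (rule sum_mono)
  then have "d * card A + d * card A \<le> d * card V"
    using sum_nbr_count[OF assms(1)] finite_V assms(1)
    by (simp add: sum.distrib sum.If_cases Int_absorb1 mult.commute)
  then have "d * (2 * card A) \<le> d * card V" by (simp only: mult_2 distrib_left)
  then show ?thesis using degree_pos by simp
qed

lemma card_exact_cover:
  assumes "exact_cover G S"
  shows "2 * d * card S = card V"
proof -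
  define side where "side u \<longleftrightarrow> nbr_count G S u = 0" for u
  have count: "nbr_count G S u = (if side u then 0 else 1)" if "u \<in> V" for u
    using assms that by (auto simp: exact_cover_def side_def le_Suc_eq)
  have "side u \<noteq> side v" if "(u, v) \<in> parcs G" for u v
  proof -
    have "nbr_count G S u \<noteq> nbr_count G S v"
      using assms that by (auto simp: exact_cover_def dest: nbr_separatingD)
    then show ?thesis using arc_verts[OF that] count[of u] count[of v] by metis
  qed
  then have sides: "card {u \<in> V. side u} = card {u \<in> V. \<not> side u}" by (rule card_sides_eq)
  have "d * card S = (\<Sum>u\<in>V. if side u then 0 else 1)"
    using assms count by (subst sum_nbr_count[symmetric]) (auto simp: exact_cover_def)
  also have "\<dots> = card {u \<in> V. \<not> side u}"
    using finite_V by (simp add: sum.If_cases Int_def)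
  moreover have "card V = card {u \<in> V. side u} + card {u \<in> V. \<not> side u}"
    using finite_V by (subst card_Un_disjoint[symmetric]) (auto intro: arg_cong[of _ _ card])
  ultimately show ?thesis using sides by simp
qed

lemma exact_cover_if_small:
  assumes "S \<subseteq> V" "nbr_separating G S" "2 * d * card S \<le> card V"
  shows "exact_cover G S"
proof -
  let ?A = "{u \<in> V. nbr_count G S u = 0}"
  have half: "2 * card ?A \<le> card V"
  proof (rule card_independent_set)
    show "neighbors G u \<inter> ?A = {}" if "u \<in> ?A" for u
      using that nbr_separatingD[OF assms(2)] by (force simp: neighbors_def)
  qed simp
  have "nbr_count G S u \<le> 1" if "u \<in> V" for u
  proof (rule ccontr)
    assume "\<not> nbr_count G S u \<le> 1"
    then have "(\<Sum>v\<in>V. of_bool (nbr_count G S v > 0)) < (\<Sum>v\<in>V. nbr_count G S v)"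
      using \<open>u \<in> V\<close> by (intro sum_strict_mono_ex1) (auto simp: finite_V intro!: bexI[of _ u])
    moreover have "V \<inter> {v. nbr_count G S v > 0} = V - ?A" by auto
    ultimately have "card (V - ?A) < d * card S"
      using sum_nbr_count[OF assms(1)] finite_V by simp
    then show False
      using half assms(3) card_Diff_subset[of ?A V] finite_V by simp
  qed
  then show ?thesis using assms(1,2) by (auto simp: exact_cover_def)
qed

lemma exact_cover_iff_small:
  "exact_cover G S \<longleftrightarrow> S \<subseteq> V \<and> nbr_separating G S \<and> 2 * d * card S \<le> card V"
  using exact_cover_if_small card_exact_cover by (auto simp: exact_cover_def)

lemma sigma_coloring_indicator:
  "sigma_coloring G (\<lambda>v. of_bool (v \<in> S)) \<longleftrightarrow> nbr_separating G S"
  unfolding sigma_coloring_def nbr_separating_def sum_indicator_neighbors ..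

lemma indicator_image_if_separating:
  assumes "V \<noteq> {}" "nbr_separating G S"
  shows "(\<lambda>v. of_bool (v \<in> S)) ` V = {0, 1 :: nat}"
proof -
  obtain u v where arc: "(u, v) \<in> parcs G" using ex_arc[OF assms(1)] .
  have "nbr_count G S u \<noteq> nbr_count G S v" using assms(2) arc by (rule nbr_separatingD)
  moreover have "nbr_count G S w = 0" if "V \<inter> S = {}" for w
    using that neighbors_subset[of w] by (auto simp: nbr_count_def card_eq_0_iff)
  moreover have "nbr_count G S w = d" if "V \<subseteq> S" "w \<in> V" for w
    using that neighbors_subset[of w] card_neighbors[of w] by (auto simp: nbr_count_def Int_absorb2)
  ultimately have "V \<inter> S \<noteq> {}" "\<not> V \<subseteq> S" using arc_verts[OF arc] by metis+
  then show ?thesis by (auto simp: image_iff)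
qed

lemma sum_two_labels:
  assumes "u \<in> V" "\<And>v. v \<in> V \<Longrightarrow> c v = (if v \<in> S then l else l')"
  shows "(\<Sum>w\<in>neighbors G u. c w) = nbr_count G S u * l + (d - nbr_count G S u) * (l' :: nat)"
proof -
  have "(\<Sum>w\<in>neighbors G u. c w) = (\<Sum>w\<in>neighbors G u. if w \<in> S then l else l')"
    using assms(2) neighbors_subset[of u] by (intro sum.cong refl) auto
  also have "\<dots> = nbr_count G S u * l + card (neighbors G u - S) * l'"
    using finite_neighbors[of u] by (simp add: sum.If_cases nbr_count_def Diff_eq)
  also have "card (neighbors G u - S) = d - nbr_count G S u"
    using card_Diff_subset_Int[of "neighbors G u" S] finite_neighbors[of u] card_neighbors[OF assms(1)]
    by (simp add: nbr_count_def)
  finally show ?thesis .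
qed

lemma nbr_separating_label_class:
  assumes "sigma_coloring G c" "card (c ` V) = 2" "l \<in> c ` V"
  shows "nbr_separating G {v \<in> V. c v = l}"
proof -
  obtain k k' where "c ` V = {k, k'}" using assms(2) by (auto simp: card_2_iff)
  then obtain l' where "c ` V = {l, l'}" using assms(3) by auto
  then have labels: "c v = (if v \<in> {v \<in> V. c v = l} then l else l')" if "v \<in> V" for v
    using that by auto
  show ?thesis
    using assms(1) arc_verts sum_two_labels[OF _ labels]
    by (fastforce simp: nbr_separating_def sigma_coloring_def)
qed

lemma card_labels_ge_2:
  assumes "V \<noteq> {}" "sigma_coloring G c"
  shows "2 \<le> card (c ` V)"
proof (rule ccontr)
  assume "\<not> 2 \<le> card (c ` V)"
  then have "card (c ` V) \<le> Suc 0" by simp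
  then have "\<forall>l\<in>c ` V. \<forall>l'\<in>c ` V. l = l'"
    by (simp only: card_le_Suc0_iff_eq[OF finite_imageI[OF finite_V]])
  then have const: "c v = c w" if "v \<in> V" "w \<in> V" for v w
    using imageI[OF that(1)] imageI[OF that(2)] by meson
  obtain u v where arc: "(u, v) \<in> parcs G" using ex_arc[OF assms(1)] .
  have "(\<Sum>w\<in>neighbors G x. c w) = d * c u" if "x \<in> V" for x
  proof -
    have "(\<Sum>w\<in>neighbors G x. c w) = (\<Sum>w\<in>neighbors G x. c u)"
      using const arc_verts[OF arc] neighbors_subset[of x] by (intro sum.cong refl) blast
    then show ?thesis using card_neighbors[OF that] by simp
  qed
  then show False using assms(2) arc arc_verts[OF arc] by (auto simp: sigma_coloring_def)
qed

lemma sigma_chromatic_number_if_separating: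
  assumes "V \<noteq> {}" "nbr_separating G S"
  shows "sigma_chromatic_number G = 2"
  unfolding sigma_chromatic_number_def
proof (rule Least_equality)
  show "\<exists>c. sigma_coloring G c \<and> card (c ` V) = 2"
    using sigma_coloring_indicator indicator_image_if_separating[OF assms] assms(2)
    by (intro exI[of _ "\<lambda>v. of_bool (v \<in> S)"]) simp
qed (use card_labels_ge_2[OF assms(1)] in blast)

lemma sigma_chromatic_number_bipartite:
  assumes "V \<noteq> {}" "bipartite G"
  shows "sigma_chromatic_number G = 2"
proof -
  obtain side where side: "\<And>u v. (u, v) \<in> parcs G \<Longrightarrow> side u \<noteq> (side v :: bool)"
    using assms(2) by (auto simp: bipartite_def)
  have "nbr_count G {w \<in> V. side w} u \<noteq> nbr_count G {w \<in> V. side w} v" if "(u, v) \<in> parcs G" for u v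
    using side[OF that] arc_verts[OF that] nbr_count_side[of side, OF side] degree_pos by simp
  then have "nbr_separating G {v \<in> V. side v}" by (auto simp: nbr_separating_def)
  with assms(1) show ?thesis by (rule sigma_chromatic_number_if_separating)
qed

end

lemma Theta_question_iff_separating:
  assumes "regular_pair_graph G d" "pverts G \<noteq> {}" "sigma_chromatic_number G = 2"
  shows "Theta_question G r \<longleftrightarrow>
    (\<exists>S\<subseteq>pverts G. nbr_separating G S \<and> of_nat (card S) \<le> r * of_nat (card (pverts G)))"
proof -
  interpret regular_pair_graph G d by fact
  show ?thesis
  proof
    assume "Theta_question G r"
    then obtain c l where "sigma_coloring G c" "card (c ` V) = 2" "l \<in> c ` V"
      and small: "of_nat (card {v \<in> V. c v = l}) \<le> r * of_nat (card V)"
      using assms(3) by (auto simp: Theta_question_def)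
    from nbr_separating_label_class[OF this(1-3)] small
    show "\<exists>S\<subseteq>V. nbr_separating G S \<and> of_nat (card S) \<le> r * of_nat (card V)"
      by (intro exI[of _ "{v \<in> V. c v = l}"]) simp
  next
    assume "\<exists>S\<subseteq>V. nbr_separating G S \<and> of_nat (card S) \<le> r * of_nat (card V)"
    then obtain S where S: "S \<subseteq> V" "nbr_separating G S" "of_nat (card S) \<le> r * of_nat (card V)"
      by blast
    let ?c = "\<lambda>v. of_bool (v \<in> S) :: nat"
    have "{v \<in> V. ?c v = 1} = S" using S(1) by auto
    moreover have "?c ` V = {0, 1}" using assms(2) S(2) by (rule indicator_image_if_separating)
    ultimately show "Theta_question G r"
      unfolding Theta_question_def assms(3)
      using S(3) sigma_coloring_indicator S(2) by (intro exI[of _ ?c]) simp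
  qed
qed

lemma Theta_question_sixth_iff:
  assumes "regular_pair_graph G 3" "pverts G \<noteq> {}" "sigma_chromatic_number G = 2"
  shows "Theta_question G (1 / 6) \<longleftrightarrow> (\<exists>S. exact_cover G S)"
proof -
  interpret regular_pair_graph G 3 by fact
  have "of_nat (card S) \<le> (1 / 6 :: rat) * of_nat (card V) \<longleftrightarrow> 2 * 3 * card S \<le> card V" for S
  proof -
    have "of_nat (card S) \<le> (1 / 6 :: rat) * of_nat (card V) \<longleftrightarrow>
        of_nat (2 * 3 * card S) \<le> (of_nat (card V) :: rat)"
      by (simp add: field_simps)
    then show ?thesis by (simp only: of_nat_le_iff)
  qed
  then show ?thesis
    unfolding Theta_question_iff_separating[OF assms, of "1 / 6"] exact_cover_iff_small by auto
qed

subsection \<open>Plane drawings\<close>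

lemma plane_drawing_arc:
  assumes "plane_drawing G pos \<gamma>" "(u, v) \<in> parcs G"
  shows "arc (\<gamma> {u, v}) \<and> {pathstart (\<gamma> {u, v}), pathfinish (\<gamma> {u, v})} = {pos u, pos v} \<and>
    path_image (\<gamma> {u, v}) \<inter> pos ` pverts G = {pos u, pos v}"
proof -
  have "\<forall>(u, v)\<in>parcs G. arc (\<gamma> {u, v}) \<and>
      {pathstart (\<gamma> {u, v}), pathfinish (\<gamma> {u, v})} = {pos u, pos v} \<and>
      path_image (\<gamma> {u, v}) \<inter> pos ` pverts G = {pos u, pos v}"
    using assms(1) unfolding plane_drawing_def by (elim conjE)
  from bspec[OF this assms(2)] show ?thesis by simp
qed

lemma plane_drawing_crossing:
  assumes "plane_drawing G pos \<gamma>" "(u, v) \<in> parcs G" "(x, y) \<in> parcs G" "{u, v} \<noteq> {x, y}"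
  shows "path_image (\<gamma> {u, v}) \<inter> path_image (\<gamma> {x, y}) \<subseteq> pos ` pverts G"
proof -
  have "\<forall>(u, v)\<in>parcs G. \<forall>(x, y)\<in>parcs G. {u, v} \<noteq> {x, y} \<longrightarrow>
      path_image (\<gamma> {u, v}) \<inter> path_image (\<gamma> {x, y}) \<subseteq> pos ` pverts G"
    using assms(1) unfolding plane_drawing_def by (elim conjE)
  from bspec[OF bspec[OF this assms(2), unfolded prod.case] assms(3)] assms(4) show ?thesis by simp
qed

lemma ex_linepath_between:
  fixes pos :: "'a \<Rightarrow> complex"
  shows "\<exists>\<gamma>. \<forall>u v. \<gamma> {u, v} = linepath (pos u) (pos v) \<or> \<gamma> {u, v} = linepath (pos v) (pos u)"
proof (intro exI allI)
  let ?ends = "\<lambda>e. SOME (a, b). e = {a, b}"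
  fix u v :: 'a
  have "case ?ends {u, v} of (a, b) \<Rightarrow> {u, v} = {a, b}" by (rule someI[of _ "(u, v)"]) simp
  then show "(case ?ends {u, v} of (a, b) \<Rightarrow> linepath (pos a) (pos b)) = linepath (pos u) (pos v) \<or>
      (case ?ends {u, v} of (a, b) \<Rightarrow> linepath (pos a) (pos b)) = linepath (pos v) (pos u)"
    by (auto simp: doubleton_eq_iff split: prod.splits)
qed

lemma (in pair_graph) planar_graph_straight_line:
  fixes pos :: "'a \<Rightarrow> complex"
  assumes inj: "inj_on pos (pverts G)"
    and nonisolated: "\<And>u. u \<in> pverts G \<Longrightarrow> neighbors G u \<noteq> {}"
    and crossing: "\<And>u v x y. (u, v) \<in> parcs G \<Longrightarrow> (x, y) \<in> parcs G \<Longrightarrow> {u, v} \<noteq> {x, y} \<Longrightarrow>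
      closed_segment (pos u) (pos v) \<inter> closed_segment (pos x) (pos y) \<subseteq> pos ` ({u, v} \<inter> {x, y})"
  shows "planar_graph G"
proof -
  obtain \<gamma> :: "'a set \<Rightarrow> real \<Rightarrow> complex"
    where \<gamma>: "\<And>u v. \<gamma> {u, v} = linepath (pos u) (pos v) \<or> \<gamma> {u, v} = linepath (pos v) (pos u)"
    using ex_linepath_between[of pos] by blast
  have image: "path_image (\<gamma> {u, v}) = closed_segment (pos u) (pos v)" for u v
    using \<gamma>[of u v] by (auto simp: closed_segment_commute)
  have ends_only: "w \<in> {u, v}"
    if arc: "(u, v) \<in> parcs G" and w: "w \<in> pverts G" "pos w \<in> closed_segment (pos u) (pos v)" for u v w
  proof (rule ccontr)
    assume "w \<notin> {u, v}"
    obtain x where x: "(w, x) \<in> parcs G" using nonisolated[OF w(1)] by (auto simp: neighbors_def)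
    then have "pos w \<in> pos ` ({u, v} \<inter> {w, x})"
      using crossing[OF arc x] w(2) \<open>w \<notin> {u, v}\<close> by fastforce
    then show False
      using \<open>w \<notin> {u, v}\<close> inj_onD[OF inj] w(1) arc_verts[OF arc] by auto
  qed
  have "plane_drawing G pos \<gamma>"
    unfolding plane_drawing_def image
  proof (intro conjI ballI; clarify?)
    fix u v assume arc: "(u, v) \<in> parcs G"
    have "pos u \<noteq> pos v" using inj_onD[OF inj] arc_verts[OF arc] no_loops' arc by metis
    then show "Path_Connected.arc (\<gamma> {u, v}) \<and> {pathstart (\<gamma> {u, v}), pathfinish (\<gamma> {u, v})} = {pos u, pos v} \<and>
        closed_segment (pos u) (pos v) \<inter> pos ` pverts G = {pos u, pos v}"
      using \<gamma>[of u v] ends_only[OF arc] arc_verts[OF arc] by (auto intro: arc_linepath)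
  next
    fix u v x y z
    assume "(u, v) \<in> parcs G" "(x, y) \<in> parcs G" "{u, v} \<noteq> {x, y}"
      and "z \<in> closed_segment (pos u) (pos v)" "z \<in> closed_segment (pos x) (pos y)"
    then show "z \<in> pos ` pverts G" using crossing arc_verts by blast
  qed (rule inj)
  then show ?thesis by (auto simp: planar_graph_def)
qed

subsection \<open>Relabelling\<close>

definition relabel :: "('a \<Rightarrow> 'b) \<Rightarrow> 'a pair_pre_digraph \<Rightarrow> 'b pair_pre_digraph" where
  "relabel f G = \<lparr>pverts = f ` pverts G, parcs = map_prod f f ` parcs G\<rparr>"

locale relabelling = pair_graph G for G :: "'a pair_pre_digraph" +
  fixes f :: "'a \<Rightarrow> 'b"
  assumes inj: "inj_on f (pverts G)"
begin

lemma pverts_relabel [simp]: "pverts (relabel f G) = f ` pverts G"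
  by (simp add: relabel_def)

lemma arc_relabelE:
  assumes "(x, y) \<in> parcs (relabel f G)"
  obtains u v where "x = f u" "y = f v" "(u, v) \<in> parcs G" "u \<in> pverts G" "v \<in> pverts G"
  using assms arc_verts by (auto simp: relabel_def)

lemma arc_relabel_iff:
  assumes "u \<in> pverts G" "v \<in> pverts G"
  shows "(f u, f v) \<in> parcs (relabel f G) \<longleftrightarrow> (u, v) \<in> parcs G"
proof
  assume "(f u, f v) \<in> parcs (relabel f G)"
  then show "(u, v) \<in> parcs G" using inj_onD[OF inj] assms by (auto elim!: arc_relabelE)
qed (auto simp: relabel_def)

lemma neighbors_relabel: "u \<in> pverts G \<Longrightarrow> neighbors (relabel f G) (f u) = f ` neighbors G u"
  using arc_verts inj_onD[OF inj] by (fastforce simp: neighbors_def relabel_def)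

lemma pair_graph_relabel: "pair_graph (relabel f G)"
proof (rule pair_graphI)
  show "(y, x) \<in> parcs (relabel f G)" if "(x, y) \<in> parcs (relabel f G)" for x y
    using that arc_sym by (auto elim!: arc_relabelE simp: arc_relabel_iff)
  show "(x, x) \<notin> parcs (relabel f G)" for x
  proof
    assume "(x, x) \<in> parcs (relabel f G)"
    then obtain u v where "x = f u" "x = f v" "(u, v) \<in> parcs G" by (rule arc_relabelE)
    moreover from this have "u = v" using inj_onD[OF inj] arc_verts by blast
    ultimately show False using no_loops' by blast
  qed
qed (use arc_verts pair_finite_verts in \<open>auto simp: relabel_def\<close>)

lemma nbr_count_relabel:
  assumes "u \<in> pverts G" "S \<subseteq> pverts G"
  shows "nbr_count (relabel f G) (f ` S) (f u) = nbr_count G S u"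
proof -
  have "f ` neighbors G u \<inter> f ` S = f ` (neighbors G u \<inter> S)"
    using inj_on_image_Int[OF inj neighbors_subset assms(2)] by simp
  moreover have "inj_on f (neighbors G u \<inter> S)" using inj assms(2) by (auto intro: inj_on_subset)
  ultimately show ?thesis by (simp add: nbr_count_def neighbors_relabel[OF assms(1)] card_image)
qed

lemma regular_graph_relabel:
  assumes "regular_graph d G"
  shows "regular_graph d (relabel f G)"
  using assms neighbors_relabel card_image[OF inj_on_subset[OF inj neighbors_subset]]
  by (auto simp: regular_graph_def out_degree_eq_card_neighbors)

lemma bipartite_relabel:
  assumes "bipartite G"
  shows "bipartite (relabel f G)"
proof -
  obtain side :: "'a \<Rightarrow> bool" where "\<And>u v. (u, v) \<in> parcs G \<Longrightarrow> side u \<noteq> side v"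
    using assms by (auto simp: bipartite_def)
  then show ?thesis
    unfolding bipartite_def
    by (intro exI[of _ "side \<circ> inv_into (pverts G) f"])
      (auto elim!: arc_relabelE simp: inv_into_f_f[OF inj])
qed

lemma exact_cover_relabel:
  assumes "S \<subseteq> pverts G"
  shows "exact_cover (relabel f G) (f ` S) \<longleftrightarrow> exact_cover G S"
proof -
  have "nbr_separating (relabel f G) (f ` S) \<longleftrightarrow> nbr_separating G S"
    unfolding nbr_separating_def relabel_def[of f G]
    using assms arc_verts nbr_count_relabel[OF _ assms] unfolding relabel_def by fastforce
  then show ?thesis using assms by (auto simp: exact_cover_def nbr_count_relabel)
qed

lemma ex_exact_cover_relabel: "(\<exists>S. exact_cover (relabel f G) S) \<longleftrightarrow> (\<exists>S. exact_cover G S)"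
proof
  assume "\<exists>S. exact_cover (relabel f G) S"
  then obtain S where S: "S \<subseteq> f ` pverts G" "exact_cover (relabel f G) S"
    by (auto simp: exact_cover_def)
  obtain S' where "S' \<subseteq> pverts G" "S = f ` S'" using S(1) by (rule subset_imageE)
  then show "\<exists>S. exact_cover G S" using S(2) exact_cover_relabel by blast
next
  assume "\<exists>S. exact_cover G S"
  then obtain S where "exact_cover G S" "S \<subseteq> pverts G" by (auto simp: exact_cover_def)
  then show "\<exists>S. exact_cover (relabel f G) S" using exact_cover_relabel by blast
qed

lemma planar_graph_relabel:
  assumes "planar_graph G"
  shows "planar_graph (relabel f G)"
proof -
  obtain pos \<gamma> where drawing: "plane_drawing G pos \<gamma>" using assms by (auto simp: planar_graph_def)
  let ?g = "inv_into (pverts G) f"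
  have g: "?g (f u) = u" if "u \<in> pverts G" for u using inv_into_f_f[OF inj that] .
  have vertices: "(\<lambda>x. pos (?g x)) ` f ` pverts G = pos ` pverts G"
    using g by (auto simp: image_image)
  have "plane_drawing (relabel f G) (pos \<circ> ?g) (\<lambda>e. \<gamma> (?g ` e))"
    unfolding plane_drawing_def
  proof (intro conjI ballI; (clarify elim!: arc_relabelE)?)
    show "inj_on (pos \<circ> ?g) (pverts (relabel f G))"
      using drawing g by (auto simp: plane_drawing_def inj_on_def)
  next
    fix u v assume "(u, v) \<in> parcs G" and verts: "u \<in> pverts G" "v \<in> pverts G"
    from plane_drawing_arc[OF drawing this(1)] show "Path_Connected.arc (\<gamma> (?g ` {f u, f v})) \<and>
        {pathstart (\<gamma> (?g ` {f u, f v})), pathfinish (\<gamma> (?g ` {f u, f v}))} =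
          {(pos \<circ> ?g) (f u), (pos \<circ> ?g) (f v)} \<and>
        path_image (\<gamma> (?g ` {f u, f v})) \<inter> (pos \<circ> ?g) ` pverts (relabel f G) =
          {(pos \<circ> ?g) (f u), (pos \<circ> ?g) (f v)}"
      by (simp add: g[OF verts(1)] g[OF verts(2)] vertices)
  next
    fix u v x y z
    assume arcs: "(u, v) \<in> parcs G" "(x, y) \<in> parcs G" and "{f u, f v} \<noteq> {f x, f y}"
      and verts: "u \<in> pverts G" "v \<in> pverts G" "x \<in> pverts G" "y \<in> pverts G"
      and z: "z \<in> path_image (\<gamma> (?g ` {f u, f v}))" "z \<in> path_image (\<gamma> (?g ` {f x, f y}))"
    from this(3) have "{u, v} \<noteq> {x, y}" using arg_cong[of "{u, v}" "{x, y}" "image f"] by auto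
    with drawing arcs have "path_image (\<gamma> {u, v}) \<inter> path_image (\<gamma> {x, y}) \<subseteq> pos ` pverts G"
      by (rule plane_drawing_crossing)
    then show "z \<in> (pos \<circ> ?g) ` pverts (relabel f G)" using z verts by (auto simp: g vertices)
  qed
  then show ?thesis by (auto simp: planar_graph_def)
qed

end

section \<open>Counter programs and their compilation to Turing machines\<close>

datatype cmd =
    Inc nat
  | Dec nat
  | Out bool
  | While nat nat "cmd list"
  | If nat nat "cmd list" "cmd list"

text \<open>
  The tape of register \<open>r\<close> never changes: the value of the register is the position of its head.
  Symbol 3 marks position 0, and register 0 additionally scans the input, shifted by one position.
  \<open>While r a c\<close> iterates \<open>c\<close> until register \<open>r\<close> scans the symbol \<open>a\<close>.
\<close>

definition reg_symbol :: "bool list \<Rightarrow> nat \<Rightarrow> nat \<Rightarrow> nat" where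
  "reg_symbol x r v =
     (if v = 0 then 3 else if r = 0 \<and> v \<le> length x then (if x ! (v - 1) then 2 else 1) else 0)"

lemma reg_symbol_eq_3 [simp]: "reg_symbol x r v = 3 \<longleftrightarrow> v = 0"
  by (auto simp: reg_symbol_def)

type_synonym pstate = "(nat \<Rightarrow> nat) \<times> bool list"

fun guard :: "(nat \<Rightarrow> nat) \<Rightarrow> cmd \<Rightarrow> bool" where
  "guard scan (While r a c) \<longleftrightarrow> scan r = a"
| "guard scan (If r a c d) \<longleftrightarrow> scan r = a"
| "guard scan _ \<longleftrightarrow> False"

fun successor :: "bool \<Rightarrow> cmd list \<Rightarrow> cmd list" where
  "successor b [] = []"
| "successor b (While r a c # k) = (if b then k else c @ While r a c # k)"
| "successor b (If r a c d # k) = (if b then c else d) @ k"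
| "successor b (a # k) = k"

fun effect :: "cmd \<Rightarrow> pstate \<Rightarrow> pstate" where
  "effect (Inc r) (s, z) = (s(r := Suc (s r)), z)"
| "effect (Dec r) (s, z) = (s(r := s r - 1), z)"
| "effect (Out b) (s, z) = (s, z @ [b])"
| "effect _ \<sigma> = \<sigma>"

fun pstep :: "bool list \<Rightarrow> cmd list \<times> pstate \<Rightarrow> cmd list \<times> pstate" where
  "pstep x ([], \<sigma>) = ([], \<sigma>)"
| "pstep x (a # k, \<sigma>) =
     (successor (guard (\<lambda>r. reg_symbol x r (fst \<sigma> r)) a) (a # k), effect a \<sigma>)"

definition exec :: "bool list \<Rightarrow> cmd list \<Rightarrow> pstate \<Rightarrow> nat \<Rightarrow> pstate \<Rightarrow> bool" where
  "exec x c \<sigma> T \<sigma>' \<longleftrightarrow> (\<exists>t\<le>T. \<forall>k. (pstep x ^^ t) (c @ k, \<sigma>) = (k, \<sigma>'))"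

lemma exec_mono: "exec x c \<sigma> T \<sigma>' \<Longrightarrow> T \<le> T' \<Longrightarrow> exec x c \<sigma> T' \<sigma>'"
  unfolding exec_def using le_trans by blast

lemma exec_Nil: "exec x [] \<sigma> 0 \<sigma>"
  unfolding exec_def by (intro exI[of _ 0]) simp

lemma exec_append:
  assumes "exec x c \<sigma> T \<sigma>'" "exec x d \<sigma>' T' \<sigma>''"
  shows "exec x (c @ d) \<sigma> (T + T') \<sigma>''"
proof -
  obtain t t' where t: "t \<le> T" "\<And>k. (pstep x ^^ t) (c @ k, \<sigma>) = (k, \<sigma>')"
    and t': "t' \<le> T'" "\<And>k. (pstep x ^^ t') (d @ k, \<sigma>') = (k, \<sigma>'')"
    using assms unfolding exec_def by blast
  have "(pstep x ^^ (t' + t)) ((c @ d) @ k, \<sigma>) = (k, \<sigma>'')" for k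
    using t(2)[of "d @ k"] t'(2)[of k] by (simp add: funpow_add)
  then show ?thesis unfolding exec_def using t(1) t'(1) by (intro exI[of _ "t' + t"]) auto
qed

lemma exec_Cons:
  assumes "exec x [a] \<sigma> T \<sigma>'" "exec x d \<sigma>' T' \<sigma>''"
  shows "exec x (a # d) \<sigma> (T + T') \<sigma>''"
  using exec_append[OF assms] by simp

lemma exec_Inc: "exec x [Inc r] (s, z) 1 (s(r := Suc (s r)), z)"
  and exec_Dec: "exec x [Dec r] (s, z) 1 (s(r := s r - 1), z)"
  and exec_Out: "exec x [Out b] (s, z) 1 (s, z @ [b])"
  unfolding exec_def by (auto intro!: exI[of _ 1])

lemma exec_first_step:
  assumes "\<And>k. pstep x (c @ k, \<sigma>) = (d @ k, \<sigma>)" "exec x d \<sigma> T \<sigma>'"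
  shows "exec x c \<sigma> (Suc T) \<sigma>'"
proof -
  obtain t where t: "t \<le> T" "\<And>k. (pstep x ^^ t) (d @ k, \<sigma>) = (k, \<sigma>')"
    using assms unfolding exec_def by blast
  have "(pstep x ^^ Suc t) (c @ k, \<sigma>) = (k, \<sigma>')" for k
    by (simp add: funpow_Suc_right assms(1) t(2) del: funpow.simps)
  then show ?thesis unfolding exec_def using t(1) by (intro exI[of _ "Suc t"]) auto
qed

lemma exec_If:
  assumes "exec x (if reg_symbol x r (s r) = a then c else d) (s, z) T \<sigma>'"
  shows "exec x [If r a c d] (s, z) (Suc T) \<sigma>'"
  by (rule exec_first_step[OF _ assms]) simp

lemma exec_While_stop:
  assumes "reg_symbol x r (fst \<sigma> r) = a"
  shows "exec x [While r a c] \<sigma> 1 \<sigma>"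
  using exec_first_step[of x "[While r a c]" \<sigma> "[]", OF _ exec_Nil] assms by simp

lemma exec_While_step:
  assumes "reg_symbol x r (fst \<sigma> r) \<noteq> a" "exec x c \<sigma> T \<sigma>'" "exec x [While r a c] \<sigma>' T' \<sigma>''"
  shows "exec x [While r a c] \<sigma> (Suc (T + T')) \<sigma>''"
  by (rule exec_first_step[OF _ exec_append[OF assms(2,3)]]) (use assms(1) in simp)

lemma exec_While_iterate:
  assumes "\<And>j. j < N \<Longrightarrow> reg_symbol x r (fst (\<sigma> j) r) \<noteq> a"
    and "reg_symbol x r (fst (\<sigma> N) r) = a"
    and body: "\<And>j. j < N \<Longrightarrow> exec x c (\<sigma> j) D (\<sigma> (Suc j))"
  shows "exec x [While r a c] (\<sigma> 0) (N * Suc D + 1) (\<sigma> N)"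
proof -
  have "exec x [While r a c] (\<sigma> j) ((N - j) * Suc D + 1) (\<sigma> N)" if "j \<le> N" for j
    using that
  proof (induction rule: inc_induct)
    case base
    then show ?case using exec_While_stop[of x r "\<sigma> N" a c] assms(2) by simp
  next
    case (step j)
    have "exec x [While r a c] (\<sigma> j) (Suc (D + ((N - Suc j) * Suc D + 1))) (\<sigma> N)"
      using assms(1) body step by (intro exec_While_step)
    moreover have "N - j = Suc (N - Suc j)" using step by simp
    ultimately show ?case by (auto intro: exec_mono)
  qed
  from this[of 0] show ?thesis by simp
qed

lemma exec_While_countdown:
  assumes "\<And>j. j \<le> N \<Longrightarrow> fst (\<sigma> j) r = N - j"
    and "\<And>j. j < N \<Longrightarrow> exec x c (\<sigma> j) D (\<sigma> (Suc j))"
  shows "exec x [While r 3 c] (\<sigma> 0) (N * Suc D + 1) (\<sigma> N)"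
  by (rule exec_While_iterate) (use assms in auto)

lemma exec_map_Inc:
  assumes "distinct bs"
  shows "exec x (map Inc bs) (s, z) (length bs) (\<lambda>r. if r \<in> set bs then Suc (s r) else s r, z)"
  using assms
proof (induction bs arbitrary: s)
  case (Cons b bs)
  have "exec x (Inc b # map Inc bs) (s, z) (1 + length bs)
      (\<lambda>r. if r \<in> set bs then Suc ((s(b := Suc (s b))) r) else (s(b := Suc (s b))) r, z)"
    using Cons by (intro exec_Cons[OF exec_Inc]) simp
  moreover have "(\<lambda>r. if r \<in> set bs then Suc ((s(b := Suc (s b))) r) else (s(b := Suc (s b))) r) =
      (\<lambda>r. if r \<in> set (b # bs) then Suc (s r) else s r)"
    using Cons.prems by (auto simp: fun_eq_iff)
  ultimately show ?case by simp
qed (simp add: exec_Nil)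

lemma exec_transfer:
  assumes "distinct (a # bs)"
  shows "exec x [While a 3 (Dec a # map Inc bs)] (s, z) ((length bs + 2) * s a + 1)
    (\<lambda>r. if r = a then 0 else if r \<in> set bs then s r + s a else s r, z)"
proof -
  define \<sigma> where
    "\<sigma> j = (\<lambda>r. if r = a then s a - j else if r \<in> set bs then s r + j else s r, z)" for j
  have "exec x (Dec a # map Inc bs) (\<sigma> j) (1 + length bs) (\<sigma> (Suc j))" if "j < s a" for j
  proof -
    let ?s = "(fst (\<sigma> j))(a := fst (\<sigma> j) a - 1)"
    have "exec x (Dec a # map Inc bs) (fst (\<sigma> j), z) (1 + length bs)
        (\<lambda>r. if r \<in> set bs then Suc (?s r) else ?s r, z)"
      using assms by (intro exec_Cons[OF exec_Dec] exec_map_Inc) simp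
    moreover have "(\<lambda>r. if r \<in> set bs then Suc (?s r) else ?s r, z) = \<sigma> (Suc j)"
      using assms by (auto simp: \<sigma>_def fun_eq_iff)
    ultimately show ?thesis by (simp add: \<sigma>_def)
  qed
  then have "exec x [While a 3 (Dec a # map Inc bs)] (\<sigma> 0) (s a * Suc (1 + length bs) + 1) (\<sigma> (s a))"
    by (intro exec_While_countdown) (simp_all add: \<sigma>_def)
  moreover have "\<sigma> 0 = (s, z)" by (simp add: \<sigma>_def fun_eq_iff)
  moreover have "\<sigma> (s a) = (\<lambda>r. if r = a then 0 else if r \<in> set bs then s r + s a else s r, z)"
    by (auto simp: \<sigma>_def)
  ultimately show ?thesis by (simp add: mult.commute)
qed

lemma exec_clear: "exec x [While a 3 [Dec a]] (s, z) (2 * s a + 1) (s(a := 0), z)"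
  using exec_transfer[of a "[]" x s z] by (simp add: fun_upd_def eval_nat_numeral cong: if_cong)

lemma exec_move:
  assumes "a \<noteq> b"
  shows "exec x [While a 3 [Dec a, Inc b]] (s, z) (3 * s a + 1) (s(a := 0, b := s b + s a), z)"
proof -
  have "(\<lambda>r. if r = a then 0 else if r \<in> set [b] then s r + s a else s r) = s(a := 0, b := s b + s a)"
    using assms by (auto simp: fun_eq_iff)
  then show ?thesis using exec_transfer[of a "[b]" x s z] assms by (simp add: eval_nat_numeral)
qed

lemma exec_move_twice:
  assumes "distinct [a, b, c]"
  shows "exec x [While a 3 [Dec a, Inc b, Inc c]] (s, z) (4 * s a + 1)
    (s(a := 0, b := s b + s a, c := s c + s a), z)"
proof -
  have "(\<lambda>r. if r = a then 0 else if r \<in> set [b, c] then s r + s a else s r) =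
      s(a := 0, b := s b + s a, c := s c + s a)"
    using assms by (auto simp: fun_eq_iff)
  then show ?thesis using exec_transfer[of a "[b, c]" x s z] assms by (simp add: eval_nat_numeral)
qed

subsection \<open>Compilation\<close>

text \<open>The control states of the compiled machine are the continuations of the program.\<close>

function continuations :: "cmd list \<Rightarrow> cmd list set" where
  "continuations [] = {[]}"
| "continuations (Inc r # k) = insert (Inc r # k) (continuations k)"
| "continuations (Dec r # k) = insert (Dec r # k) (continuations k)"
| "continuations (Out b # k) = insert (Out b # k) (continuations k)"
| "continuations (While r a c # k) = insert (While r a c # k)
     (continuations k \<union> (\<lambda>d. d @ While r a c # k) ` continuations c)"
| "continuations (If r a c d # k) = insert (If r a c d # k)
     (continuations k \<union> (\<lambda>e. e @ k) ` (continuations c \<union> continuations d))"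
  by pat_completeness auto
termination by (relation "Wellfounded.measure (size_list size)") auto

lemma finite_continuations: "finite (continuations c)"
  by (induction c rule: continuations.induct) auto

lemma self_in_continuations: "c \<in> continuations c"
  by (cases c rule: continuations.cases) auto

lemma Nil_in_continuations: "[] \<in> continuations c"
  by (induction c rule: continuations.induct) auto

lemma successor_append: "c \<noteq> [] \<Longrightarrow> successor b (c @ k) = successor b c @ k"
  by (cases "(b, c)" rule: successor.cases) auto

lemma successor_in_continuations: "d \<in> continuations c \<Longrightarrow> successor b d \<in> continuations c"
proof (induction c arbitrary: d rule: continuations.induct)
  case (5 r a c k)
  show ?case
  proof (cases "d = While r a c # k \<or> d \<in> continuations k")
    case True
    then show ?thesis
      using "5.IH"(1) self_in_continuations[of c] self_in_continuations[of k] by auto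
  next
    case False
    then obtain e where e: "e \<in> continuations c" "d = e @ While r a c # k" using "5.prems" by auto
    with False have "e \<noteq> []" by auto
    then show ?thesis using "5.IH"(2)[OF e(1)] e(2) by (auto simp: successor_append)
  qed
next
  case (6 r a c c' k)
  show ?case
  proof (cases "d = If r a c c' # k \<or> d \<in> continuations k")
    case True
    then show ?thesis
      using "6.IH"(1) self_in_continuations[of c] self_in_continuations[of c'] by auto
  next
    case False
    then obtain e where e: "e \<in> continuations c \<union> continuations c'" "d = e @ k"
      using "6.prems" by auto
    with False self_in_continuations[of k] have "e \<noteq> []" by auto
    then show ?thesis using "6.IH"(2,3)[of e] e by (auto simp: successor_append)
  qed
qed (auto simp: self_in_continuations)

fun cmd_regs :: "cmd \<Rightarrow> nat set" where
  "cmd_regs (Inc r) = {r}"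
| "cmd_regs (Dec r) = {r}"
| "cmd_regs (Out b) = {}"
| "cmd_regs (While r a c) = insert r (\<Union>(cmd_regs ` set c))"
| "cmd_regs (If r a c d) = insert r (\<Union>(cmd_regs ` set c) \<union> \<Union>(cmd_regs ` set d))"

lemma finite_cmd_regs: "finite (cmd_regs a)"
  by (induction a) auto

lemma continuations_regs: "d \<in> continuations c \<Longrightarrow> \<Union>(cmd_regs ` set d) \<subseteq> \<Union>(cmd_regs ` set c)"
  by (induction c arbitrary: d rule: continuations.induct) (fastforce)+

lemma guard_cong: "(\<And>r. r \<in> cmd_regs a \<Longrightarrow> scan r = scan' r) \<Longrightarrow> guard scan a = guard scan' a"
  by (cases a) auto

fun action :: "cmd \<Rightarrow> nat list \<Rightarrow> nat \<Rightarrow> nat \<times> int" where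
  "action (Inc r) ss i = (ss ! i, if i = Suc r then 1 else 0)"
| "action (Dec r) ss i = (ss ! i, if i = Suc r \<and> ss ! i \<noteq> 3 then -1 else 0)"
| "action (Out b) ss i = (if i = 0 then (if b then 2 else 1, 1) else (ss ! i, 0))"
| "action _ ss i = (ss ! i, 0)"

text \<open>
  Tape 0 holds the output and tape \<open>r + 1\<close> register \<open>r\<close>. Initially tape 0 holds the input, which is
  moved to the tape of register 0 before the program is run.
\<close>

datatype ctl = Start | Copying | Rewinding | Run "cmd list"

fun ctl_step :: "cmd list \<Rightarrow> ctl \<Rightarrow> nat list \<Rightarrow> ctl \<times> (nat \<Rightarrow> nat \<times> int)" where
  "ctl_step p Start ss =
     (Copying, \<lambda>i. if i = 0 then (ss ! i, 0) else (3, if i = 1 then 1 else 0))"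
| "ctl_step p Copying ss =
     (if ss ! 0 = 0 then (Rewinding, \<lambda>i. (ss ! i, if i < 2 then -1 else 0))
      else (Copying, \<lambda>i. if i = 0 then (0, 1) else if i = 1 then (ss ! 0, 1) else (ss ! i, 0)))"
| "ctl_step p Rewinding ss =
     (if ss ! 1 = 3 then (Run p, \<lambda>i. (ss ! i, if i = 0 then 1 else 0))
      else (Rewinding, \<lambda>i. (ss ! i, if i < 2 then -1 else 0)))"
| "ctl_step p (Run []) ss = (Run [], \<lambda>i. (ss ! i, 0))"
| "ctl_step p (Run (a # k)) ss =
     (Run (successor (guard (\<lambda>r. ss ! Suc r) a) (a # k)), action a ss)"

definition reg_tape :: "bool list \<Rightarrow> nat \<Rightarrow> int \<Rightarrow> nat" where
  "reg_tape x r j = (if j < 0 then 0 else reg_symbol x r (nat j))"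

definition prog_tape :: "bool list \<Rightarrow> pstate \<Rightarrow> nat \<Rightarrow> int \<times> (int \<Rightarrow> nat)" where
  "prog_tape x = (\<lambda>(s, z) i. if i = 0 then (int (length z), string_tape z)
     else (int (s (i - 1)), reg_tape x (i - 1)))"

definition copy_tape :: "bool list \<Rightarrow> nat \<Rightarrow> nat \<Rightarrow> int \<times> (int \<Rightarrow> nat)" where
  "copy_tape x j i = (if i = 0 then (int j, \<lambda>l. if l < int j then 0 else string_tape x l)
     else if i = 1 then (int j + 1, reg_tape (take j x) 0) else (0, reg_tape x (i - 1)))"

definition rewind_tape :: "bool list \<Rightarrow> nat \<Rightarrow> nat \<Rightarrow> int \<times> (int \<Rightarrow> nat)" where
  "rewind_tape x j i = (if i = 0 then (int j - 1, string_tape [])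
     else if i = 1 then (int j, reg_tape x 0) else (0, reg_tape x (i - 1)))"

lemma string_tape_snoc:
  "(string_tape z)(int (length z) := if b then 2 else 1) = string_tape (z @ [b])"
  by (auto simp: string_tape_def fun_eq_iff nth_append)

lemma reg_tape_take_Suc:
  assumes "j < length x"
  shows "(reg_tape (take j x) 0)(int j + 1 := if x ! j then 2 else 1) = reg_tape (take (Suc j) x) 0"
proof -
  have pos: "nat (int j + 1) = Suc j" by simp
  show ?thesis
    using assms
    by (auto simp: pos reg_tape_def reg_symbol_def fun_eq_iff min_def nat_eq_iff nth_take split: if_splits)
qed

definition next_tape :: "nat \<times> int \<Rightarrow> int \<times> (int \<Rightarrow> nat) \<Rightarrow> int \<times> (int \<Rightarrow> nat)" where
  "next_tape = (\<lambda>(a, d) (h, t). (h + d, t(h := a)))"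

lemma next_tape_same_symbol: "next_tape (snd tp (fst tp), d) tp = (fst tp + d, snd tp)"
  by (simp add: next_tape_def case_prod_beta)

locale compilation =
  fixes p :: "cmd list" and R :: nat and ctls :: "ctl list"
  assumes R: "R > 0" "\<Union>(cmd_regs ` set p) \<subseteq> {..<R}"
    and ctls: "distinct ctls" "set ctls = {Start, Copying, Rewinding} \<union> Run ` continuations p"
      "ctls ! 0 = Start" "ctls ! 1 = Run []" "length ctls \<ge> 2"
begin

definition ctl_index :: "ctl \<Rightarrow> nat" where
  "ctl_index c = (SOME n. n < length ctls \<and> ctls ! n = c)"

definition compiled :: turing_machine where
  "compiled = \<lparr>tm_tapes = Suc R, tm_states = length ctls, tm_symbols = 4,
     tm_delta = (\<lambda>q ss. case ctl_step p (ctls ! q) ss of (c, act) \<Rightarrow>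
       (ctl_index c, map act [0..<length ss]))\<rparr>"

definition machine_config :: "ctl \<Rightarrow> (nat \<Rightarrow> int \<times> (int \<Rightarrow> nat)) \<Rightarrow> tm_config" where
  "machine_config c tp = (ctl_index c, map tp [0..<Suc R])"

definition scan :: "(nat \<Rightarrow> int \<times> (int \<Rightarrow> nat)) \<Rightarrow> nat list" where
  "scan tp = map (\<lambda>i. snd (tp i) (fst (tp i))) [0..<Suc R]"

lemma nth_scan: "i < Suc R \<Longrightarrow> scan tp ! i = snd (tp i) (fst (tp i))"
  by (simp add: scan_def del: upt_Suc)

lemma ctl_index: "c \<in> set ctls \<Longrightarrow> ctl_index c < length ctls \<and> ctls ! ctl_index c = c"
  unfolding ctl_index_def in_set_conv_nth by (rule someI_ex) blast

lemma ctl_index_nth: "n < length ctls \<Longrightarrow> ctl_index (ctls ! n) = n"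
  using ctl_index[of "ctls ! n"] ctls(1) nth_eq_iff_index_eq by fastforce

lemma ctl_index_Start: "ctl_index Start = 0" and ctl_index_halt: "ctl_index (Run []) = 1"
proof -
  have "0 < length ctls" "1 < length ctls" using ctls(5) by linarith+
  then show "ctl_index Start = 0" "ctl_index (Run []) = 1"
    using ctl_index_nth[of 0] ctl_index_nth[of 1] ctls(3,4) by simp_all
qed

lemma ctl_index_eq_halt_iff: "c \<in> set ctls \<Longrightarrow> ctl_index c = 1 \<longleftrightarrow> c = Run []"
  using ctl_index ctl_index_halt ctls by metis

lemma ctl_step_in_ctls:
  assumes "c \<in> set ctls"
  shows "fst (ctl_step p c ss) \<in> set ctls"
proof (cases "(p, c, ss)" rule: ctl_step.cases)
  case (5 p' a k ss')
  then have "a # k \<in> continuations p" using assms ctls(2) by auto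
  then show ?thesis using 5 successor_in_continuations ctls(2) by auto
qed (use assms ctls(2) self_in_continuations[of p] in auto)

lemma ctl_step_act:
  assumes "length ss = Suc R" "set ss \<subseteq> {..<4}" "i < Suc R"
  shows "snd (ctl_step p c ss) i \<in> {..<4} \<times> {-1, 0, 1}"
proof -
  have "ss ! i \<in> set ss" "ss ! 0 \<in> set ss" using assms(1,3) by auto
  then have symbols: "ss ! i < 4" "ss ! 0 < 4" using assms(2) by auto
  then have "action a ss i \<in> {..<4} \<times> {-1, 0, 1}" for a by (cases a) auto
  then show ?thesis using symbols by (cases "(p, c, ss)" rule: ctl_step.cases) auto
qed

lemma wf_compiled: "wf_tm compiled"
proof -
  have "case tm_delta compiled q ss of (q', acts) \<Rightarrow>
           q' < tm_states compiled \<and> length acts = tm_tapes compiled \<and>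
           set acts \<subseteq> {..<tm_symbols compiled} \<times> {-1, 0, 1}"
    if "q < length ctls" "length ss = Suc R" "set ss \<subseteq> {..<4}" for q ss
  proof -
    obtain c act where step: "ctl_step p (ctls ! q) ss = (c, act)"
      by (rule that[OF prod.collapse[symmetric]])
    have "c \<in> set ctls" using ctl_step_in_ctls[of "ctls ! q" ss] \<open>q < length ctls\<close> step by simp
    moreover have "act i \<in> {..<4} \<times> {-1, 0, 1}" if "i < Suc R" for i
      using ctl_step_act[OF \<open>length ss = Suc R\<close> \<open>set ss \<subseteq> {..<4}\<close> that, of "ctls ! q"] step by simp
    ultimately show ?thesis using \<open>length ss = Suc R\<close> ctl_index step
      by (auto simp: compiled_def image_subset_iff simp del: upt_Suc)
  qed
  then show ?thesis using ctls(5) by (auto simp: wf_tm_def compiled_def)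
qed

lemma tm_step_compiled:
  assumes "c \<in> set ctls" "c \<noteq> Run []" "ctl_step p c (scan tp) = (c', act)"
    and "\<And>i. i < Suc R \<Longrightarrow> next_tape (act i) (tp i) = tp' i"
  shows "tm_step compiled (machine_config c tp) = machine_config c' tp'"
proof -
  define ts where "ts = map tp [0..<Suc R]"
  have "map (\<lambda>(h, t). t h) ts = scan tp"
    unfolding ts_def scan_def map_map by (intro map_cong refl) (simp add: case_prod_beta)
  moreover have "map2 (\<lambda>(s, d) (h, t). (h + d, t(h := s))) (map act [0..<Suc R]) ts =
      map tp' [0..<Suc R]"
    unfolding ts_def using assms(4)
    by (intro nth_equalityI) (auto simp: next_tape_def case_prod_beta simp del: upt_Suc)
  moreover have "tm_delta compiled (ctl_index c) (scan tp) = (ctl_index c', map act [0..<Suc R])"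
    using assms(3) ctl_index[OF assms(1)] by (simp add: compiled_def scan_def del: upt_Suc)
  ultimately show ?thesis
    unfolding machine_config_def ts_def[symmetric]
    using ctl_index_eq_halt_iff[OF assms(1)] assms(2) by (simp add: tm_step_def del: upt_Suc)
qed

lemma scan_prog_tape: "r < R \<Longrightarrow> scan (prog_tape x \<sigma>) ! Suc r = reg_symbol x r (fst \<sigma> r)"
  by (cases \<sigma>) (simp add: nth_scan prog_tape_def reg_tape_def)

lemma next_tape_action:
  assumes "i < Suc R"
  shows "next_tape (action a (scan (prog_tape x \<sigma>)) i) (prog_tape x \<sigma> i) = prog_tape x (effect a \<sigma>) i"
proof -
  obtain s z where \<sigma>: "\<sigma> = (s, z)" by fastforce
  have same_symbol: "next_tape (scan (prog_tape x \<sigma>) ! i, d) (prog_tape x \<sigma> i) =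
      (fst (prog_tape x \<sigma> i) + d, snd (prog_tape x \<sigma> i))" for d
    unfolding nth_scan[OF assms] by (rule next_tape_same_symbol)
  show ?thesis
  proof (cases a)
    case (Dec r)
    then have "action a (scan (prog_tape x \<sigma>)) i =
        (scan (prog_tape x \<sigma>) ! i, if i = Suc r \<and> s r \<noteq> 0 then -1 else 0)"
      using assms scan_prog_tape[of r x \<sigma>] by (auto simp: \<sigma>)
    then show ?thesis using Dec by (simp only: same_symbol) (auto simp: \<sigma> prog_tape_def)
  next
    case (Out b)
    then show ?thesis
      using same_symbol string_tape_snoc[of z b]
      by (auto simp: \<sigma> prog_tape_def next_tape_def)
  qed (use same_symbol in \<open>auto simp: \<sigma> prog_tape_def\<close>)
qed

lemma tm_step_prog:
  assumes "c \<in> continuations p"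
  shows "tm_step compiled (machine_config (Run c) (prog_tape x \<sigma>)) =
    (case pstep x (c, \<sigma>) of (c', \<sigma>') \<Rightarrow> machine_config (Run c') (prog_tape x \<sigma>'))"
proof (cases c)
  case Nil
  then show ?thesis by (simp add: machine_config_def ctl_index_halt tm_step_def)
next
  case (Cons a k)
  have "\<Union>(cmd_regs ` set c) \<subseteq> {..<R}" using continuations_regs[OF assms] R(2) by (rule order_trans)
  then have "cmd_regs a \<subseteq> {..<R}" using Cons by simp
  then have "guard (\<lambda>r. scan (prog_tape x \<sigma>) ! Suc r) a = guard (\<lambda>r. reg_symbol x r (fst \<sigma> r)) a"
    by (intro guard_cong scan_prog_tape) blast
  then have "ctl_step p (Run c) (scan (prog_tape x \<sigma>)) =
      (Run (fst (pstep x (c, \<sigma>))), action a (scan (prog_tape x \<sigma>)))"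
    using Cons by simp
  then have "tm_step compiled (machine_config (Run c) (prog_tape x \<sigma>)) =
      machine_config (Run (fst (pstep x (c, \<sigma>)))) (prog_tape x (effect a \<sigma>))"
    by (rule tm_step_compiled[rotated 2]) (use assms ctls(2) Cons next_tape_action in auto)
  then show ?thesis using Cons by simp
qed

lemma pstep_in_continuations:
  "c \<in> continuations p \<Longrightarrow> fst (pstep x (c, \<sigma>)) \<in> continuations p"
  by (cases c) (auto dest: successor_in_continuations)

lemma tm_steps_prog:
  assumes "c \<in> continuations p"
  shows "(tm_step compiled ^^ t) (machine_config (Run c) (prog_tape x \<sigma>)) =
    (case (pstep x ^^ t) (c, \<sigma>) of (c', \<sigma>') \<Rightarrow> machine_config (Run c') (prog_tape x \<sigma>'))"
  using assms
proof (induction t arbitrary: c \<sigma>)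
  case (Suc t)
  obtain c' \<sigma>' where step: "pstep x (c, \<sigma>) = (c', \<sigma>')" by (rule that[OF prod.collapse[symmetric]])
  have "c' \<in> continuations p" using pstep_in_continuations[OF Suc.prems, of x \<sigma>] step by simp
  from Suc.IH[OF this, of \<sigma>'] show ?case
    using tm_step_prog[OF Suc.prems, of x \<sigma>] step
    by (simp add: funpow_Suc_right del: funpow.simps)
qed simp

lemma tm_step_Start: "tm_step compiled (tm_init compiled x) = machine_config Copying (copy_tape x 0)"
proof -
  have "tm_init compiled x =
      machine_config Start (\<lambda>i. (0, if i = 0 then string_tape x else (\<lambda>_. 0)))"
    by (auto simp: tm_init_def compiled_def machine_config_def ctl_index_Start nth_Cons
        intro!: nth_equalityI split: nat.splits simp del: upt_Suc)
  moreover have "tm_step compiled (machine_config Start (\<lambda>i. (0, if i = 0 then string_tape x else (\<lambda>_. 0)))) =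
      machine_config Copying (copy_tape x 0)"
    by (rule tm_step_compiled[OF _ _ ctl_step.simps(1)])
      (use ctls(2) in \<open>auto simp: nth_scan next_tape_def copy_tape_def reg_tape_def reg_symbol_def
        fun_eq_iff string_tape_def\<close>)
  ultimately show ?thesis by simp
qed

lemma tm_step_Copying:
  assumes "j < length x"
  shows "tm_step compiled (machine_config Copying (copy_tape x j)) =
    machine_config Copying (copy_tape x (Suc j))"
proof (rule tm_step_compiled)
  let ?ss = "scan (copy_tape x j)"
  have bit: "?ss ! 0 = (if x ! j then 2 else 1)"
    using assms by (simp add: nth_scan copy_tape_def string_tape_def)
  then show "ctl_step p Copying ?ss =
      (Copying, \<lambda>i. if i = 0 then (0, 1) else if i = 1 then (?ss ! 0, 1) else (?ss ! i, 0))"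
    by simp
  fix i assume "i < Suc R"
  consider "i = 0" | "i = 1" | "i > 1" by linarith
  then show "next_tape (if i = 0 then (0, 1) else if i = 1 then (?ss ! 0, 1) else (?ss ! i, 0))
      (copy_tape x j i) = copy_tape x (Suc j) i"
  proof cases
    case 2
    then show ?thesis using bit reg_tape_take_Suc[OF assms] by (simp add: next_tape_def copy_tape_def)
  qed (use \<open>i < Suc R\<close> in \<open>auto simp: nth_scan next_tape_def copy_tape_def fun_eq_iff\<close>)
qed (use ctls(2) in auto)

lemma tm_step_Copying_end:
  "tm_step compiled (machine_config Copying (copy_tape x (length x))) =
    machine_config Rewinding (rewind_tape x (length x))"
proof (rule tm_step_compiled)
  let ?ss = "scan (copy_tape x (length x))"
  have "?ss ! 0 = 0" by (simp add: nth_scan copy_tape_def string_tape_def)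
  then show "ctl_step p Copying ?ss = (Rewinding, \<lambda>i. (?ss ! i, if i < 2 then -1 else 0))" by simp
  show "next_tape (?ss ! i, if i < 2 then -1 else 0) (copy_tape x (length x) i) =
      rewind_tape x (length x) i" if "i < Suc R" for i
    using that
    by (auto simp: nth_scan next_tape_def copy_tape_def rewind_tape_def fun_eq_iff string_tape_def)
qed (use ctls(2) in auto)

lemma scan_rewind_tape: "scan (rewind_tape x j) ! 1 = 3 \<longleftrightarrow> j = 0"
  using R(1) by (simp add: nth_scan rewind_tape_def reg_tape_def)

lemma tm_step_Rewinding:
  "tm_step compiled (machine_config Rewinding (rewind_tape x (Suc j))) =
    machine_config Rewinding (rewind_tape x j)"
proof (rule tm_step_compiled)
  let ?ss = "scan (rewind_tape x (Suc j))"
  show "ctl_step p Rewinding ?ss = (Rewinding, \<lambda>i. (?ss ! i, if i < 2 then -1 else 0))"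
    using scan_rewind_tape[of x "Suc j"] by simp
qed (use ctls(2) in \<open>auto simp: nth_scan next_tape_def rewind_tape_def\<close>)

lemma tm_step_Rewinding_end:
  "tm_step compiled (machine_config Rewinding (rewind_tape x 0)) =
    machine_config (Run p) (prog_tape x (\<lambda>_. 0, []))"
proof (rule tm_step_compiled)
  let ?ss = "scan (rewind_tape x 0)"
  show "ctl_step p Rewinding ?ss = (Run p, \<lambda>i. (?ss ! i, if i = 0 then 1 else 0))"
    using scan_rewind_tape[of x 0] by simp
qed (use ctls(2) in \<open>auto simp: nth_scan next_tape_def rewind_tape_def prog_tape_def\<close>)

lemma tm_steps_Copying:
  "j \<le> length x \<Longrightarrow> (tm_step compiled ^^ j) (machine_config Copying (copy_tape x 0)) =
     machine_config Copying (copy_tape x j)"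
  by (induction j) (simp_all add: tm_step_Copying)

lemma tm_steps_Rewinding:
  "(tm_step compiled ^^ j) (machine_config Rewinding (rewind_tape x j)) =
     machine_config Rewinding (rewind_tape x 0)"
  by (induction j) (simp_all add: funpow_Suc_right tm_step_Rewinding del: funpow.simps(2))

lemma tm_steps_until_Run:
  "(tm_step compiled ^^ (2 * length x + 3)) (tm_init compiled x) =
    machine_config (Run p) (prog_tape x (\<lambda>_. 0, []))"
proof -
  have "2 * length x + 3 = Suc (length x + Suc (length x + Suc 0))" by simp
  then show ?thesis
    by (simp only: funpow.simps funpow_add o_apply id_apply tm_step_Start tm_steps_Copying le_refl
        tm_step_Copying_end tm_steps_Rewinding tm_step_Rewinding_end)
qed

lemma compiled_computes_within:
  assumes "\<And>x. \<exists>s. exec x p (\<lambda>_. 0, []) (T (length x)) (s, f x)"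
  shows "tm_computes_within compiled f (\<lambda>n. 2 * n + 3 + T n)"
  unfolding tm_computes_within_def
proof
  fix x
  obtain s t where t: "t \<le> T (length x)" "\<And>k. (pstep x ^^ t) (p @ k, \<lambda>_. 0, []) = (k, s, f x)"
    using assms[of x] unfolding exec_def by blast
  have "(tm_step compiled ^^ (t + (2 * length x + 3))) (tm_init compiled x) =
      machine_config (Run []) (prog_tape x (s, f x))"
    using t(2)[of "[]"]
    by (simp only: funpow_add[of t "2 * length x + 3"] o_apply tm_steps_until_Run
      tm_steps_prog[OF self_in_continuations] append_Nil2 prod.case)
  moreover have "snd (hd (map (prog_tape x (s, f x)) [0..<Suc R])) = string_tape (f x)"
    by (simp add: hd_conv_nth prog_tape_def del: upt_Suc)
  ultimately show "\<exists>t\<le>2 * length x + 3 + T (length x). \<exists>ts.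
      (tm_step compiled ^^ t) (tm_init compiled x) = (1, ts) \<and> snd (hd ts) = string_tape (f x)"
    using t(1) unfolding machine_config_def ctl_index_halt
    by (intro exI[of _ "t + (2 * length x + 3)"]) auto
qed

end

lemma poly_time_computable_program:
  fixes q :: "nat poly"
  assumes "\<And>x. \<exists>s. exec x p (\<lambda>_. 0, []) (poly q (length x)) (s, f x)"
  shows "poly_time_computable f"
proof -
  have "finite (({Copying, Rewinding} \<union> Run ` continuations p) - {Run []})"
    by (simp add: finite_continuations)
  then obtain cs where cs: "set cs = ({Copying, Rewinding} \<union> Run ` continuations p) - {Run []}"
    "distinct cs"
    using finite_distinct_list by blast
  obtain R where R: "\<Union>(cmd_regs ` set p) \<subseteq> {..<R}"
    using finite_nat_iff_bounded[of "\<Union>(cmd_regs ` set p)"] by (auto simp: finite_cmd_regs)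
  interpret compilation p "Suc R" "Start # Run [] # cs"
    using R cs Nil_in_continuations[of p] by unfold_locales auto
  have "poly ([:3, 2:] + q) = (\<lambda>n. 2 * n + 3 + poly q n)" by (auto simp: fun_eq_iff)
  then have "tm_computes_within compiled f (poly ([:3, 2:] + q))"
    using compiled_computes_within[OF assms] by simp
  then show ?thesis unfolding poly_time_computable_def using wf_compiled by blast
qed

section \<open>Functions computable by counter programs in polynomial time\<close>

text \<open>
  A function takes the input string and an environment of \<open>n\<close> numbers, which counter programs hold
  in unary; environments are extended by \<open>0\<close> and indexed as de Bruijn indices.
\<close>

type_synonym env = "nat \<Rightarrow> nat"
type_synonym env_fun = "bool list \<Rightarrow> env \<Rightarrow> nat"

definition env_size :: "nat \<Rightarrow> env_fun" where
  "env_size n x E = 2 + length x + (\<Sum>i<n. E i)"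

definition is_env :: "nat \<Rightarrow> env \<Rightarrow> bool" where
  "is_env n E \<longleftrightarrow> (\<forall>i\<ge>n. E i = 0)"

definition poly_bounded :: "nat \<Rightarrow> env_fun \<Rightarrow> bool" where
  "poly_bounded n g \<longleftrightarrow> (\<exists>k. \<forall>x E. is_env n E \<longrightarrow> g x E \<le> env_size n x E ^ k)"

definition env_of :: "(nat \<Rightarrow> nat) \<Rightarrow> nat list \<Rightarrow> env" where
  "env_of s rs i = (if i < length rs then s (rs ! i) else 0)"

definition arg_regs :: "nat \<Rightarrow> nat list \<Rightarrow> nat \<Rightarrow> bool" where
  "arg_regs n rs m \<longleftrightarrow> length rs = n \<and> set rs \<subseteq> {0<..<m} \<and> 0 < m"

definition unused_from :: "nat \<Rightarrow> (nat \<Rightarrow> nat) \<Rightarrow> bool" where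
  "unused_from m s \<longleftrightarrow> s 0 = 0 \<and> (\<forall>r\<ge>m. s r = 0)"

definition computes :: "cmd list \<Rightarrow> env_fun \<Rightarrow> nat list \<Rightarrow> nat \<Rightarrow> env_fun \<Rightarrow> bool" where
  "computes c T rs m f \<longleftrightarrow> (\<forall>x s z. unused_from m s \<longrightarrow>
     exec x c (s, z) (T x (env_of s rs)) (s(m := f x (env_of s rs)), z))"

definition ptime_fun :: "nat \<Rightarrow> env_fun \<Rightarrow> bool" where
  "ptime_fun n f \<longleftrightarrow>
     (\<forall>rs m. arg_regs n rs m \<longrightarrow> (\<exists>c T. computes c T rs m f \<and> poly_bounded n T))"

lemma computesD:
  "computes c T rs m f \<Longrightarrow> unused_from m s \<Longrightarrow>
   exec x c (s, z) (T x (env_of s rs)) (s(m := f x (env_of s rs)), z)"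
  unfolding computes_def by blast

lemma ptime_funE:
  assumes "ptime_fun n f" "arg_regs n rs m"
  obtains c T where "poly_bounded n T" "computes c T rs m f"
  using assms unfolding ptime_fun_def by blast

lemma ptime_funI:
  "(\<And>rs m. arg_regs n rs m \<Longrightarrow> \<exists>c T. computes c T rs m f \<and> poly_bounded n T) \<Longrightarrow> ptime_fun n f"
  unfolding ptime_fun_def by blast

lemma arg_regs_Cons:
  assumes "arg_regs n rs m" "m \<le> r" "r < m'"
  shows "arg_regs (Suc n) (r # rs) m'"
  using assms by (auto simp: arg_regs_def)

lemma arg_regs_mono: "arg_regs n rs m \<Longrightarrow> m \<le> m' \<Longrightarrow> arg_regs n rs m'"
  by (auto simp: arg_regs_def)

lemma unused_from_mono: "unused_from m s \<Longrightarrow> m \<le> m' \<Longrightarrow> unused_from m' s"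
  by (auto simp: unused_from_def)

lemma is_env_env_of [simp]: "length rs = n \<Longrightarrow> is_env n (env_of s rs)"
  by (auto simp: is_env_def env_of_def)

lemma is_env_push [simp]: "is_env n E \<Longrightarrow> is_env (Suc n) (case_nat a E)"
  by (auto simp: is_env_def split: nat.splits)

lemma env_of_Cons [simp]: "env_of s (r # rs) = case_nat (s r) (env_of s rs)"
  by (auto simp: env_of_def fun_eq_iff split: nat.splits)

lemma env_of_cong: "(\<And>r. r \<in> set rs \<Longrightarrow> s r = s' r) \<Longrightarrow> env_of s rs = env_of s' rs"
  by (auto simp: env_of_def fun_eq_iff)

lemma env_of_upd: "arg_regs n rs m \<Longrightarrow> m \<le> r \<Longrightarrow> env_of (s(r := v)) rs = env_of s rs"
  by (rule env_of_cong) (auto simp: arg_regs_def)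

lemma env_size_push [simp]: "env_size (Suc n) x (case_nat a E) = a + env_size n x E"
  by (simp add: env_size_def sum.lessThan_Suc_shift del: sum.lessThan_Suc)

subsection \<open>Polynomial bounds\<close>

lemma env_size_ge_2: "env_size n x E \<ge> 2"
  by (simp add: env_size_def)

lemma power_add_le_power:
  fixes b :: nat
  assumes "b \<ge> 2"
  shows "b ^ k + b ^ l \<le> b ^ (Suc (k + l))"
proof -
  have "b ^ k \<le> b ^ (k + l)" "b ^ l \<le> b ^ (k + l)" using assms by (auto intro: power_increasing)
  then have "b ^ k + b ^ l \<le> 2 * b ^ (k + l)" by simp
  also have "\<dots> \<le> b * b ^ (k + l)" using assms by simp
  finally show ?thesis by simp
qed

lemma poly_boundedI: "(\<And>x E. is_env n E \<Longrightarrow> g x E \<le> env_size n x E ^ k) \<Longrightarrow> poly_bounded n g"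
  unfolding poly_bounded_def by blast

lemma poly_boundedE:
  assumes "poly_bounded n g"
  obtains k where "\<And>x E. is_env n E \<Longrightarrow> g x E \<le> env_size n x E ^ k"
  using assms unfolding poly_bounded_def by blast

lemma poly_bounded_mono:
  "poly_bounded n g \<Longrightarrow> (\<And>x E. is_env n E \<Longrightarrow> h x E \<le> g x E) \<Longrightarrow> poly_bounded n h"
  unfolding poly_bounded_def using le_trans by meson

lemma poly_bounded_const: "poly_bounded n (\<lambda>x E. c)"
proof (rule poly_boundedI[of _ _ c])
  fix x :: "bool list" and E :: env
  have "c \<le> 2 ^ c" by (rule less_imp_le[OF less_exp])
  also have "\<dots> \<le> env_size n x E ^ c" by (intro power_mono env_size_ge_2) simp
  finally show "c \<le> env_size n x E ^ c" .
qed

lemma poly_bounded_env_size: "poly_bounded n (env_size n)"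
  by (rule poly_boundedI[of _ _ 1]) simp

lemma poly_bounded_add:
  assumes "poly_bounded n g" "poly_bounded n h"
  shows "poly_bounded n (\<lambda>x E. g x E + h x E)"
proof -
  obtain k l where "\<And>x E. is_env n E \<Longrightarrow> g x E \<le> env_size n x E ^ k"
    "\<And>x E. is_env n E \<Longrightarrow> h x E \<le> env_size n x E ^ l"
    using assms by (auto elim!: poly_boundedE)
  then show ?thesis
    by (intro poly_boundedI[of _ _ "Suc (k + l)"]
        order_trans[OF add_mono power_add_le_power[OF env_size_ge_2]])
qed

lemma poly_bounded_mult:
  assumes "poly_bounded n g" "poly_bounded n h"
  shows "poly_bounded n (\<lambda>x E. g x E * h x E)"
proof -
  obtain k l where "\<And>x E. is_env n E \<Longrightarrow> g x E \<le> env_size n x E ^ k"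
    "\<And>x E. is_env n E \<Longrightarrow> h x E \<le> env_size n x E ^ l"
    using assms by (auto elim!: poly_boundedE)
  then show ?thesis
    by (intro poly_boundedI[of _ _ "k + l"]) (simp add: power_add mult_mono)
qed

lemma poly_bounded_power: "poly_bounded n g \<Longrightarrow> poly_bounded n (\<lambda>x E. g x E ^ k)"
  by (induction k) (auto intro: poly_bounded_mult poly_bounded_const)

lemma poly_bounded_Suc: "poly_bounded n g \<Longrightarrow> poly_bounded n (\<lambda>x E. Suc (g x E))"
  using poly_bounded_add[OF _ poly_bounded_const[of n 1], of g] by simp

lemma poly_bounded_nth: "poly_bounded n (\<lambda>x E. E i)"
proof (rule poly_bounded_mono[OF poly_bounded_env_size])
  fix x :: "bool list" and E :: env
  assume "is_env n E"
  moreover have "E i \<le> (\<Sum>j<n. E j)" if "i < n" using that by (intro member_le_sum) auto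
  ultimately show "E i \<le> env_size n x E" by (cases "i < n") (auto simp: env_size_def is_env_def)
qed

lemma poly_bounded_length: "poly_bounded n (\<lambda>x E. length x)"
  by (rule poly_bounded_mono[OF poly_bounded_env_size]) (simp add: env_size_def)

lemmas poly_bounded_intros = poly_bounded_const poly_bounded_add poly_bounded_mult
  poly_bounded_power poly_bounded_Suc poly_bounded_nth poly_bounded_length poly_bounded_env_size

lemma poly_bounded_pushE:
  assumes "poly_bounded (Suc n) g"
  obtains k where "\<And>x E a. is_env n E \<Longrightarrow> g x (case_nat a E) \<le> (a + env_size n x E) ^ k"
  using assms by (metis poly_boundedE env_size_push is_env_push)

lemma poly_bounded_let:
  assumes "poly_bounded (Suc n) g" "poly_bounded n f"
  shows "poly_bounded n (\<lambda>x E. g x (case_nat (f x E) E))"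
proof -
  obtain k where "\<And>x E a. is_env n E \<Longrightarrow> g x (case_nat a E) \<le> (a + env_size n x E) ^ k"
    by (rule poly_bounded_pushE[OF assms(1)]) blast
  moreover have "poly_bounded n (\<lambda>x E. (f x E + env_size n x E) ^ k)"
    by (intro poly_bounded_intros assms(2))
  ultimately show ?thesis by (rule poly_bounded_mono[rotated])
qed

definition reindex :: "nat \<Rightarrow> (nat \<Rightarrow> nat) \<Rightarrow> env \<Rightarrow> env" where
  "reindex k p E i = (if i < k then E (p i) else 0)"

lemma poly_bounded_reindex:
  assumes "poly_bounded k g" "\<And>i. i < k \<Longrightarrow> p i < n"
  shows "poly_bounded n (\<lambda>x E. g x (reindex k p E))"
proof -
  obtain l where l: "\<And>x E. is_env k E \<Longrightarrow> g x E \<le> env_size k x E ^ l"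
    by (rule poly_boundedE[OF assms(1)]) blast
  have size: "env_size k x (reindex k p E) \<le> (k + 1) * env_size n x E" for x E
  proof -
    have "(\<Sum>i<k. reindex k p E i) \<le> (\<Sum>i<k. \<Sum>j<n. E j)"
      by (intro sum_mono) (auto simp: reindex_def intro!: member_le_sum assms(2))
    then show ?thesis by (auto simp: env_size_def algebra_simps)
  qed
  have "g x (reindex k p E) \<le> ((k + 1) * env_size n x E) ^ l" for x E
    by (rule order_trans[OF l power_mono[OF size]]) (auto simp: is_env_def reindex_def)
  moreover have "poly_bounded n (\<lambda>x E. ((k + 1) * env_size n x E) ^ l)"
    by (intro poly_bounded_intros)
  ultimately show ?thesis by (auto intro: poly_bounded_mono)
qed

lemma psteps_growth: "(pstep x ^^ t) (c, \<sigma>) = (c', \<sigma>') \<Longrightarrow> fst \<sigma>' r \<le> fst \<sigma> r + t"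
proof (induction t arbitrary: c' \<sigma>')
  case (Suc t)
  obtain d \<rho> where steps: "(pstep x ^^ t) (c, \<sigma>) = (d, \<rho>)" by (rule prod.exhaust)
  have "fst (effect a \<rho>) r \<le> Suc (fst \<rho> r)" for a by (cases "(a, \<rho>)" rule: effect.cases) auto
  then have "fst \<sigma>' r \<le> Suc (fst \<rho> r)" using Suc.prems steps by (cases d) auto
  with Suc.IH[OF steps] show ?case by simp
qed simp

lemma exec_growth:
  assumes "exec x c \<sigma> T \<sigma>'"
  shows "fst \<sigma>' r \<le> fst \<sigma> r + T"
proof -
  obtain t where "t \<le> T" "(pstep x ^^ t) (c @ [], \<sigma>) = ([], \<sigma>')"
    using assms unfolding exec_def by blast
  then show ?thesis using psteps_growth[of t x "c @ []" \<sigma> "[]" \<sigma>' r] by simp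
qed

lemma poly_bounded_ptime_fun:
  assumes "ptime_fun n f"
  shows "poly_bounded n f"
proof -
  let ?rs = "[1..<Suc n]"
  obtain c T where T: "poly_bounded n T" and prog: "computes c T ?rs (Suc n) f"
    by (rule ptime_funE[OF assms, of ?rs "Suc n"]) (auto simp: arg_regs_def)
  show ?thesis
  proof (rule poly_bounded_mono[OF T])
    fix x E assume E: "is_env n E"
    define s where "s = case_nat 0 E"
    have env: "env_of s ?rs = E"
      using E by (auto simp: env_of_def s_def is_env_def fun_eq_iff simp del: upt_Suc)
    have "unused_from (Suc n) s"
      using E by (auto simp: unused_from_def s_def is_env_def split: nat.splits)
    then have "exec x c (s, []) (T x E) (s(Suc n := f x E), [])" and "s (Suc n) = 0"
      using computesD[OF prog, of s x "[]"] env by (auto simp: unused_from_def)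
    from exec_growth[OF this(1), of "Suc n"] this(2) show "f x E \<le> T x E" by simp
  qed
qed

subsection \<open>Basic functions\<close>

lemma exec_replicate_Inc: "exec x (replicate a (Inc r)) (s, z) a (s(r := s r + a), z)"
proof (induction a arbitrary: s)
  case (Suc a)
  let ?s = "s(r := Suc (s r))"
  have "?s(r := ?s r + a) = s(r := s r + Suc a)" by (simp add: fun_eq_iff)
  then show ?case using exec_Cons[OF exec_Inc[of x r s z] Suc.IH[of ?s]] by (simp del: fun_upd_apply)
qed (simp add: exec_Nil)

lemma computes_const: "computes (replicate a (Inc m)) (\<lambda>x E. a) rs m (\<lambda>x E. a)"
  unfolding computes_def
proof (intro allI impI)
  fix x s and z :: "bool list"
  assume "unused_from m s"
  then show "exec x (replicate a (Inc m)) (s, z) a (s(m := a), z)"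
    using exec_replicate_Inc[of x a m s z] by (simp add: unused_from_def)
qed

lemma ptime_fun_const: "ptime_fun n (\<lambda>x E. a)"
  by (intro ptime_funI exI conjI, rule computes_const, rule poly_bounded_const)

lemma computes_nth:
  assumes "i < n" "arg_regs n rs m"
  shows "computes [While (rs ! i) 3 [Dec (rs ! i), Inc m, Inc (Suc m)],
      While (Suc m) 3 [Dec (Suc m), Inc (rs ! i)]] (\<lambda>x E. 7 * E i + 2) rs m (\<lambda>x E. E i)"
  unfolding computes_def
proof (intro allI impI)
  fix x s and z :: "bool list"
  assume s: "unused_from m s"
  let ?a = "rs ! i"
  let ?s = "s(?a := 0, m := s ?a, Suc m := s ?a)"
  have a: "?a < m" using assms by (auto simp: arg_regs_def dest!: subsetD[OF _ nth_mem[of i rs]])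
  have copy: "exec x [While ?a 3 [Dec ?a, Inc m, Inc (Suc m)]] (s, z) (4 * s ?a + 1) (?s, z)"
    using exec_move_twice[of ?a m "Suc m" x s z] a s by (simp add: unused_from_def)
  have "?s(Suc m := 0, ?a := ?s ?a + ?s (Suc m)) = s(m := s ?a)"
    using a s by (auto simp: fun_eq_iff unused_from_def)
  then have restore: "exec x [While (Suc m) 3 [Dec (Suc m), Inc ?a]] (?s, z) (3 * s ?a + 1)
      (s(m := s ?a), z)"
    using exec_move[of "Suc m" ?a x ?s z] a by simp
  have "env_of s rs i = s ?a" using assms by (simp add: env_of_def arg_regs_def)
  then show "exec x [While ?a 3 [Dec ?a, Inc m, Inc (Suc m)], While (Suc m) 3 [Dec (Suc m), Inc ?a]]
      (s, z) (7 * env_of s rs i + 2) (s(m := env_of s rs i), z)"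
    using exec_Cons[OF copy restore] by simp
qed

lemma ptime_fun_nth: "i < n \<Longrightarrow> ptime_fun n (\<lambda>x E. E i)"
  by (intro ptime_funI exI conjI, erule (1) computes_nth) (intro poly_bounded_intros)

lemma computes_Suc:
  assumes "computes c T rs m f"
  shows "computes (c @ [Inc m]) (\<lambda>x E. T x E + 1) rs m (\<lambda>x E. Suc (f x E))"
  unfolding computes_def
proof (intro allI impI)
  fix x s and z :: "bool list"
  assume "unused_from m s"
  from exec_append[OF computesD[OF assms this] exec_Inc[of x m]]
  show "exec x (c @ [Inc m]) (s, z) (T x (env_of s rs) + 1) (s(m := Suc (f x (env_of s rs))), z)"
    by simp
qed

lemma ptime_fun_Suc:
  assumes "ptime_fun n f"
  shows "ptime_fun n (\<lambda>x E. Suc (f x E))"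
proof (rule ptime_funI)
  fix rs m assume "arg_regs n rs m"
  with assms obtain c T where prog: "poly_bounded n T" "computes c T rs m f" by (rule ptime_funE)
  show "\<exists>c T. computes c T rs m (\<lambda>x E. Suc (f x E)) \<and> poly_bounded n T"
    by (intro exI conjI, rule computes_Suc[OF prog(2)]) (intro poly_bounded_intros prog(1))
qed

lemma computes_if_0:
  assumes f: "computes c T rs m f" and g: "computes d U rs m g" and h: "computes e V rs m h"
  shows "computes (c @ [If m 3 d (While m 3 [Dec m] # e)])
    (\<lambda>x E. T x E + Suc (U x E + (2 * f x E + 1 + V x E))) rs m
    (\<lambda>x E. if f x E = 0 then g x E else h x E)"
  unfolding computes_def
proof (intro allI impI, rule exec_append[OF computesD[OF f] exec_If])
  fix x s and z :: "bool list"
  assume s: "unused_from m s"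
  let ?E = "env_of s rs"
  let ?s = "s(m := f x ?E)"
  have reset: "?s(m := 0) = s" using s by (auto simp: fun_eq_iff unused_from_def)
  show "exec x (if reg_symbol x m (?s m) = 3 then d else While m 3 [Dec m] # e) (?s, z)
     (U x ?E + (2 * f x ?E + 1 + V x ?E)) (s(m := if f x ?E = 0 then g x ?E else h x ?E), z)"
  proof (cases "f x ?E = 0")
    case True
    then have "?s = s" "s m = 0" using reset s by (simp_all add: unused_from_def)
    then show ?thesis using True computesD[OF g s, of x z] by (auto intro: exec_mono)
  next
    case False
    have "exec x [While m 3 [Dec m]] (?s, z) (2 * f x ?E + 1) (s, z)"
      using exec_clear[of x m ?s z] reset by simp
    from exec_Cons[OF this computesD[OF h s]] False show ?thesis by (auto intro: exec_mono)
  qed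
qed

lemma ptime_fun_if_0:
  assumes "ptime_fun n f" "ptime_fun n g" "ptime_fun n h"
  shows "ptime_fun n (\<lambda>x E. if f x E = 0 then g x E else h x E)"
proof (rule ptime_funI)
  fix rs m assume rs: "arg_regs n rs m"
  obtain c T where f: "poly_bounded n T" "computes c T rs m f" by (rule ptime_funE[OF assms(1) rs])
  obtain d U where g: "poly_bounded n U" "computes d U rs m g" by (rule ptime_funE[OF assms(2) rs])
  obtain e V where h: "poly_bounded n V" "computes e V rs m h" by (rule ptime_funE[OF assms(3) rs])
  show "\<exists>c T. computes c T rs m (\<lambda>x E. if f x E = 0 then g x E else h x E) \<and> poly_bounded n T"
    by (intro exI conjI, rule computes_if_0[OF f(2) g(2) h(2)])
      (intro poly_bounded_intros f(1) g(1) h(1) poly_bounded_ptime_fun[OF assms(1)])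
qed

lemma computes_let:
  assumes f: "computes c T rs (Suc m) f" and g: "computes d U (Suc m # rs) (Suc (Suc m)) g"
    and rs: "arg_regs n rs m"
  shows "computes
    (c @ d @ [While (Suc m) 3 [Dec (Suc m)], While (Suc (Suc m)) 3 [Dec (Suc (Suc m)), Inc m]])
    (\<lambda>x E. T x E + (U x (case_nat (f x E) E) +
      ((2 * f x E + 1) + (3 * g x (case_nat (f x E) E) + 1)))) rs m
    (\<lambda>x E. g x (case_nat (f x E) E))"
  unfolding computes_def
proof (intro allI impI)
  fix x s and z :: "bool list"
  assume s: "unused_from m s"
  let ?E = "env_of s rs"
  let ?v = "f x ?E"
  let ?w = "g x (case_nat ?v ?E)"
  let ?s = "s(Suc m := ?v, Suc (Suc m) := ?w)"
  have zero: "s m = 0" "s (Suc m) = 0" "s (Suc (Suc m)) = 0" using s by (auto simp: unused_from_def)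
  have run_f: "exec x c (s, z) (T x ?E) (s(Suc m := ?v), z)"
    by (rule computesD[OF f unused_from_mono[OF s]]) simp
  have "unused_from (Suc (Suc m)) (s(Suc m := ?v))"
    using s by (auto simp: unused_from_def)
  then have run_g: "exec x d (s(Suc m := ?v), z) (U x (case_nat ?v ?E)) (?s, z)"
    using computesD[OF g, of "s(Suc m := ?v)" x z] by (simp add: env_of_upd[OF rs])
  have "?s(Suc m := 0) = s(Suc (Suc m) := ?w)" using zero by (auto simp: fun_eq_iff)
  then have clear: "exec x [While (Suc m) 3 [Dec (Suc m)]] (?s, z) (2 * ?v + 1)
      (s(Suc (Suc m) := ?w), z)"
    using exec_clear[of x "Suc m" ?s z] by simp
  have "s(Suc (Suc m) := ?w, Suc (Suc m) := 0, m := ?w) = s(m := ?w)"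
    using zero by (auto simp: fun_eq_iff)
  then have move: "exec x [While (Suc (Suc m)) 3 [Dec (Suc (Suc m)), Inc m]]
      (s(Suc (Suc m) := ?w), z) (3 * ?w + 1) (s(m := ?w), z)"
    using exec_move[of "Suc (Suc m)" m x "s(Suc (Suc m) := ?w)" z] zero by simp
  show "exec x (c @ d @ [While (Suc m) 3 [Dec (Suc m)],
        While (Suc (Suc m)) 3 [Dec (Suc (Suc m)), Inc m]]) (s, z)
      (T x ?E + (U x (case_nat ?v ?E) + ((2 * ?v + 1) + (3 * ?w + 1)))) (s(m := ?w), z)"
    by (rule exec_append[OF run_f exec_append[OF run_g exec_Cons[OF clear move]]])
qed

lemma ptime_fun_let:
  assumes "ptime_fun n f" "ptime_fun (Suc n) g"
  shows "ptime_fun n (\<lambda>x E. g x (case_nat (f x E) E))"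
proof (rule ptime_funI)
  fix rs m assume rs: "arg_regs n rs m"
  have "arg_regs n rs (Suc m)" using rs by (rule arg_regs_mono) simp
  then obtain c T where f: "poly_bounded n T" "computes c T rs (Suc m) f"
    by (rule ptime_funE[OF assms(1)])
  have "arg_regs (Suc n) (Suc m # rs) (Suc (Suc m))" using rs by (rule arg_regs_Cons) simp_all
  then obtain d U where g: "poly_bounded (Suc n) U" "computes d U (Suc m # rs) (Suc (Suc m)) g"
    by (rule ptime_funE[OF assms(2)])
  show "\<exists>c T. computes c T rs m (\<lambda>x E. g x (case_nat (f x E) E)) \<and> poly_bounded n T"
    by (intro exI conjI, rule computes_let[OF f(2) g(2) rs])
      (intro poly_bounded_intros poly_bounded_let f(1) g(1) assms[THEN poly_bounded_ptime_fun])
qed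

lemma ptime_fun_reindex:
  assumes "ptime_fun k g" "\<And>i. i < k \<Longrightarrow> p i < n"
  shows "ptime_fun n (\<lambda>x E. g x (reindex k p E))"
proof (rule ptime_funI)
  fix rs m assume rs: "arg_regs n rs m"
  let ?rs = "map (\<lambda>i. rs ! p i) [0..<k]"
  have "arg_regs k ?rs m" using rs assms(2) by (auto simp: arg_regs_def dest: nth_mem)
  then obtain c T where prog: "poly_bounded k T" "computes c T ?rs m g" by (rule ptime_funE[OF assms(1)])
  have "env_of s ?rs = reindex k p (env_of s rs)" for s
    using rs assms(2) by (auto simp: env_of_def arg_regs_def reindex_def fun_eq_iff)
  with prog(2) have "computes c (\<lambda>x E. T x (reindex k p E)) rs m (\<lambda>x E. g x (reindex k p E))"
    by (simp add: computes_def)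
  moreover have "poly_bounded n (\<lambda>x E. T x (reindex k p E))"
    using prog(1) assms(2) by (rule poly_bounded_reindex)
  ultimately show "\<exists>c T. computes c T rs m (\<lambda>x E. g x (reindex k p E)) \<and> poly_bounded n T"
    by blast
qed

lemma ptime_fun_cong:
  assumes "ptime_fun n f" "\<And>x E. is_env n E \<Longrightarrow> f x E = g x E"
  shows "ptime_fun n g"
proof (rule ptime_funI)
  fix rs m assume rs: "arg_regs n rs m"
  obtain c T where prog: "poly_bounded n T" "computes c T rs m f" by (rule ptime_funE[OF assms(1) rs])
  have "f x (env_of s rs) = g x (env_of s rs)" for x s
    using rs by (intro assms(2)) (simp add: arg_regs_def)
  with prog show "\<exists>c T. computes c T rs m g \<and> poly_bounded n T" by (auto simp: computes_def)
qed

lemma ptime_fun_shift: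
  assumes "ptime_fun n f"
  shows "ptime_fun (Suc n) (\<lambda>x E. f x (\<lambda>i. E (Suc i)))"
  by (rule ptime_fun_cong[OF ptime_fun_reindex[OF assms, of Suc]])
    (auto simp: is_env_def reindex_def fun_eq_iff intro!: arg_cong[of _ _ "f _"])

lemma ptime_fun_compose:
  assumes "ptime_fun 1 (\<lambda>x E. g x (E 0))" "ptime_fun n f"
  shows "ptime_fun n (\<lambda>x E. g x (f x E))"
  using ptime_fun_let[OF assms(2) ptime_fun_reindex[OF assms(1), of "\<lambda>i. 0"]]
  by (simp add: reindex_def)

subsection \<open>Access to the input\<close>

lemma computes_length:
  assumes "0 < m"
  shows "computes [Inc 0, While 0 0 [Inc 0, Inc m], While 0 3 [Dec 0]]
    (\<lambda>x E. 1 + ((length x * 3 + 1) + (2 * Suc (length x) + 1))) rs m (\<lambda>x E. length x)"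
  unfolding computes_def
proof (intro allI impI)
  fix x s and z :: "bool list"
  assume s: "unused_from m s"
  define \<sigma> where "\<sigma> j = (s(0 := Suc j, m := j), z)" for j
  have "s(0 := 1) = s(0 := Suc 0, m := 0)" using assms s by (auto simp: fun_eq_iff unused_from_def)
  then have start: "exec x [Inc 0] (s, z) 1 (\<sigma> 0)"
    using exec_Inc[of x 0 s z] s by (simp add: \<sigma>_def unused_from_def)
  have "exec x [While 0 0 [Inc 0, Inc m]] (\<sigma> 0) (length x * Suc 2 + 1) (\<sigma> (length x))"
  proof (rule exec_While_iterate)
    fix j assume "j < length x"
    have "s(0 := Suc j, m := j, 0 := Suc (Suc j), m := Suc j) = s(0 := Suc (Suc j), m := Suc j)"
      by (auto simp: fun_eq_iff)
    then show "exec x [Inc 0, Inc m] (\<sigma> j) 2 (\<sigma> (Suc j))"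
      using exec_Cons[OF exec_Inc[of x 0 "fst (\<sigma> j)" z] exec_Inc[of x m]] assms
      by (simp add: \<sigma>_def numeral_2_eq_2)
  qed (use assms in \<open>auto simp: \<sigma>_def reg_symbol_def\<close>)
  then have scan: "exec x [While 0 0 [Inc 0, Inc m]] (\<sigma> 0) (length x * 3 + 1) (\<sigma> (length x))"
    by (simp add: numeral_3_eq_3)
  have "(fst (\<sigma> (length x)))(0 := 0) = s(m := length x)"
    using assms s by (auto simp: \<sigma>_def fun_eq_iff unused_from_def)
  then have clear: "exec x [While 0 3 [Dec 0]] (\<sigma> (length x)) (2 * Suc (length x) + 1)
      (s(m := length x), z)"
    using exec_clear[of x 0 "fst (\<sigma> (length x))" z] assms by (simp add: \<sigma>_def)
  show "exec x [Inc 0, While 0 0 [Inc 0, Inc m], While 0 3 [Dec 0]] (s, z)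
      (1 + ((length x * 3 + 1) + (2 * Suc (length x) + 1))) (s(m := length x), z)"
    by (rule exec_Cons[OF start exec_Cons[OF scan clear]])
qed

lemma ptime_fun_length: "ptime_fun n (\<lambda>x E. length x)"
  by (intro ptime_funI exI conjI, rule computes_length)
    (simp add: arg_regs_def, intro poly_bounded_intros)

lemma exec_test_input:
  assumes "0 < m" "unused_from m s"
  shows "exec x [If 0 2 [Inc m] []] (s(0 := Suc v), z) 2
    (s(0 := Suc v, m := of_bool (v < length x \<and> x ! v)), z)"
proof -
  let ?s = "s(0 := Suc v)"
  have symbol: "reg_symbol x 0 (?s 0) = 2 \<longleftrightarrow> v < length x \<and> x ! v"
    by (auto simp: reg_symbol_def)
  have "?s m = 0" using assms by (simp add: unused_from_def)
  then have "exec x (if v < length x \<and> x ! v then [Inc m] else []) (?s, z) 1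
      (?s(m := of_bool (v < length x \<and> x ! v)), z)"
    using exec_Inc[of x m ?s z] exec_mono[OF exec_Nil, of 1 x "(?s, z)"]
    by (simp add: fun_upd_idem)
  then show ?thesis
    using exec_If[of x 0 ?s 2 "[Inc m]" "[]" z 1] by (simp only: symbol Suc_1)
qed

lemma computes_input_bit:
  assumes f: "computes c T rs m f" and "0 < m"
  shows "computes (c @ [While m 3 [Dec m, Inc 0], Inc 0, If 0 2 [Inc m] [], While 0 3 [Dec 0]])
    (\<lambda>x E. T x E + ((3 * f x E + 1) + (1 + (2 + (2 * Suc (f x E) + 1))))) rs m
    (\<lambda>x E. of_bool (f x E < length x \<and> x ! f x E))"
  unfolding computes_def
proof (intro allI impI)
  fix x s and z :: "bool list"
  assume s: "unused_from m s"
  let ?E = "env_of s rs"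
  let ?v = "f x ?E" and ?b = "of_bool (f x ?E < length x \<and> x ! f x ?E) :: nat"
  have zero: "s 0 = 0" "s m = 0" using s by (auto simp: unused_from_def)
  have "s(m := ?v, m := 0, 0 := ?v) = s(0 := ?v)" using zero by (auto simp: fun_eq_iff)
  then have position: "exec x [While m 3 [Dec m, Inc 0]] (s(m := ?v), z) (3 * ?v + 1) (s(0 := ?v), z)"
    using exec_move[of m 0 x "s(m := ?v)" z] zero \<open>0 < m\<close> by simp
  have shift: "exec x [Inc 0] (s(0 := ?v), z) 1 (s(0 := Suc ?v), z)"
    using exec_Inc[of x 0 "s(0 := ?v)" z] by simp
  have "s(0 := Suc ?v, m := ?b, 0 := 0) = s(m := ?b)"
    using zero \<open>0 < m\<close> by (auto simp: fun_eq_iff)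
  then have clear: "exec x [While 0 3 [Dec 0]] (s(0 := Suc ?v, m := ?b), z) (2 * Suc ?v + 1)
      (s(m := ?b), z)"
    using exec_clear[of x 0 "s(0 := Suc ?v, m := ?b)" z] \<open>0 < m\<close> by simp
  show "exec x (c @ [While m 3 [Dec m, Inc 0], Inc 0, If 0 2 [Inc m] [], While 0 3 [Dec 0]]) (s, z)
      (T x ?E + ((3 * ?v + 1) + (1 + (2 + (2 * Suc ?v + 1))))) (s(m := ?b), z)"
    by (rule exec_append[OF computesD[OF f s] exec_Cons[OF position exec_Cons[OF shift
        exec_Cons[OF exec_test_input[OF \<open>0 < m\<close> s] clear]]]])
qed

lemma ptime_fun_input_bit:
  assumes "ptime_fun n f"
  shows "ptime_fun n (\<lambda>x E. of_bool (f x E < length x \<and> x ! f x E))"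
proof (rule ptime_funI)
  fix rs m assume rs: "arg_regs n rs m"
  obtain c T where prog: "poly_bounded n T" "computes c T rs m f" by (rule ptime_funE[OF assms rs])
  have "0 < m" using rs by (simp add: arg_regs_def)
  show "\<exists>c T. computes c T rs m (\<lambda>x E. of_bool (f x E < length x \<and> x ! f x E)) \<and>
      poly_bounded n T"
    by (intro exI conjI, rule computes_input_bit[OF prog(2)])
      (rule \<open>0 < m\<close>, intro poly_bounded_intros prog(1) poly_bounded_ptime_fun[OF assms])
qed

subsection \<open>Iteration\<close>

text \<open>
  The registers \<open>m\<close>, \<open>m + 1\<close> and \<open>m + 2\<close> hold the accumulator, the number of rounds done and the
  number of rounds to go.
\<close>

definition iterate_body :: "cmd list \<Rightarrow> nat \<Rightarrow> cmd list" where
  "iterate_body c m = c @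
     [While m 3 [Dec m], While (m + 3) 3 [Dec (m + 3), Inc m], Inc (m + 1), Dec (m + 2)]"

lemma exec_iterate_body:
  assumes g: "computes c T (m # (m + 1) # rs) (m + 3) g"
    and rs: "arg_regs n rs m" and s: "unused_from m s"
  defines "E u v \<equiv> case_nat u (case_nat v (env_of s rs))"
  shows "exec x (iterate_body c m) (s(m := u, m + 1 := v, m + 2 := Suc w), z)
    (T x (E u v) + (2 * u + 3 * g x (E u v) + 4)) (s(m := g x (E u v), m + 1 := Suc v, m + 2 := w), z)"
proof -
  let ?u = "g x (E u v)"
  let ?s0 = "s(m := u, m + 1 := v, m + 2 := Suc w)"
  let ?s1 = "?s0(m + 3 := ?u)"
  let ?s2 = "?s1(m := 0)"
  let ?s3 = "?s0(m := ?u)"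
  let ?s4 = "?s3(m + 1 := Suc v)"
  have zero: "s (m + 3) = 0" using s by (simp add: unused_from_def)
  have "unused_from (m + 3) ?s0" using s rs by (auto simp: unused_from_def arg_regs_def)
  then have step: "exec x c (?s0, z) (T x (E u v)) (?s1, z)"
    using computesD[OF g, of ?s0 x z] by (simp add: env_of_upd[OF rs] E_def)
  have clear: "exec x [While m 3 [Dec m]] (?s1, z) (2 * u + 1) (?s2, z)"
    using exec_clear[of x m ?s1 z] by simp
  have "?s2(m + 3 := 0, m := ?u) = ?s3" using zero by (auto simp: fun_eq_iff)
  then have move: "exec x [While (m + 3) 3 [Dec (m + 3), Inc m]] (?s2, z) (3 * ?u + 1) (?s3, z)"
    using exec_move[of "m + 3" m x ?s2 z] by simp
  have count: "exec x [Inc (m + 1)] (?s3, z) 1 (?s4, z)"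
    using exec_Inc[of x "m + 1" ?s3 z] by simp
  have "?s4(m + 2 := w) = s(m := ?u, m + 1 := Suc v, m + 2 := w)" by (auto simp: fun_eq_iff)
  then have "exec x [Dec (m + 2)] (?s4, z) 1 (s(m := ?u, m + 1 := Suc v, m + 2 := w), z)"
    using exec_Dec[of x "m + 2" ?s4 z] by simp
  from exec_append[OF step exec_Cons[OF clear exec_Cons[OF move exec_Cons[OF count this]]]]
  show ?thesis unfolding iterate_body_def by (rule exec_mono) simp
qed

definition iterate :: "env_fun \<Rightarrow> env_fun \<Rightarrow> nat \<Rightarrow> env_fun" where
  "iterate a g j x E = rec_nat (a x E) (\<lambda>i u. g x (case_nat u (case_nat i E))) j"

lemma iterate_simps [simp]:
  "iterate a g 0 x E = a x E"
  "iterate a g (Suc j) x E = g x (case_nat (iterate a g j x E) (case_nat j E))"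
  by (simp_all add: iterate_def)

lemma computes_iterate:
  assumes a: "computes ca Ta rs m a" and f: "computes cf Tf rs (m + 2) f"
    and g: "computes cg Tg (m # (m + 1) # rs) (m + 3) g" and rs: "arg_regs n rs m"
    and D: "\<And>x E j. is_env n E \<Longrightarrow> j < f x E \<Longrightarrow>
      Tg x (case_nat (iterate a g j x E) (case_nat j E)) +
        (2 * iterate a g j x E + 3 * iterate a g (Suc j) x E + 4) \<le> D x E"
  shows "computes
    (ca @ cf @ [While (m + 2) 3 (iterate_body cg m), While (m + 1) 3 [Dec (m + 1)]])
    (\<lambda>x E. Ta x E + (Tf x E + ((f x E * Suc (D x E) + 1) + (2 * f x E + 1)))) rs m
    (\<lambda>x E. iterate a g (f x E) x E)"
  unfolding computes_def
proof (intro allI impI)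
  fix x s and z :: "bool list"
  assume s: "unused_from m s"
  let ?E = "env_of s rs"
  let ?F = "f x ?E" and ?I = "\<lambda>j. iterate a g j x ?E"
  define \<sigma> where "\<sigma> j = (s(m := ?I j, m + 1 := j, m + 2 := ?F - j), z)" for j
  have "0 < m" and E: "is_env n ?E" using rs by (auto simp: arg_regs_def)
  have init: "exec x ca (s, z) (Ta x ?E) (s(m := ?I 0), z)" using computesD[OF a s] by simp
  have "unused_from (m + 2) (s(m := ?I 0))" using s \<open>0 < m\<close> by (auto simp: unused_from_def)
  moreover have "s(m := ?I 0, m + 2 := ?F) = fst (\<sigma> 0)"
    using s by (auto simp: \<sigma>_def fun_eq_iff unused_from_def)
  ultimately have bound: "exec x cf (s(m := ?I 0), z) (Tf x ?E) (\<sigma> 0)"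
    using computesD[OF f, of "s(m := ?I 0)" x z] env_of_upd[OF rs] by (simp add: \<sigma>_def)
  have loop: "exec x [While (m + 2) 3 (iterate_body cg m)] (\<sigma> 0) (?F * Suc (D x ?E) + 1) (\<sigma> ?F)"
  proof (rule exec_While_countdown)
    fix j assume j: "j < ?F"
    then have "?F - j = Suc (?F - Suc j)" by simp
    then have "exec x (iterate_body cg m) (\<sigma> j) (Tg x (case_nat (?I j) (case_nat j ?E)) +
        (2 * ?I j + 3 * ?I (Suc j) + 4)) (\<sigma> (Suc j))"
      using exec_iterate_body[OF g rs s, of x "?I j" j "?F - Suc j" z] by (simp add: \<sigma>_def)
    then show "exec x (iterate_body cg m) (\<sigma> j) (D x ?E) (\<sigma> (Suc j))"
      by (rule exec_mono) (rule D[OF E j])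
  qed (simp add: \<sigma>_def)
  have "(fst (\<sigma> ?F))(m + 1 := 0) = s(m := ?I ?F)"
    using s by (auto simp: \<sigma>_def fun_eq_iff unused_from_def)
  then have clear: "exec x [While (m + 1) 3 [Dec (m + 1)]] (\<sigma> ?F) (2 * ?F + 1) (s(m := ?I ?F), z)"
    using exec_clear[of x "m + 1" "fst (\<sigma> ?F)" z] by (simp add: \<sigma>_def)
  show "exec x (ca @ cf @ [While (m + 2) 3 (iterate_body cg m), While (m + 1) 3 [Dec (m + 1)]])
      (s, z) (Ta x ?E + (Tf x ?E + ((?F * Suc (D x ?E) + 1) + (2 * ?F + 1)))) (s(m := ?I ?F), z)"
    by (rule exec_append[OF init exec_append[OF bound exec_Cons[OF loop clear]]])
qed

lemma ptime_fun_iterate: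
  assumes f: "ptime_fun n f" and a: "ptime_fun n a" and g: "ptime_fun (Suc (Suc n)) g"
    and B: "poly_bounded n B"
    and bound: "\<And>x E j. is_env n E \<Longrightarrow> j \<le> f x E \<Longrightarrow> iterate a g j x E \<le> B x E"
  shows "ptime_fun n (\<lambda>x E. iterate a g (f x E) x E)"
proof (rule ptime_funI)
  fix rs m assume rs: "arg_regs n rs m"
  obtain ca Ta where a': "poly_bounded n Ta" "computes ca Ta rs m a" by (rule ptime_funE[OF a rs])
  have "arg_regs n rs (m + 2)" using rs by (rule arg_regs_mono) simp
  then obtain cf Tf where f': "poly_bounded n Tf" "computes cf Tf rs (m + 2) f"
    by (rule ptime_funE[OF f])
  have "arg_regs (Suc (Suc n)) (m # (m + 1) # rs) (m + 3)" using rs by (auto simp: arg_regs_def)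
  then obtain cg Tg where g': "poly_bounded (Suc (Suc n)) Tg" "computes cg Tg (m # (m + 1) # rs) (m + 3) g"
    by (rule ptime_funE[OF g])
  obtain k where k: "\<And>x E u v. is_env n E \<Longrightarrow>
      Tg x (case_nat u (case_nat v E)) \<le> (u + (v + env_size n x E)) ^ k"
    using g'(1) by (metis poly_bounded_pushE env_size_push is_env_push)
  let ?D = "\<lambda>x E. (B x E + (f x E + env_size n x E)) ^ k + (5 * B x E + 4)"
  have "Tg x (case_nat (iterate a g j x E) (case_nat j E)) +
      (2 * iterate a g j x E + 3 * iterate a g (Suc j) x E + 4) \<le> ?D x E"
    if E: "is_env n E" and j: "j < f x E" for x E j
  proof -
    have "Tg x (case_nat (iterate a g j x E) (case_nat j E)) \<le> (B x E + (f x E + env_size n x E)) ^ k"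
      using j bound[OF E, of j] by (intro order_trans[OF k[OF E]] power_mono add_mono) auto
    then show ?thesis using bound[OF E, of j x] bound[OF E, of "Suc j" x] j by linarith
  qed
  from computes_iterate[OF a'(2) f'(2) g'(2) rs this]
  show "\<exists>c T. computes c T rs m (\<lambda>x E. iterate a g (f x E) x E) \<and> poly_bounded n T"
    by (intro exI conjI) (assumption, intro poly_bounded_intros a'(1) f'(1) B poly_bounded_ptime_fun[OF f])
qed

subsection \<open>Arithmetic\<close>

lemma ptime_fun_pred:
  assumes "ptime_fun n f"
  shows "ptime_fun n (\<lambda>x E. f x E - 1)"
proof -
  have pred: "iterate (\<lambda>x E. 0) (\<lambda>x E. E 1) b x E = b - 1" for b x E by (cases b) auto
  have "ptime_fun n (\<lambda>x E. iterate (\<lambda>x E. 0) (\<lambda>x E. E 1) (f x E) x E)"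
    by (rule ptime_fun_iterate[OF assms ptime_fun_const ptime_fun_nth poly_bounded_ptime_fun[OF assms]])
      (simp, unfold pred, simp)
  then show ?thesis by (simp only: pred)
qed

lemma ptime_fun_add:
  assumes "ptime_fun n f" "ptime_fun n g"
  shows "ptime_fun n (\<lambda>x E. f x E + g x E)"
proof -
  have add: "iterate f (\<lambda>x E. Suc (E 0)) b x E = f x E + b" for b x E by (induction b) auto
  have "ptime_fun n (\<lambda>x E. iterate f (\<lambda>x E. Suc (E 0)) (g x E) x E)"
  proof (rule ptime_fun_iterate[OF assms(2,1)])
    show "poly_bounded n (\<lambda>x E. f x E + g x E)"
      by (intro poly_bounded_add assms[THEN poly_bounded_ptime_fun])
  qed (auto simp: add intro: ptime_fun_Suc ptime_fun_nth)
  then show ?thesis by (simp only: add)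
qed

lemma ptime_fun_diff:
  assumes "ptime_fun n f" "ptime_fun n g"
  shows "ptime_fun n (\<lambda>x E. f x E - g x E)"
proof -
  have diff: "iterate f (\<lambda>x E. E 0 - 1) b x E = f x E - b" for b x E by (induction b) auto
  have "ptime_fun n (\<lambda>x E. iterate f (\<lambda>x E. E 0 - 1) (g x E) x E)"
  proof (rule ptime_fun_iterate[OF assms(2,1) _ poly_bounded_ptime_fun[OF assms(1)]])
    show "ptime_fun (Suc (Suc n)) (\<lambda>x E. E 0 - 1)" by (intro ptime_fun_pred ptime_fun_nth) simp
  qed (unfold diff, simp)
  then show ?thesis by (simp only: diff)
qed

lemma ptime_fun_sum:
  assumes f: "ptime_fun n f" and h: "ptime_fun (Suc n) (\<lambda>x E. h x (\<lambda>i. E (Suc i)) (E 0))"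
  shows "ptime_fun n (\<lambda>x E. \<Sum>i<f x E. h x E i)"
proof -
  let ?g = "\<lambda>x E. E 0 + h x (\<lambda>i. E (Suc (Suc i))) (E 1)"
  have sum: "iterate (\<lambda>x E. 0) ?g b x E = (\<Sum>i<b. h x E i)" for b x E by (induction b) auto
  obtain k where k: "\<And>x E a. is_env n E \<Longrightarrow> h x E a \<le> (a + env_size n x E) ^ k"
    using poly_bounded_pushE[OF poly_bounded_ptime_fun[OF h]] by auto
  let ?B = "\<lambda>x E. f x E * (f x E + env_size n x E) ^ k"
  have "ptime_fun n (\<lambda>x E. iterate (\<lambda>x E. 0) ?g (f x E) x E)"
  proof (rule ptime_fun_iterate[OF f ptime_fun_const])
    show "ptime_fun (Suc (Suc n)) ?g"
      using ptime_fun_add[OF ptime_fun_nth[of 0] ptime_fun_shift[OF h]] by simp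
    show "poly_bounded n ?B" by (intro poly_bounded_intros poly_bounded_ptime_fun[OF f])
    fix x E j assume E: "is_env n E" and j: "j \<le> f x E"
    have "(\<Sum>i<j. h x E i) \<le> (\<Sum>i<j. (f x E + env_size n x E) ^ k)"
      using j by (intro sum_mono order_trans[OF k[OF E]] power_mono) auto
    also have "\<dots> \<le> ?B x E" using j by simp
    finally show "iterate (\<lambda>x E. 0) ?g j x E \<le> ?B x E" by (simp only: sum)
  qed
  then show ?thesis by (simp only: sum)
qed

lemma ptime_fun_mult:
  assumes "ptime_fun n f" "ptime_fun n g"
  shows "ptime_fun n (\<lambda>x E. f x E * g x E)"
  using ptime_fun_sum[OF assms(1), of "\<lambda>x E i. g x E"] ptime_fun_shift[OF assms(2)] by simp

lemma ptime_fun_poly: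
  assumes "ptime_fun n f"
  shows "ptime_fun n (\<lambda>x E. poly p (f x E))"
proof (induction p)
  case (pCons a p)
  have "ptime_fun n (\<lambda>x E. a + f x E * poly p (f x E))"
    by (intro ptime_fun_add ptime_fun_const ptime_fun_mult assms pCons.IH)
  then show ?case by simp
qed (simp add: ptime_fun_const)

subsection \<open>Bounded quantification\<close>

abbreviation ptime_pred :: "nat \<Rightarrow> (bool list \<Rightarrow> env \<Rightarrow> bool) \<Rightarrow> bool" where
  "ptime_pred n P \<equiv> ptime_fun n (\<lambda>x E. of_bool (P x E))"

lemma ptime_fun_if:
  assumes "ptime_pred n P" "ptime_fun n f" "ptime_fun n g"
  shows "ptime_fun n (\<lambda>x E. if P x E then f x E else g x E)"
  by (rule ptime_fun_cong[OF ptime_fun_if_0[OF assms(1,3,2)]]) auto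

lemma ptime_pred_const: "ptime_pred n (\<lambda>x E. b)"
  by (rule ptime_fun_const)

lemma ptime_pred_not:
  assumes "ptime_pred n P"
  shows "ptime_pred n (\<lambda>x E. \<not> P x E)"
  by (rule ptime_fun_cong[OF ptime_fun_if[OF assms ptime_fun_const[of _ 0] ptime_fun_const[of _ 1]]]) auto

lemma ptime_pred_conj:
  assumes "ptime_pred n P" "ptime_pred n Q"
  shows "ptime_pred n (\<lambda>x E. P x E \<and> Q x E)"
  by (rule ptime_fun_cong[OF ptime_fun_mult[OF assms]]) auto

lemma ptime_pred_disj:
  assumes "ptime_pred n P" "ptime_pred n Q"
  shows "ptime_pred n (\<lambda>x E. P x E \<or> Q x E)"
  by (rule ptime_fun_cong[OF ptime_fun_if[OF assms(1) ptime_fun_const[of _ 1] assms(2)]]) auto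

lemma ptime_pred_imp:
  assumes "ptime_pred n P" "ptime_pred n Q"
  shows "ptime_pred n (\<lambda>x E. P x E \<longrightarrow> Q x E)"
  by (rule ptime_fun_cong[OF ptime_fun_if[OF assms ptime_fun_const[of _ 1]]]) auto

lemma ptime_pred_if:
  assumes "ptime_pred n P" "ptime_pred n Q" "ptime_pred n R"
  shows "ptime_pred n (\<lambda>x E. if P x E then Q x E else R x E)"
  by (rule ptime_fun_cong[OF ptime_fun_if[OF assms]]) auto

lemma ptime_pred_le:
  assumes "ptime_fun n f" "ptime_fun n g"
  shows "ptime_pred n (\<lambda>x E. f x E \<le> g x E)"
  by (rule ptime_fun_cong[OF
        ptime_fun_if_0[OF ptime_fun_diff[OF assms] ptime_fun_const[of _ 1] ptime_fun_const[of _ 0]]]) auto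

lemma ptime_pred_less:
  assumes "ptime_fun n f" "ptime_fun n g"
  shows "ptime_pred n (\<lambda>x E. f x E < g x E)"
  using ptime_pred_le[OF ptime_fun_Suc[OF assms(1)] assms(2)] by (simp add: Suc_le_eq)

lemma ptime_pred_eq:
  assumes "ptime_fun n f" "ptime_fun n g"
  shows "ptime_pred n (\<lambda>x E. f x E = g x E)"
  by (rule ptime_fun_cong[OF
        ptime_pred_conj[OF ptime_pred_le[OF assms] ptime_pred_le[OF assms(2,1)]]]) auto

lemma ptime_pred_iff:
  assumes "ptime_pred n P" "ptime_pred n Q"
  shows "ptime_pred n (\<lambda>x E. P x E \<longleftrightarrow> Q x E)"
  by (rule ptime_fun_cong[OF ptime_pred_eq[OF assms]]) auto

lemma ptime_pred_ex:
  assumes "ptime_fun n f" "ptime_pred (Suc n) (\<lambda>x E. P x (\<lambda>i. E (Suc i)) (E 0))"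
  shows "ptime_pred n (\<lambda>x E. \<exists>i<f x E. P x E i)"
proof (rule ptime_fun_cong[OF ptime_pred_less[OF ptime_fun_const[of _ 0] ptime_fun_sum[OF assms(1)]]])
  show "ptime_fun (Suc n) (\<lambda>x E. of_bool (P x (\<lambda>i. E (Suc i)) (E 0)))" by (rule assms(2))
qed auto

lemma ptime_pred_all:
  assumes "ptime_fun n f" "ptime_pred (Suc n) (\<lambda>x E. P x (\<lambda>i. E (Suc i)) (E 0))"
  shows "ptime_pred n (\<lambda>x E. \<forall>i<f x E. P x E i)"
  by (rule ptime_fun_cong[OF ptime_pred_not[OF
        ptime_pred_ex[OF assms(1) ptime_pred_not[OF assms(2)]]]]) auto

lemma ptime_pred_finite_ex:
  assumes "finite S" "\<And>a. a \<in> S \<Longrightarrow> ptime_pred n (P a)"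
  shows "ptime_pred n (\<lambda>x E. \<exists>a\<in>S. P a x E)"
  using assms
proof (induction S rule: finite_induct)
  case (insert a S)
  have "ptime_pred n (\<lambda>x E. P a x E \<or> (\<exists>a\<in>S. P a x E))"
    by (rule ptime_pred_disj) (use insert in auto)
  then show ?case by simp
qed (use ptime_pred_const[of n False] in simp)

definition least_below :: "nat \<Rightarrow> (nat \<Rightarrow> bool) \<Rightarrow> nat" where
  "least_below b P = (LEAST i. i = b \<or> P i)"

lemma least_below_eq:
  assumes "i < b" "P i" "\<And>j. j < i \<Longrightarrow> \<not> P j"
  shows "least_below b P = i"
  unfolding least_below_def
proof (rule Least_equality)
  show "i \<le> j" if "j = b \<or> P j" for j using that assms by (meson leI less_imp_le)
qed (use assms(2) in blast)

lemma least_below_eq_sum: "least_below b P = (\<Sum>i<b. of_bool (\<forall>j<Suc i. \<not> P j))"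
proof -
  let ?m = "least_below b P"
  have m: "?m = b \<or> P ?m" unfolding least_below_def by (rule LeastI[of _ b]) simp
  have "?m \<le> b" unfolding least_below_def by (rule Least_le) simp
  have not_below: "\<not> P j" if "j < ?m" for j
    using not_less_Least[OF that[unfolded least_below_def]] by blast
  have "(\<forall>j<Suc i. \<not> P j) \<longleftrightarrow> i < ?m" if "i < b" for i
  proof
    assume "\<forall>j<Suc i. \<not> P j"
    then have "?m < Suc i \<Longrightarrow> \<not> P ?m" by blast
    then show "i < ?m" using m that by linarith
  next
    assume "i < ?m"
    then show "\<forall>j<Suc i. \<not> P j" using not_below by simp
  qed
  then have "(\<Sum>i<b. of_bool (\<forall>j<Suc i. \<not> P j)) = (\<Sum>i<b. of_bool (i < ?m))"
    by (intro sum.cong) simp_all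
  also have "\<dots> = card ({..<b} \<inter> {..<?m})" by (simp add: lessThan_def)
  also have "{..<b} \<inter> {..<?m} = {..<?m}" using \<open>?m \<le> b\<close> by (intro Int_absorb1) simp
  finally show ?thesis by simp
qed

lemma ptime_fun_least_below:
  assumes "ptime_fun n f" "ptime_pred (Suc n) (\<lambda>x E. P x (\<lambda>i. E (Suc i)) (E 0))"
  shows "ptime_fun n (\<lambda>x E. least_below (f x E) (P x E))"
proof -
  let ?skip = "case_nat 0 (\<lambda>i. Suc (Suc i))"
  have "ptime_pred (Suc (Suc n)) (\<lambda>x E. P x (\<lambda>i. E (Suc (Suc i))) (E 0))"
  proof (rule ptime_fun_cong[OF ptime_fun_reindex[OF assms(2), of ?skip]])
    fix x :: "bool list" and E :: env assume "is_env (Suc (Suc n)) E"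
    then have "(\<lambda>i. reindex (Suc n) ?skip E (Suc i)) = (\<lambda>i. E (Suc (Suc i)))"
      by (auto simp: is_env_def reindex_def fun_eq_iff)
    moreover have "reindex (Suc n) ?skip E 0 = E 0" by (simp add: reindex_def)
    ultimately show "of_bool (P x (\<lambda>i. reindex (Suc n) ?skip E (Suc i)) (reindex (Suc n) ?skip E 0)) =
        (of_bool (P x (\<lambda>i. E (Suc (Suc i))) (E 0)) :: nat)"
      by simp
  qed (auto split: nat.splits)
  then show ?thesis
    unfolding least_below_eq_sum
    by (intro ptime_fun_sum ptime_pred_all ptime_pred_not ptime_fun_Suc ptime_fun_nth assms(1)) simp_all
qed

lemma sum_of_bool_mult_le_eq_div:
  fixes a b :: nat
  assumes "b > 0"
  shows "(\<Sum>i<a. of_bool (Suc i * b \<le> a)) = a div b"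
proof -
  have le_iff: "Suc i * b \<le> a \<longleftrightarrow> i < a div b" for i
    using less_eq_div_iff_mult_less_eq[OF assms, of "Suc i" a] by (simp only: Suc_le_eq)
  have "(\<Sum>i<a. of_bool (i < a div b)) = card ({..<a} \<inter> {..<a div b})" by (simp add: lessThan_def)
  also have "{..<a} \<inter> {..<a div b} = {..<a div b}" using div_le_dividend[of a b] by (intro Int_absorb1) simp
  finally show ?thesis by (simp only: le_iff card_lessThan)
qed

lemma ptime_fun_div:
  assumes "ptime_fun n f" "ptime_fun n g"
  shows "ptime_fun n (\<lambda>x E. f x E div g x E)"
proof -
  have "ptime_fun n (\<lambda>x E. if g x E = 0 then 0 else \<Sum>i<f x E. of_bool (Suc i * g x E \<le> f x E))"
    by (intro ptime_fun_if_0 ptime_fun_sum ptime_fun_const ptime_pred_le ptime_fun_mult ptime_fun_Suc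
        ptime_fun_nth ptime_fun_shift assms zero_less_Suc)
  then show ?thesis
  proof (rule ptime_fun_cong)
    show "(if g x E = 0 then 0 else \<Sum>i<f x E. of_bool (Suc i * g x E \<le> f x E)) = f x E div g x E" for x E
      using sum_of_bool_mult_le_eq_div[of "g x E" "f x E"] by (cases "g x E = 0") simp_all
  qed
qed

lemma ptime_fun_mod:
  assumes "ptime_fun n f" "ptime_fun n g"
  shows "ptime_fun n (\<lambda>x E. f x E mod g x E)"
  using ptime_fun_diff[OF assms(1) ptime_fun_mult[OF ptime_fun_div[OF assms] assms(2)]]
  by (simp add: minus_div_mult_eq_mod)

lemmas ptime_intros = ptime_fun_const ptime_fun_nth ptime_fun_Suc ptime_fun_add ptime_fun_diff
  ptime_fun_mult ptime_fun_div ptime_fun_mod ptime_fun_length ptime_fun_if ptime_pred_not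
  ptime_pred_conj ptime_pred_disj ptime_pred_imp ptime_pred_if ptime_pred_le ptime_pred_less
  ptime_pred_eq ptime_pred_iff ptime_pred_ex ptime_pred_all ptime_fun_sum ptime_fun_least_below
  ptime_fun_input_bit

subsection \<open>Computable strings\<close>

lemma poly_bounded_imp_le_poly:
  assumes "poly_bounded n g"
  obtains q :: "nat poly" where "\<And>x. g x (\<lambda>_. 0) \<le> poly q (length x)"
proof -
  obtain k where k: "\<And>x E. is_env n E \<Longrightarrow> g x E \<le> env_size n x E ^ k"
    by (rule poly_boundedE[OF assms]) blast
  have "g x (\<lambda>_. 0) \<le> poly ([:2, 1:] ^ k) (length x)" for x
    using k[of "\<lambda>_. 0" x] by (simp add: is_env_def env_size_def)
  then show ?thesis using that by blast
qed

text \<open>Registers 1, 2 and 3 hold the index, the number of remaining indices and the bit to output.\<close>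

definition output_body :: "cmd list \<Rightarrow> cmd list" where
  "output_body c = c @ [If 3 3 [Out False] [Dec 3, Out True], Inc 1, Dec 2]"

lemma exec_output_bit:
  assumes "s 3 = 0"
  shows "exec x [If 3 3 [Out False] [Dec 3, Out True]] (s(3 := of_bool b), z) 3 (s, z @ [b])"
proof -
  let ?s = "s(3 := of_bool b)"
  have reset: "s(3 := 0) = s" using assms by (auto simp: fun_eq_iff)
  have "exec x (if reg_symbol x 3 (?s 3) = 3 then [Out False] else [Dec 3, Out True]) (?s, z) 2 (s, z @ [b])"
  proof (cases b)
    case True
    then show ?thesis
      using exec_Cons[OF exec_Dec[of x 3 ?s z] exec_Out[of x True]] reset
      by (simp add: numeral_2_eq_2)
  next
    case False
    then show ?thesis using exec_mono[OF exec_Out[of x False s z], of 2] reset assms by simp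
  qed
  from exec_If[OF this] show ?thesis by (simp only: eval_nat_numeral)
qed

lemma exec_output_body:
  assumes b: "computes c T [1] 3 (\<lambda>x E. of_bool (b x (E 0)))"
  shows "exec x (output_body c) ((\<lambda>_. 0)(1 := j, 2 := Suc w), z)
    (T x (case_nat j (\<lambda>_. 0)) + 5) ((\<lambda>_. 0)(1 := Suc j, 2 := w), z @ [b x j])"
proof -
  let ?s = "(\<lambda>_. 0)(1 := j, 2 := Suc w) :: nat \<Rightarrow> nat"
  let ?s' = "?s(1 := Suc j)"
  have "unused_from 3 ?s" by (simp add: unused_from_def)
  moreover have "env_of ?s [1] = case_nat j (\<lambda>_. 0)"
    by (auto simp: env_of_def fun_eq_iff split: nat.splits)
  ultimately have run: "exec x c (?s, z) (T x (case_nat j (\<lambda>_. 0))) (?s(3 := of_bool (b x j)), z)"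
    using computesD[OF b, of ?s x z] by (simp del: env_of_Cons)
  have emit: "exec x [If 3 3 [Out False] [Dec 3, Out True]] (?s(3 := of_bool (b x j)), z) 3
      (?s, z @ [b x j])"
    by (rule exec_output_bit) simp
  have count: "exec x [Inc 1] (?s, z @ [b x j]) 1 (?s', z @ [b x j])"
    using exec_Inc[of x 1 ?s "z @ [b x j]"] by simp
  have "?s'(2 := w) = (\<lambda>_. 0)(1 := Suc j, 2 := w)" by (auto simp: fun_eq_iff)
  then have "exec x [Dec 2] (?s', z @ [b x j]) 1 ((\<lambda>_. 0)(1 := Suc j, 2 := w), z @ [b x j])"
    using exec_Dec[of x 2 ?s' "z @ [b x j]"] by simp
  from exec_append[OF run exec_Cons[OF emit exec_Cons[OF count this]]]
  show ?thesis unfolding output_body_def by (rule exec_mono) simp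
qed

lemma exec_output_loop:
  assumes N: "computes cN TN [1] 2 (\<lambda>x E. N x)"
    and b: "computes cb Tb [1] 3 (\<lambda>x E. of_bool (b x (E 0)))"
    and D: "\<And>j. j < N x \<Longrightarrow> Tb x (case_nat j (\<lambda>_. 0)) + 5 \<le> D"
  shows "\<exists>s. exec x (cN @ [While 2 3 (output_body cb)]) (\<lambda>_. 0, [])
    (TN x (\<lambda>_. 0) + (N x * Suc D + 1)) (s, map (b x) [0..<N x])"
proof -
  define \<sigma> :: "nat \<Rightarrow> pstate" where "\<sigma> j = ((\<lambda>_. 0)(1 := j, 2 := N x - j), map (b x) [0..<j])" for j
  have "env_of (\<lambda>_. 0) [1] = (\<lambda>_. 0)"
    by (auto simp: env_of_def fun_eq_iff simp del: env_of_Cons)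
  moreover have "(\<lambda>_. 0)(2 := N x) = fst (\<sigma> 0)" by (auto simp: \<sigma>_def fun_eq_iff)
  ultimately have init: "exec x cN (\<lambda>_. 0, []) (TN x (\<lambda>_. 0)) (\<sigma> 0)"
    using computesD[OF N, of "\<lambda>_. 0" x "[]"] by (simp add: \<sigma>_def unused_from_def)
  have "exec x [While 2 3 (output_body cb)] (\<sigma> 0) (N x * Suc D + 1) (\<sigma> (N x))"
  proof (rule exec_While_countdown)
    fix j assume j: "j < N x"
    then have "N x - j = Suc (N x - Suc j)" by simp
    then have "exec x (output_body cb) (\<sigma> j) (Tb x (case_nat j (\<lambda>_. 0)) + 5) (\<sigma> (Suc j))"
      using exec_output_body[OF b, of x j "N x - Suc j" "map (b x) [0..<j]"] by (simp add: \<sigma>_def)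
    then show "exec x (output_body cb) (\<sigma> j) D (\<sigma> (Suc j))" using D[OF j] by (rule exec_mono)
  qed (simp add: \<sigma>_def)
  from exec_append[OF init this] show ?thesis unfolding \<sigma>_def by blast
qed

lemma poly_time_computable_map_upt:
  assumes N: "ptime_fun 1 (\<lambda>x E. N x)" and b: "ptime_pred 1 (\<lambda>x E. b x (E 0))"
  shows "poly_time_computable (\<lambda>x. map (b x) [0..<N x])"
proof -
  obtain cN TN where TN: "poly_bounded 1 TN" and cN: "computes cN TN [1] 2 (\<lambda>x E. N x)"
    by (rule ptime_funE[OF N, of "[1]" 2]) (auto simp: arg_regs_def)
  obtain cb Tb where Tb: "poly_bounded 1 Tb" and cb: "computes cb Tb [1] 3 (\<lambda>x E. of_bool (b x (E 0)))"
    by (rule ptime_funE[OF b, of "[1]" 3]) (auto simp: arg_regs_def)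
  obtain k where "\<And>x E a. is_env 0 E \<Longrightarrow> Tb x (case_nat a E) \<le> (a + env_size 0 x E) ^ k"
    by (rule poly_bounded_pushE[of 0 Tb]) (use Tb in auto)
  then have k: "Tb x (case_nat a (\<lambda>_. 0)) \<le> (a + env_size 0 x (\<lambda>_. 0)) ^ k" for x a
    by (simp add: is_env_def)
  let ?D = "\<lambda>x E. (N x + env_size 1 x E) ^ k + 5"
  have "poly_bounded 1 (\<lambda>x E. TN x E + (N x * Suc (?D x E) + 1))"
    using TN poly_bounded_ptime_fun[OF N] by (intro poly_bounded_intros)
  then obtain q :: "nat poly" where
    q: "\<And>x. TN x (\<lambda>_. 0) + (N x * Suc (?D x (\<lambda>_. 0)) + 1) \<le> poly q (length x)"
    by (rule poly_bounded_imp_le_poly) blast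
  show ?thesis
  proof (rule poly_time_computable_program)
    fix x
    have "Tb x (case_nat j (\<lambda>_. 0)) + 5 \<le> ?D x (\<lambda>_. 0)" if "j < N x" for j
      using that by (intro add_mono order_trans[OF k] power_mono) (auto simp: env_size_def)
    from exec_output_loop[OF cN cb this] obtain s where
      "exec x (cN @ [While 2 3 (output_body cb)]) (\<lambda>_. 0, [])
        (TN x (\<lambda>_. 0) + (N x * Suc (?D x (\<lambda>_. 0)) + 1)) (s, map (b x) [0..<N x])"
      by blast
    from exec_mono[OF this q]
    show "\<exists>s. exec x (cN @ [While 2 3 (output_body cb)]) (\<lambda>_. 0, []) (poly q (length x))
        (s, map (b x) [0..<N x])"
      by blast
  qed
qed

section \<open>Membership in NP\<close>

subsection \<open>Decoding pairs\<close>

lemma length_pair_string: "length (pair_string x y) = 2 * length x + 2 + length y"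
  by (induction x) (auto simp: pair_string_def)

lemma nth_pair_string:
  "pair_string x y ! i =
     (if i < 2 * length x then x ! (i div 2) else if i = 2 * length x then False
      else if i = 2 * length x + 1 then True else y ! (i - 2 * length x - 2))"
proof (induction x arbitrary: i)
  case Nil
  then show ?case by (cases i rule: nat.exhaust; cases "i - 1") (auto simp: pair_string_def)
next
  case (Cons b x)
  have pair_Cons: "pair_string (b # x) y = b # b # pair_string x y" by (simp add: pair_string_def)
  consider "i = 0" | "i = 1" | j where "i = j + 2"
    by (metis One_nat_def add_2_eq_Suc' not0_implies_Suc)
  then show ?case
  proof cases
    case 3
    then have "pair_string (b # x) y ! i = pair_string x y ! j" unfolding pair_Cons by simp
    moreover have "i div 2 = Suc (j div 2)" using 3 by simp
    ultimately show ?thesis using 3 Cons.IH[of j] by auto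
  qed (auto simp: pair_Cons)
qed

definition bit_at :: "bool list \<Rightarrow> nat \<Rightarrow> bool" where
  "bit_at x i \<longleftrightarrow> i < length x \<and> x ! i"

text \<open>
  Strings are decoded in terms of their bits: \<open>fst_bits b \<beta>\<close> and \<open>snd_bits b \<beta>\<close> are the bits of the
  components of a pair with the bits \<open>\<beta>\<close>, where \<open>b\<close> exceeds the length of the first component.
\<close>

definition split_at :: "nat \<Rightarrow> (nat \<Rightarrow> bool) \<Rightarrow> nat" where
  "split_at b \<beta> = least_below b (\<lambda>i. \<beta> (2 * i) \<noteq> \<beta> (2 * i + 1))"

definition fst_bits :: "nat \<Rightarrow> (nat \<Rightarrow> bool) \<Rightarrow> nat \<Rightarrow> bool" where
  "fst_bits b \<beta> i \<longleftrightarrow> i < split_at b \<beta> \<and> \<beta> (2 * i)"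

definition snd_bits :: "nat \<Rightarrow> (nat \<Rightarrow> bool) \<Rightarrow> nat \<Rightarrow> bool" where
  "snd_bits b \<beta> i \<longleftrightarrow> \<beta> (2 * split_at b \<beta> + 2 + i)"

lemma split_at_pair_string:
  assumes "length x < b"
  shows "split_at b (bit_at (pair_string x y)) = length x"
  unfolding split_at_def
  by (rule least_below_eq) (use assms in \<open>auto simp: bit_at_def length_pair_string nth_pair_string\<close>)

lemma fst_bits_pair_string:
  assumes "length x < b"
  shows "fst_bits b (bit_at (pair_string x y)) = bit_at x"
  by (rule ext)
    (auto simp: fst_bits_def split_at_pair_string[OF assms] bit_at_def length_pair_string nth_pair_string)

lemma snd_bits_pair_string:
  assumes "length x < b"
  shows "snd_bits b (bit_at (pair_string x y)) = bit_at y"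
  by (rule ext)
    (auto simp: snd_bits_def split_at_pair_string[OF assms] bit_at_def length_pair_string nth_pair_string)

definition ptime_bits :: "(bool list \<Rightarrow> nat \<Rightarrow> bool) \<Rightarrow> bool" where
  "ptime_bits \<beta> \<longleftrightarrow> ptime_pred 1 (\<lambda>x E. \<beta> x (E 0))"

lemma ptime_pred_bits: "ptime_bits \<beta> \<Longrightarrow> ptime_fun n f \<Longrightarrow> ptime_pred n (\<lambda>x E. \<beta> x (f x E))"
  unfolding ptime_bits_def by (rule ptime_fun_compose)

lemma ptime_bitsI: "(\<And>n f. ptime_fun n f \<Longrightarrow> ptime_pred n (\<lambda>x E. \<beta> x (f x E))) \<Longrightarrow> ptime_bits \<beta>"
  unfolding ptime_bits_def using ptime_fun_nth[of 0 1] by simp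

lemma ptime_bits_input: "ptime_bits bit_at"
  unfolding bit_at_def by (intro ptime_bitsI ptime_fun_input_bit)

lemma ptime_fun_split_at:
  assumes "ptime_bits \<beta>"
  shows "ptime_fun n (\<lambda>x E. split_at (length x) (\<beta> x))"
  unfolding split_at_def by (intro ptime_intros ptime_pred_bits[OF assms]) simp_all

lemma ptime_bits_fst:
  assumes "ptime_bits \<beta>"
  shows "ptime_bits (\<lambda>x. fst_bits (length x) (\<beta> x))"
  unfolding fst_bits_def
  by (intro ptime_bitsI ptime_intros ptime_pred_bits[OF assms] ptime_fun_split_at[OF assms])

lemma ptime_bits_snd:
  assumes "ptime_bits \<beta>"
  shows "ptime_bits (\<lambda>x. snd_bits (length x) (\<beta> x))"
  unfolding snd_bits_def
  by (intro ptime_bitsI ptime_intros ptime_pred_bits[OF assms] ptime_fun_split_at[OF assms])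

subsection \<open>Comparing products of binary numbers\<close>

lemma horner_sum_nat_string: "horner_sum of_bool 2 (nat_string m) = m"
proof (induction m rule: nat_string.induct)
  case (1 m)
  show ?case
  proof (cases "m = 0")
    case False
    then have "nat_string m = odd m # nat_string (m div 2)" by (subst nat_string.simps) simp
    then have "horner_sum of_bool 2 (nat_string m) = of_bool (odd m) + 2 * (m div 2)"
      using 1 False by simp
    also have "\<dots> = m" by (simp add: mult.commute flip: of_bool_odd_eq_mod_2)
    finally show ?thesis .
  qed (simp add: nat_string.simps)
qed

lemma sum_bit_at_nat_string:
  assumes "length (nat_string m) \<le> L"
  shows "(\<Sum>i<L. 2 ^ i * of_bool (bit_at (nat_string m) i)) = m"
proof -
  have "(\<Sum>i<L. 2 ^ i * of_bool (bit_at (nat_string m) i) :: nat) =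
      (\<Sum>i<length (nat_string m). 2 ^ i * of_bool (bit_at (nat_string m) i))"
    using assms by (intro sum.mono_neutral_right) (auto simp: bit_at_def)
  also have "\<dots> = horner_sum of_bool 2 (nat_string m)"
    unfolding horner_sum_eq_sum by (intro sum.cong) (auto simp: bit_at_def)
  finally show ?thesis by (simp only: horner_sum_nat_string)
qed

text \<open>
  Two products are compared bit by bit, from the least significant one, carrying only a small number:
  after \<open>L\<close> steps the carry is \<open>\<lfloor>(n * a + k * (2 ^ L - b)) / 2 ^ L\<rfloor>\<close> for the numbers \<open>a\<close> and \<open>b\<close> with
  the given bits.
\<close>

definition carry :: "nat \<Rightarrow> nat \<Rightarrow> (nat \<Rightarrow> bool) \<Rightarrow> (nat \<Rightarrow> bool) \<Rightarrow> nat \<Rightarrow> nat" where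
  "carry n k a b = rec_nat k (\<lambda>i c. (c + n * of_bool (a i) + k * of_bool (\<not> b i)) div 2)"

lemma carry_simps [simp]:
  "carry n k a b 0 = k"
  "carry n k a b (Suc i) = (carry n k a b i + n * of_bool (a i) + k * of_bool (\<not> b i)) div 2"
  by (simp_all add: carry_def)

lemma carry_le: "carry n k a b i \<le> n + k"
proof (induction i)
  case (Suc i)
  have "carry n k a b i + n * of_bool (a i) + k * of_bool (\<not> b i) \<le> (n + k) + n + k"
    using Suc by (intro add_mono) auto
  then have "carry n k a b i + n * of_bool (a i) + k * of_bool (\<not> b i) \<le> 2 * (n + k)" by simp
  then have "(carry n k a b i + n * of_bool (a i) + k * of_bool (\<not> b i)) div 2 \<le> 2 * (n + k) div 2"
    by (rule div_le_mono)
  then show ?case by simp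
qed simp

lemma carry_eq:
  "carry n k a b L = (k + (\<Sum>i<L. 2 ^ i * (n * of_bool (a i) + k * of_bool (\<not> b i)))) div 2 ^ L"
proof (induction L)
  case (Suc L)
  let ?s = "k + (\<Sum>i<L. 2 ^ i * (n * of_bool (a i) + k * of_bool (\<not> b i)))"
  let ?y = "n * of_bool (a L) + k * of_bool (\<not> b L)"
  have "carry n k a b (Suc L) = (?s div 2 ^ L + ?y) div 2" using Suc by simp
  also have "?s div 2 ^ L + ?y = (?s + 2 ^ L * ?y) div 2 ^ L" by simp
  also have "\<dots> div 2 = (?s + 2 ^ L * ?y) div 2 ^ Suc L" by (simp only: div_mult2_eq power_Suc2)
  finally show ?case by (simp only: sum.lessThan_Suc add.assoc)
qed simp

lemma le_carry_iff:
  "k \<le> carry n k a b L \<longleftrightarrow> k * (\<Sum>i<L. 2 ^ i * of_bool (b i)) \<le> n * (\<Sum>i<L. 2 ^ i * of_bool (a i))"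
proof -
  let ?a = "\<Sum>i<L. 2 ^ i * of_bool (a i) :: nat" and ?b = "\<Sum>i<L. 2 ^ i * of_bool (b i) :: nat"
    and ?c = "\<Sum>i<L. 2 ^ i * of_bool (\<not> b i) :: nat"
  have "2 ^ L = Suc (\<Sum>i<L. 2 ^ i)" by (induction L) auto
  also have "(\<Sum>i<L. 2 ^ i) = ?b + ?c"
    unfolding sum.distrib[symmetric] by (intro sum.cong) auto
  finally have complement: "2 ^ L = Suc (?b + ?c)" .
  have total: "(\<Sum>i<L. 2 ^ i * (n * of_bool (a i) + k * of_bool (\<not> b i))) = n * ?a + k * ?c"
    by (simp add: sum_distrib_left distrib_left sum.distrib mult.left_commute del: sum_mult_of_bool_eq)
  have "k \<le> carry n k a b L \<longleftrightarrow> k * 2 ^ L \<le> k + (n * ?a + k * ?c)"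
    unfolding carry_eq total by (simp add: less_eq_div_iff_mult_less_eq)
  also have "\<dots> \<longleftrightarrow> k * ?b \<le> n * ?a" unfolding complement by (simp add: algebra_simps)
  finally show ?thesis .
qed

lemma ptime_fun_carry:
  assumes "ptime_fun n f" "ptime_fun n g" "ptime_bits \<alpha>" "ptime_bits \<beta>"
  shows "ptime_fun n (\<lambda>x E. carry (f x E) (g x E) (\<alpha> x) (\<beta> x) (length x))"
proof -
  let ?step = "\<lambda>x E. (E 0 + f x (\<lambda>i. E (Suc (Suc i))) * of_bool (\<alpha> x (E 1)) +
    g x (\<lambda>i. E (Suc (Suc i))) * of_bool (\<not> \<beta> x (E 1))) div 2"
  have carry: "iterate g ?step L x E = carry (f x E) (g x E) (\<alpha> x) (\<beta> x) L" for L x E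
    by (induction L) simp_all
  have "ptime_fun n (\<lambda>x E. iterate g ?step (length x) x E)"
  proof (rule ptime_fun_iterate[OF ptime_fun_length assms(2)])
    show "ptime_fun (Suc (Suc n)) ?step"
      by (intro ptime_intros ptime_pred_bits[OF assms(3)] ptime_pred_bits[OF assms(4)]
          ptime_fun_shift[OF ptime_fun_shift[OF assms(1)]] ptime_fun_shift[OF ptime_fun_shift[OF assms(2)]])
        simp_all
    show "poly_bounded n (\<lambda>x E. f x E + g x E)"
      by (intro poly_bounded_ptime_fun ptime_fun_add assms)
  qed (unfold carry, rule carry_le)
  then show ?thesis unfolding carry .
qed

subsection \<open>The verifier\<close>

text \<open>
  The functions below refer to the parts of a string
  \<open>pair_string (pair_string g (pair_string a b)) w\<close>, where \<open>g\<close> is an adjacency matrix.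
\<close>

definition instance_bits :: "bool list \<Rightarrow> nat \<Rightarrow> bool" where
  "instance_bits y = fst_bits (length y) (bit_at y)"

definition chosen :: "bool list \<Rightarrow> nat \<Rightarrow> bool" where
  "chosen y = snd_bits (length y) (bit_at y)"

definition num_bits :: "bool list \<Rightarrow> nat \<Rightarrow> bool" where
  "num_bits y = fst_bits (length y) (snd_bits (length y) (instance_bits y))"

definition denom_bits :: "bool list \<Rightarrow> nat \<Rightarrow> bool" where
  "denom_bits y = snd_bits (length y) (snd_bits (length y) (instance_bits y))"

definition graph_order :: "bool list \<Rightarrow> nat" where
  "graph_order y = least_below (length y) (\<lambda>i. split_at (length y) (instance_bits y) \<le> i * i)"

definition adjacent :: "bool list \<Rightarrow> nat \<Rightarrow> nat \<Rightarrow> bool" where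
  "adjacent y u v \<longleftrightarrow> fst_bits (length y) (instance_bits y) (u * graph_order y + v)"

definition chosen_nbrs :: "bool list \<Rightarrow> nat \<Rightarrow> nat" where
  "chosen_nbrs y u = (\<Sum>v<graph_order y. of_bool (adjacent y u v \<and> chosen y v))"

definition chosen_count :: "bool list \<Rightarrow> nat" where
  "chosen_count y = (\<Sum>v<graph_order y. of_bool (chosen y v))"

definition accepts :: "bool list \<Rightarrow> bool" where
  "accepts y \<longleftrightarrow>
     (\<forall>u<graph_order y. \<forall>v<graph_order y. adjacent y u v \<longrightarrow> chosen_nbrs y u \<noteq> chosen_nbrs y v) \<and>
     chosen_count y \<le> carry (graph_order y) (chosen_count y) (num_bits y) (denom_bits y) (length y)"

lemma ptime_bits_instance: "ptime_bits instance_bits"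
  unfolding instance_bits_def by (intro ptime_bits_fst ptime_bits_input)

lemma ptime_bits_chosen: "ptime_bits chosen"
  unfolding chosen_def by (intro ptime_bits_snd ptime_bits_input)

lemma ptime_bits_num: "ptime_bits num_bits"
  unfolding num_bits_def by (intro ptime_bits_fst ptime_bits_snd ptime_bits_instance)

lemma ptime_bits_denom: "ptime_bits denom_bits"
  unfolding denom_bits_def by (intro ptime_bits_snd ptime_bits_instance)

lemma ptime_fun_graph_order: "ptime_fun n (\<lambda>x E. graph_order x)"
  unfolding graph_order_def by (intro ptime_intros ptime_fun_split_at ptime_bits_instance) simp_all

lemma ptime_pred_adjacent:
  "ptime_fun n f \<Longrightarrow> ptime_fun n g \<Longrightarrow> ptime_pred n (\<lambda>x E. adjacent x (f x E) (g x E))"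
  unfolding adjacent_def
  by (intro ptime_pred_bits[OF ptime_bits_fst[OF ptime_bits_instance]] ptime_intros ptime_fun_graph_order)

lemma ptime_fun_chosen_nbrs: "ptime_fun n f \<Longrightarrow> ptime_fun n (\<lambda>x E. chosen_nbrs x (f x E))"
  unfolding chosen_nbrs_def
  by (rule ptime_fun_compose)
    (intro ptime_intros ptime_fun_graph_order ptime_pred_adjacent ptime_pred_bits[OF ptime_bits_chosen]; simp)

lemma ptime_fun_chosen_count: "ptime_fun n (\<lambda>x E. chosen_count x)"
  unfolding chosen_count_def
  by (intro ptime_intros ptime_fun_graph_order ptime_pred_bits[OF ptime_bits_chosen]) simp

lemma poly_time_decidable_accepts: "poly_time_decidable accepts"
proof -
  have "ptime_pred 1 (\<lambda>x E. accepts x)"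
    unfolding accepts_def
    by (intro ptime_intros ptime_fun_graph_order ptime_pred_adjacent ptime_fun_chosen_nbrs
        ptime_fun_chosen_count ptime_fun_carry ptime_bits_num ptime_bits_denom) simp_all
  from poly_time_computable_map_upt[OF ptime_fun_const[of 1 1] this] show ?thesis
    by (simp add: poly_time_decidable_def)
qed

lemma length_adjacency_string: "length (adjacency_string n E) = n * n"
  by (simp add: adjacency_string_def)

lemma nth_adjacency_string:
  assumes "u < n" "v < n"
  shows "u * n + v < length (adjacency_string n E)" "adjacency_string n E ! (u * n + v) \<longleftrightarrow> (u, v) \<in> E"
proof -
  have "u * n + v < Suc u * n" using assms by simp
  also have "\<dots> \<le> n * n" using assms by (intro mult_right_mono) auto
  finally have "u * n + v < n * n" .
  then show "u * n + v < length (adjacency_string n E)"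
    "adjacency_string n E ! (u * n + v) \<longleftrightarrow> (u, v) \<in> E"
    using assms by (simp_all add: adjacency_string_def)
qed

context
  fixes n a b :: nat and E :: "nat rel" and w x y :: "bool list"
  defines "x \<equiv> pair_string (adjacency_string n E) (pair_string (nat_string a) (nat_string b))"
    and "y \<equiv> pair_string x w"
begin

lemma instance_bits_encoded: "instance_bits y = bit_at x"
  unfolding instance_bits_def by (subst y_def, subst fst_bits_pair_string) (simp_all add: y_def length_pair_string)

lemma chosen_encoded: "chosen y = bit_at w"
  unfolding chosen_def by (subst y_def, subst snd_bits_pair_string) (simp_all add: y_def length_pair_string)

lemma num_bits_encoded: "num_bits y = bit_at (nat_string a)"
  and denom_bits_encoded: "denom_bits y = bit_at (nat_string b)"
  unfolding num_bits_def denom_bits_def instance_bits_encoded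
  by (simp_all add: x_def y_def length_pair_string fst_bits_pair_string snd_bits_pair_string)

lemma graph_order_encoded: "graph_order y = n"
proof -
  have "split_at (length y) (instance_bits y) = n * n"
    unfolding instance_bits_encoded x_def
    by (subst split_at_pair_string) (simp_all add: x_def y_def length_pair_string length_adjacency_string)
  moreover have "n < length y"
    by (rule le_less_trans[OF le_square]) (simp add: x_def y_def length_pair_string length_adjacency_string)
  ultimately show ?thesis
    unfolding graph_order_def by (intro least_below_eq) (auto simp: not_le mult_strict_mono)
qed

lemma adjacent_encoded: "u < n \<Longrightarrow> v < n \<Longrightarrow> adjacent y u v \<longleftrightarrow> (u, v) \<in> E"
  unfolding adjacent_def instance_bits_encoded graph_order_encoded
  by (simp add: x_def y_def length_pair_string fst_bits_pair_string bit_at_def nth_adjacency_string)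

lemma chosen_count_encoded: "chosen_count y = card {u. u < n \<and> bit_at w u}"
  unfolding chosen_count_def graph_order_encoded chosen_encoded
  by (simp add: lessThan_def Collect_conj_eq)

lemma le_carry_encoded_iff:
  assumes "b > 0"
  shows "k \<le> carry n k (num_bits y) (denom_bits y) (length y) \<longleftrightarrow>
    of_nat k \<le> (of_nat a / of_nat b :: rat) * of_nat n"
proof -
  have "length (nat_string a) \<le> length y" "length (nat_string b) \<le> length y"
    by (simp_all add: x_def y_def length_pair_string)
  then have "k \<le> carry n k (num_bits y) (denom_bits y) (length y) \<longleftrightarrow> k * b \<le> n * a"
    unfolding le_carry_iff num_bits_encoded denom_bits_encoded by (simp only: sum_bit_at_nat_string)
  also have "\<dots> \<longleftrightarrow> of_nat (k * b) \<le> (of_nat (n * a) :: rat)" by (simp only: of_nat_le_iff)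
  also have "\<dots> \<longleftrightarrow> of_nat k \<le> (of_nat a / of_nat b :: rat) * of_nat n"
    using assms by (simp add: field_simps)
  finally show ?thesis .
qed

lemma accepts_encoded_iff:
  assumes "b > 0" "pair_graph G" "pverts G = {..<n}" "parcs G = E"
  shows "accepts y \<longleftrightarrow> nbr_separating G {u. u < n \<and> bit_at w u} \<and>
    of_nat (card {u. u < n \<and> bit_at w u}) \<le> (of_nat a / of_nat b :: rat) * of_nat n"
proof -
  interpret pair_graph G by fact
  let ?S = "{u. u < n \<and> bit_at w u}"
  have nbrs: "chosen_nbrs y u = nbr_count G ?S u" if "u < n" for u
  proof -
    have "{..<n} \<inter> {v. adjacent y u v \<and> chosen y v} = neighbors G u \<inter> ?S"
      using that adjacent_encoded arc_verts assms(3,4)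
      by (auto simp: neighbors_def chosen_encoded)
    then show ?thesis by (simp add: chosen_nbrs_def graph_order_encoded nbr_count_def)
  qed
  have arc_iff: "(u, v) \<in> parcs G \<longleftrightarrow> u < n \<and> v < n \<and> adjacent y u v" for u v
    using adjacent_encoded[of u v] arc_verts[of u v] assms(3,4) by auto
  have "(\<forall>u<n. \<forall>v<n. adjacent y u v \<longrightarrow> chosen_nbrs y u \<noteq> chosen_nbrs y v) \<longleftrightarrow>
      (\<forall>u<n. \<forall>v<n. adjacent y u v \<longrightarrow> nbr_count G ?S u \<noteq> nbr_count G ?S v)"
    by (simp add: nbrs)
  also have "\<dots> \<longleftrightarrow> nbr_separating G ?S"
    unfolding nbr_separating_def Ball_def split_paired_All prod.case arc_iff by blast
  finally have "(\<forall>u<n. \<forall>v<n. adjacent y u v \<longrightarrow> chosen_nbrs y u \<noteq> chosen_nbrs y v) \<longleftrightarrow>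
      nbr_separating G ?S" .
  then show ?thesis
    unfolding accepts_def graph_order_encoded le_carry_encoded_iff[OF assms(1)] chosen_count_encoded
    by blast
qed

end

lemma ex_subset_iff_ex_bits:
  assumes "n \<le> m"
  shows "(\<exists>S\<subseteq>{..<n}. P S) \<longleftrightarrow> (\<exists>w. length w \<le> m \<and> P {u. u < n \<and> bit_at w u})"
proof
  assume "\<exists>S\<subseteq>{..<n}. P S"
  then obtain S where "S \<subseteq> {..<n}" "P S" by blast
  moreover have "{u. u < n \<and> bit_at (map (\<lambda>u. u \<in> S) [0..<n]) u} = S"
    using \<open>S \<subseteq> {..<n}\<close> by (auto simp: bit_at_def)
  ultimately show "\<exists>w. length w \<le> m \<and> P {u. u < n \<and> bit_at w u}"
    using assms by (intro exI[of _ "map (\<lambda>u. u \<in> S) [0..<n]"]) simp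
next
  assume "\<exists>w. length w \<le> m \<and> P {u. u < n \<and> bit_at w u}"
  then obtain w where "P {u. u < n \<and> bit_at w u}" by blast
  then show "\<exists>S\<subseteq>{..<n}. P S" by (intro exI[of _ "{u. u < n \<and> bit_at w u}"]) auto
qed

lemma sigma_chromatic_number_no_vertices:
  assumes "pair_graph G" "pverts G = {}"
  shows "sigma_chromatic_number G = 0"
proof -
  interpret pair_graph G by fact
  have "parcs G = {}" using assms(2) wellformed' by fastforce
  then have "sigma_coloring G (\<lambda>_. 0) \<and> card ((\<lambda>_. 0 :: nat) ` pverts G) = 0"
    using assms(2) by (simp add: sigma_coloring_def)
  then show ?thesis unfolding sigma_chromatic_number_def by (intro Least_eq_0) blast
qed

lemma Theta_yes_iff:
  assumes "encodes x G r" "Theta_instance G r"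
  shows "(\<exists>G r. encodes x G r \<and> Theta_instance G r \<and> Theta_question G r) \<longleftrightarrow> Theta_question G r"
proof
  assume "\<exists>G r. encodes x G r \<and> Theta_instance G r \<and> Theta_question G r"
  then obtain H s where H: "encodes x H s" "Theta_instance H s" "Theta_question H s" by blast
  have "pair_graph H" "pair_graph G" using H(2) assms(2) by (simp_all add: Theta_instance_def)
  from encodes_unique[OF H(1) assms(1) this] show "Theta_question G r" using H(3) by simp
qed (use assms in blast)

lemma Theta_question_iff_ex_witness:
  assumes enc: "encodes x G r" and inst: "Theta_instance G r" and sigma: "sigma_chromatic_number G = 2"
  shows "Theta_question G r \<longleftrightarrow> (\<exists>w. length w \<le> length x \<and> accepts (pair_string x w))"
proof -
  have graph: "pair_graph G" and regular: "regular_pair_graph G 3"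
    using inst
    by (auto simp: Theta_instance_def regular_pair_graph_def regular_pair_graph_axioms_def)
  have nonempty: "pverts G \<noteq> {}" using sigma_chromatic_number_no_vertices[OF graph] sigma by auto
  obtain n a b where n: "pverts G = {..<n}" "b > 0" "r = of_nat a / of_nat b"
    "x = pair_string (adjacency_string n (parcs G)) (pair_string (nat_string a) (nat_string b))"
    using enc by (auto simp: encodes_def)
  have "n \<le> length x"
    by (rule order_trans[OF le_square]) (simp add: n(4) length_pair_string length_adjacency_string)
  from ex_subset_iff_ex_bits[OF this] show ?thesis
    unfolding Theta_question_iff_separating[OF regular nonempty sigma]
    unfolding n(4) accepts_encoded_iff[OF n(2) graph n(1) refl] n(3)
    by (simp add: n(1) flip: n(4))
qed

theorem Theta_in_promise_NP: "Theta \<in> promise_NP"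
proof -
  have "x \<in> snd Theta \<longleftrightarrow> (\<exists>w. length w \<le> poly [:0, 1:] (length x) \<and> accepts (pair_string x w))"
    if promise: "x \<in> fst Theta" for x
  proof -
    obtain G r where enc: "encodes x G r" "Theta_instance G r" and "sigma_chromatic_number G = 2"
      using promise by (auto simp: Theta_def)
    from Theta_question_iff_ex_witness[OF this] Theta_yes_iff[OF enc] show ?thesis
      by (simp add: Theta_def)
  qed
  then show ?thesis
    unfolding promise_NP_def mem_Collect_eq case_prod_beta
    using poly_time_decidable_accepts by blast
qed

section \<open>Computation tableaux as propositional formulas\<close>

subsection \<open>Clause schemas\<close>

text \<open>
  Tape cells are addressed relative to the head, which stands at a fixed central cell; then every
  transition is expressed by implications whose premises only concern the state and the central cells,
  and no clause has to express that head positions or symbols are unique. The state is treated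
  as a symbol of an additional tape, with the number \<open>tm_tapes M\<close>.
\<close>

datatype schema =
    Next_State nat "nat list"
  | Write_Symbol nat "nat list" nat
  | Copy_Symbol nat "nat list" nat nat
  | Initial_Symbol nat nat
  | Initial_State
  | Witness_Symbol
  | Witness_End
  | Not_Rejecting

text \<open>
  The instance of a schema for time \<open>t\<close> and cell \<open>i\<close> refers to the times \<open>t\<close> (\<open>Now\<close>) and \<open>t + 1\<close>
  (\<open>Next\<close>), and to cells given by their distance from the central cell (\<open>Head\<close>) or from \<open>i\<close> (\<open>Cell\<close>).
\<close>

datatype place = Head int | Cell int

datatype literal = Now nat place nat | Next nat place nat

definition shift :: "int \<Rightarrow> nat \<Rightarrow> nat" where
  "shift d i = i + nat d - nat (- d)"

lemma int_shift: "- d \<le> int i \<Longrightarrow> int (shift d i) = int i + d"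
  by (simp add: shift_def)

lemma shift_0 [simp]: "shift 0 i = i" and shift_1 [simp]: "shift 1 i = Suc i"
  by (simp_all add: shift_def)

locale tm_schemas =
  fixes M :: turing_machine
  assumes wf: "wf_tm M"
begin

abbreviation K where "K \<equiv> tm_tapes M"

lemma K_pos: "K > 0"
  using wf by (simp add: wf_tm_def)

text \<open>In contrast to \<open>tm_delta\<close>, \<open>delta\<close> is also meaningful in the halting state.\<close>

definition delta :: "nat \<Rightarrow> nat list \<Rightarrow> nat \<times> (nat \<times> int) list" where
  "delta q ss = (if q = 1 then (1, map (\<lambda>s. (s, 0)) ss) else tm_delta M q ss)"

definition move :: "nat \<Rightarrow> nat list \<Rightarrow> nat \<Rightarrow> int" where
  "move q ss \<tau> = snd (snd (delta q ss) ! \<tau>)"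

definition written :: "nat \<Rightarrow> nat list \<Rightarrow> nat \<Rightarrow> nat" where
  "written q ss \<tau> = fst (snd (delta q ss) ! \<tau>)"

definition scans :: "nat list set" where
  "scans = {ss. set ss \<subseteq> {..<tm_symbols M} \<and> length ss = K}"

definition schemas :: "schema set" where
  "schemas = case_prod Next_State ` ({..<tm_states M} \<times> scans)
     \<union> (\<lambda>(q, ss, \<tau>). Write_Symbol q ss \<tau>) ` ({..<tm_states M} \<times> scans \<times> {..<K})
     \<union> (\<lambda>(q, ss, \<tau>, s). Copy_Symbol q ss \<tau> s) `
         ({..<tm_states M} \<times> scans \<times> {..<K} \<times> {..<tm_symbols M})
     \<union> case_prod Initial_Symbol ` ({..<K} \<times> {..<3})
     \<union> {Initial_State, Witness_Symbol, Witness_End, Not_Rejecting}"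

lemma schemas_iff [simp]:
  "Next_State q ss \<in> schemas \<longleftrightarrow> q < tm_states M \<and> ss \<in> scans"
  "Write_Symbol q ss \<tau> \<in> schemas \<longleftrightarrow> q < tm_states M \<and> ss \<in> scans \<and> \<tau> < K"
  "Copy_Symbol q ss \<tau> s \<in> schemas \<longleftrightarrow> q < tm_states M \<and> ss \<in> scans \<and> \<tau> < K \<and> s < tm_symbols M"
  "Initial_Symbol \<tau> s \<in> schemas \<longleftrightarrow> \<tau> < K \<and> s < 3"
  "Initial_State \<in> schemas" "Witness_Symbol \<in> schemas" "Witness_End \<in> schemas" "Not_Rejecting \<in> schemas"
  by (auto simp: schemas_def image_iff)

lemma finite_schemas: "finite schemas"
proof -
  have "finite scans" unfolding scans_def by (rule finite_lists_length_eq) simp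
  then show ?thesis unfolding schemas_def by simp
qed

definition body_lits :: "nat \<Rightarrow> nat list \<Rightarrow> literal set" where
  "body_lits q ss = insert (Now K (Head 0) q) ((\<lambda>\<tau>. Now \<tau> (Head 0) (ss ! \<tau>)) ` {..<K})"

fun neg_lits :: "schema \<Rightarrow> literal set" where
  "neg_lits (Next_State q ss) = body_lits q ss"
| "neg_lits (Write_Symbol q ss \<tau>) = body_lits q ss"
| "neg_lits (Copy_Symbol q ss \<tau> s) = insert (Now \<tau> (Cell (move q ss \<tau>)) s) (body_lits q ss)"
| "neg_lits Witness_End = {Now 0 (Cell 0) 0}"
| "neg_lits Not_Rejecting = {Now 0 (Cell 0) 1}"
| "neg_lits _ = {}"

fun pos_lits :: "schema \<Rightarrow> literal set" where
  "pos_lits (Next_State q ss) = {Next K (Head 0) (fst (delta q ss))}"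
| "pos_lits (Write_Symbol q ss \<tau>) = {Next \<tau> (Head (- move q ss \<tau>)) (written q ss \<tau>)}"
| "pos_lits (Copy_Symbol q ss \<tau> s) = {Next \<tau> (Cell 0) s}"
| "pos_lits (Initial_Symbol \<tau> s) = {Now \<tau> (Cell 0) s}"
| "pos_lits Initial_State = {Now K (Head 0) 0}"
| "pos_lits Witness_Symbol = {Now 0 (Cell 0) 0, Now 0 (Cell 0) 1, Now 0 (Cell 0) 2}"
| "pos_lits Witness_End = {Now 0 (Cell 1) 0}"
| "pos_lits Not_Rejecting = {}"

lemma finite_lits: "finite (neg_lits sc)" "finite (pos_lits sc)"
  by (cases sc; simp add: body_lits_def)+

lemma delta_bounds:
  assumes "q < tm_states M" "ss \<in> scans"
  shows "fst (delta q ss) < tm_states M" "length (snd (delta q ss)) = K"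
    "\<And>\<tau>. \<tau> < K \<Longrightarrow> written q ss \<tau> < tm_symbols M" "\<And>\<tau>. \<tau> < K \<Longrightarrow> move q ss \<tau> \<in> {-1, 0, 1}"
proof -
  obtain q' acts where eq: "delta q ss = (q', acts)" by fastforce
  have "q' < tm_states M \<and> length acts = K \<and> set acts \<subseteq> {..<tm_symbols M} \<times> {-1, 0, 1}"
  proof (cases "q = 1")
    case True
    then show ?thesis using eq assms wf by (auto simp: delta_def scans_def wf_tm_def)
  next
    case False
    then have "tm_delta M q ss = (q', acts)" using eq by (simp add: delta_def)
    then show ?thesis using wf assms unfolding wf_tm_def scans_def by fastforce
  qed
  then have bounds: "q' < tm_states M" "length acts = K"
    "\<And>\<tau>. \<tau> < K \<Longrightarrow> acts ! \<tau> \<in> {..<tm_symbols M} \<times> {-1, 0, 1}"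
    by (auto dest: nth_mem)
  show "fst (delta q ss) < tm_states M" "length (snd (delta q ss)) = K" using bounds eq by auto
  fix \<tau> assume "\<tau> < K"
  from bounds(3)[OF this] show "written q ss \<tau> < tm_symbols M" "move q ss \<tau> \<in> {-1, 0, 1}"
    by (auto simp: written_def move_def eq)
qed

end

subsection \<open>Runs\<close>

text \<open>\<open>T x\<close> bounds the running time on input \<open>x\<close>, and \<open>P x\<close> the length of the witnesses.\<close>

locale tableau = tm_schemas +
  fixes T P :: "bool list \<Rightarrow> nat"
begin

context
  fixes x :: "bool list"
begin

definition centre :: nat where "centre = 2 * T x + 2 * length x + 2 + P x"
definition width :: nat where "width = 2 * centre + 1"

lemma centre_less_width: "centre < width" "Suc centre < width"
  by (simp_all add: width_def centre_def)

definition config :: "bool list \<Rightarrow> nat \<Rightarrow> tm_config" where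
  "config w t = (tm_step M ^^ t) (tm_init M (pair_string x w))"

definition state :: "bool list \<Rightarrow> nat \<Rightarrow> nat" where
  "state w t = fst (config w t)"

definition head :: "bool list \<Rightarrow> nat \<Rightarrow> nat \<Rightarrow> int" where
  "head w t \<tau> = fst (snd (config w t) ! \<tau>)"

definition tape :: "bool list \<Rightarrow> nat \<Rightarrow> nat \<Rightarrow> int \<Rightarrow> nat" where
  "tape w t \<tau> = snd (snd (config w t) ! \<tau>)"

definition cell :: "bool list \<Rightarrow> nat \<Rightarrow> nat \<Rightarrow> nat \<Rightarrow> nat" where
  "cell w t \<tau> i = tape w t \<tau> (head w t \<tau> + int i - int centre)"

definition scanned :: "bool list \<Rightarrow> nat \<Rightarrow> nat list" where
  "scanned w t = map (\<lambda>\<tau>. cell w t \<tau> centre) [0..<K]"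

lemma config_0:
  "state w 0 = 0" "length (snd (config w 0)) = K" "\<tau> < K \<Longrightarrow> head w 0 \<tau> = 0"
  "\<tau> < K \<Longrightarrow> tape w 0 \<tau> = (if \<tau> = 0 then string_tape (pair_string x w) else (\<lambda>_. 0))"
  using K_pos
  by (auto simp: state_def config_def tm_init_def head_def tape_def nth_Cons split: nat.splits)

lemma config_Suc_eq:
  assumes "length (snd (config w t)) = K"
  shows "config w (Suc t) = (fst (delta (state w t) (scanned w t)),
    map2 (\<lambda>(s, d) (h, t). (h + d, t(h := s))) (snd (delta (state w t) (scanned w t))) (snd (config w t)))"
proof -
  obtain q ts where config: "config w t = (q, ts)" by fastforce
  have scan: "map (\<lambda>(h, t). t h) ts = scanned w t"
    using assms config
    by (intro nth_equalityI) (auto simp: scanned_def cell_def tape_def head_def case_prod_beta)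
  have step: "config w (Suc t) = tm_step M (q, ts)" using config by (simp add: config_def)
  show ?thesis
  proof (cases "q = 1")
    case True
    have "map2 (\<lambda>(s, d) (h, t). (h + d, t(h := s))) (map (\<lambda>s. (s, 0)) (scanned w t)) ts = ts"
      unfolding scan[symmetric] by (intro nth_equalityI) (auto simp: case_prod_beta)
    then show ?thesis using True step by (simp add: tm_step_def delta_def state_def config)
  next
    case False
    then show ?thesis
      using step scan by (simp add: tm_step_def delta_def state_def config case_prod_beta)
  qed
qed

lemma config_Suc:
  assumes "length (snd (config w t)) = K" "length (snd (delta (state w t) (scanned w t))) = K"
  shows "state w (Suc t) = fst (delta (state w t) (scanned w t))"
    "length (snd (config w (Suc t))) = K"
    "\<tau> < K \<Longrightarrow> head w (Suc t) \<tau> = head w t \<tau> + move (state w t) (scanned w t) \<tau>"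
    "\<tau> < K \<Longrightarrow> tape w (Suc t) \<tau> =
      (tape w t \<tau>)(head w t \<tau> := written (state w t) (scanned w t) \<tau>)"
  using config_Suc_eq[OF assms(1)] assms
  by (simp_all add: state_def[of w "Suc t"] head_def tape_def move_def written_def case_prod_beta)

lemma config_bounds:
  "state w t < tm_states M \<and> length (snd (config w t)) = K \<and> (\<forall>\<tau><K. \<forall>a. tape w t \<tau> a < tm_symbols M)"
proof (induction t)
  case 0
  have "string_tape y a < tm_symbols M" for y a using wf by (auto simp: string_tape_def wf_tm_def)
  then show ?case using config_0[where w = w] wf by (auto simp: wf_tm_def)
next
  case (Suc t)
  have "scanned w t \<in> scans" using Suc by (auto simp: scans_def scanned_def cell_def)
  note delta = delta_bounds[OF _ this, of "state w t"]
  from Suc show ?case using delta config_Suc[OF _ delta(2)] by auto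
qed

lemma state_less: "state w t < tm_states M"
  and length_config: "length (snd (config w t)) = K"
  and cell_less: "\<tau> < K \<Longrightarrow> cell w t \<tau> i < tm_symbols M"
  using config_bounds[of w t] by (auto simp: cell_def)

lemma scanned_in_scans: "scanned w t \<in> scans"
  using cell_less by (auto simp: scans_def scanned_def)

lemmas config_step = config_Suc[OF length_config delta_bounds(2)[OF state_less scanned_in_scans]]

lemma move_bounds: "\<tau> < K \<Longrightarrow> move (state w t) (scanned w t) \<tau> \<in> {-1, 0, 1}"
  by (rule delta_bounds(4)[OF state_less scanned_in_scans])

lemma abs_head_le: "\<tau> < K \<Longrightarrow> \<bar>head w t \<tau>\<bar> \<le> int t"
proof (induction t)
  case (Suc t)
  then show ?case using config_step(3)[of \<tau> w t] move_bounds[of \<tau> w t] by auto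
qed (simp add: config_0)

lemma cell_Suc:
  assumes "\<tau> < K" "- move (state w t) (scanned w t) \<tau> \<le> int i"
  shows "cell w (Suc t) \<tau> i =
    (if int i + move (state w t) (scanned w t) \<tau> = int centre then written (state w t) (scanned w t) \<tau>
     else cell w t \<tau> (shift (move (state w t) (scanned w t) \<tau>) i))"
  using config_step(3,4)[OF assms(1), of w t] int_shift[OF assms(2)] by (auto simp: cell_def algebra_simps)

lemma cell_Suc_written:
  fixes w t
  assumes "\<tau> < K"
  defines "d \<equiv> move (state w t) (scanned w t) \<tau>"
  shows "cell w (Suc t) \<tau> (shift (- d) centre) = written (state w t) (scanned w t) \<tau>"
proof -
  have "d \<in> {-1, 0, 1}" using move_bounds[OF assms(1), of w t] by (simp add: d_def)
  moreover have "1 \<le> int centre" by (simp add: centre_def)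
  ultimately have "int (shift (- d) centre) = int centre - d" "- d \<le> int (shift (- d) centre)"
    using int_shift[of "- d" centre] by auto
  then show ?thesis
    using cell_Suc[OF assms(1), of w t "shift (- d) centre"] by (simp add: d_def)
qed

lemma cell_Suc_copied:
  fixes w t
  assumes "\<tau> < K"
  defines "d \<equiv> move (state w t) (scanned w t) \<tau>"
  assumes "- d \<le> int i" "shift d i \<noteq> centre"
  shows "cell w (Suc t) \<tau> i = cell w t \<tau> (shift d i)"
proof -
  have "int i + d \<noteq> int centre" using int_shift[OF assms(3)] assms(4) by auto
  then show ?thesis using cell_Suc[OF assms(1), of w t i] assms(3) by (simp add: d_def)
qed

text \<open>The initial symbol of a cell, or 3 if it belongs to the witness.\<close>

definition init_symbol :: "nat \<Rightarrow> nat \<Rightarrow> nat" where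
  "init_symbol \<tau> i =
     (if \<tau> \<noteq> 0 \<or> i < centre then 0
      else if i - centre < 2 * length x then (if x ! ((i - centre) div 2) then 2 else 1)
      else if i - centre = 2 * length x then 1
      else if i - centre = 2 * length x + 1 then 2
      else if i - centre < 2 * length x + 2 + P x then 3 else 0)"

definition witness_cell :: "nat \<Rightarrow> nat" where
  "witness_cell a = centre + 2 * length x + 2 + a"

lemma init_symbol_eq_3_iff: "init_symbol \<tau> i = 3 \<longleftrightarrow> \<tau> = 0 \<and> (\<exists>a<P x. i = witness_cell a)"
proof
  assume "init_symbol \<tau> i = 3"
  then have "\<tau> = 0 \<and> i - (centre + 2 * length x + 2) < P x \<and>
      i = witness_cell (i - (centre + 2 * length x + 2))"
    by (auto simp: init_symbol_def witness_cell_def split: if_splits)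
  then show "\<tau> = 0 \<and> (\<exists>a<P x. i = witness_cell a)" by blast
qed (auto simp: init_symbol_def witness_cell_def)

lemma init_symbol_less_3: "init_symbol \<tau> i \<noteq> 3 \<Longrightarrow> init_symbol \<tau> i < 3"
  by (auto simp: init_symbol_def split: if_splits)

lemma witness_cell_less_width: "a < P x \<Longrightarrow> witness_cell a < width"
  by (simp add: witness_cell_def width_def centre_def)

lemma Suc_witness_cell: "Suc (witness_cell a) = witness_cell (Suc a)"
  by (simp add: witness_cell_def)

lemma witness_cell_inject: "witness_cell a = witness_cell b \<longleftrightarrow> a = b"
  by (simp add: witness_cell_def)

lemma cell_0_input:
  assumes "\<tau> < K" "length w \<le> P x" "init_symbol \<tau> i \<noteq> 3"
  shows "cell w 0 \<tau> i = init_symbol \<tau> i"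
  using assms config_0(3,4)[OF assms(1), of w]
  by (auto simp: cell_def init_symbol_def string_tape_def length_pair_string nth_pair_string nat_diff_distrib'
      split: if_splits)

lemma cell_0_witness: "cell w 0 0 (witness_cell a) = (if a < length w then (if w ! a then 2 else 1) else 0)"
proof -
  have "nat (int (witness_cell a) - int centre) = 2 * length x + 2 + a" by (simp add: witness_cell_def)
  then show ?thesis
    using config_0(3,4)[OF K_pos, of w]
    by (auto simp: cell_def witness_cell_def string_tape_def length_pair_string nth_pair_string)
qed

subsection \<open>The formula of a computation\<close>

fun valid :: "schema \<Rightarrow> nat \<Rightarrow> nat \<Rightarrow> bool" where
  "valid (Next_State q ss) t i \<longleftrightarrow> t < T x"
| "valid (Write_Symbol q ss \<tau>) t i \<longleftrightarrow> t < T x"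
| "valid (Copy_Symbol q ss \<tau> s) t i \<longleftrightarrow> t < T x \<and> nat (- move q ss \<tau>) \<le> i \<and>
     shift (move q ss \<tau>) i < width \<and> shift (move q ss \<tau>) i \<noteq> centre"
| "valid (Initial_Symbol \<tau> s) t i \<longleftrightarrow> t = 0 \<and> init_symbol \<tau> i = s"
| "valid Initial_State t i \<longleftrightarrow> t = 0"
| "valid Witness_Symbol t i \<longleftrightarrow> t = 0 \<and> init_symbol 0 i = 3"
| "valid Witness_End t i \<longleftrightarrow> t = 0 \<and> init_symbol 0 i = 3 \<and> init_symbol 0 (Suc i) = 3"
| "valid Not_Rejecting t i \<longleftrightarrow> t = T x"

fun position :: "place \<Rightarrow> nat \<Rightarrow> nat" where
  "position (Head d) i = shift d centre"
| "position (Cell d) i = shift d i"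

fun atom :: "literal \<Rightarrow> nat \<Rightarrow> nat \<Rightarrow> nat \<times> nat \<times> nat \<times> nat" where
  "atom (Now \<tau> p s) t i = (t, \<tau>, position p i, s)"
| "atom (Next \<tau> p s) t i = (Suc t, \<tau>, position p i, s)"

definition clause_holds :: "(nat \<times> nat \<times> nat \<times> nat \<Rightarrow> bool) \<Rightarrow> schema \<Rightarrow> nat \<Rightarrow> nat \<Rightarrow> bool" where
  "clause_holds v sc t i \<longleftrightarrow>
     (\<exists>l\<in>pos_lits sc. v (atom l t i)) \<or> (\<exists>l\<in>neg_lits sc. \<not> v (atom l t i))"

definition satisfies :: "(nat \<times> nat \<times> nat \<times> nat \<Rightarrow> bool) \<Rightarrow> bool" where
  "satisfies v \<longleftrightarrow>
     (\<forall>sc\<in>schemas. \<forall>t\<le>T x. \<forall>i<width. valid sc t i \<longrightarrow> clause_holds v sc t i)"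

lemma satisfiesD:
  "satisfies v \<Longrightarrow> sc \<in> schemas \<Longrightarrow> t \<le> T x \<Longrightarrow> i < width \<Longrightarrow> valid sc t i \<Longrightarrow> clause_holds v sc t i"
  unfolding satisfies_def by blast

lemma body_atom_in_range:
  assumes "q < tm_states M" "ss \<in> scans" "l \<in> body_lits q ss" "t \<le> T x"
  shows "atom l t i \<in> {..T x} \<times> {..K} \<times> {..<width} \<times> {..<tm_states M + tm_symbols M}"
proof -
  have "ss ! \<tau> < tm_symbols M" if "\<tau> < K" for \<tau>
  proof -
    have "ss ! \<tau> \<in> set ss" using assms(2) that by (simp add: scans_def)
    then show ?thesis using assms(2) by (auto simp: scans_def)
  qed
  then show ?thesis using assms centre_less_width by (fastforce simp: body_lits_def)
qed

lemma atom_in_range: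
  assumes sc: "sc \<in> schemas" "t \<le> T x" "i < width" "valid sc t i" "l \<in> pos_lits sc \<union> neg_lits sc"
  shows "atom l t i \<in> {..T x} \<times> {..K} \<times> {..<width} \<times> {..<tm_states M + tm_symbols M}"
proof (cases sc)
  case (Next_State q ss)
  then show ?thesis
    using sc delta_bounds(1)[of q ss] centre_less_width body_atom_in_range[of q ss l] by auto
next
  case (Write_Symbol q ss \<tau>)
  then have ss: "q < tm_states M" "ss \<in> scans" "\<tau> < K" using sc by auto
  have "shift (- move q ss \<tau>) centre < width"
    using delta_bounds(4)[OF ss] centre_less_width by (auto simp: shift_def)
  then show ?thesis
    using Write_Symbol sc delta_bounds(3)[OF ss] body_atom_in_range[of q ss l] by auto
next
  case (Copy_Symbol q ss \<tau> s)
  then show ?thesis using sc body_atom_in_range[of q ss l] by auto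
next
  case Witness_End
  then have "Suc i < width" using sc by (auto simp: init_symbol_eq_3_iff witness_cell_less_width)
  then show ?thesis using Witness_End sc wf by (auto simp: wf_tm_def)
qed (use sc wf centre_less_width in \<open>auto simp: wf_tm_def\<close>)

lemma pos_neg_atoms_disjoint:
  assumes "l \<in> pos_lits sc" "l' \<in> neg_lits sc"
  shows "atom l t i \<noteq> atom l' t i"
  using assms by (cases sc) (auto simp: body_lits_def)

subsection \<open>Accepting runs satisfy the formula\<close>

definition run_assignment :: "bool list \<Rightarrow> nat \<times> nat \<times> nat \<times> nat \<Rightarrow> bool" where
  "run_assignment w = (\<lambda>(t, \<tau>, i, s). s = (if \<tau> = K then state w t else cell w t \<tau> i))"

lemma run_assignment_body:
  assumes "ss \<in> scans" "\<forall>l\<in>body_lits q ss. run_assignment w (atom l t i)"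
  shows "state w t = q" "scanned w t = ss"
proof -
  show "state w t = q" using assms(2) by (simp add: body_lits_def run_assignment_def)
  have "cell w t \<tau> centre = ss ! \<tau>" if "\<tau> < K" for \<tau>
    using assms(2) that by (auto simp: body_lits_def run_assignment_def)
  then show "scanned w t = ss"
    using assms(1) by (intro nth_equalityI) (simp_all add: scanned_def scans_def)
qed

lemma run_assignment_clause_holds:
  assumes w: "length w \<le> P x" and not_rejecting: "\<And>i. i < width \<Longrightarrow> cell w (T x) 0 i \<noteq> 1"
    and sc: "sc \<in> schemas" "i < width" "valid sc t i"
  shows "clause_holds (run_assignment w) sc t i"
  unfolding clause_holds_def
proof (rule disjCI)
  assume "\<not> (\<exists>l\<in>neg_lits sc. \<not> run_assignment w (atom l t i))"
  then have neg: "\<forall>l\<in>neg_lits sc. run_assignment w (atom l t i)" by blast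
  show "\<exists>l\<in>pos_lits sc. run_assignment w (atom l t i)"
  proof (cases sc)
    case (Next_State q ss)
    then have "state w t = q" "scanned w t = ss" using neg sc run_assignment_body[of ss q w t i] by auto
    then show ?thesis using Next_State config_step(1)[of w t] by (simp add: run_assignment_def)
  next
    case (Write_Symbol q ss \<tau>)
    then have run: "state w t = q" "scanned w t = ss" and \<tau>: "\<tau> < K"
      using neg sc run_assignment_body[of ss q w t i] by auto
    then show ?thesis
      using Write_Symbol cell_Suc_written[OF \<tau>, of w t] by (simp add: run_assignment_def)
  next
    case (Copy_Symbol q ss \<tau> s)
    then have run: "state w t = q" "scanned w t = ss" and \<tau>: "\<tau> < K"
      using neg sc run_assignment_body[of ss q w t i] by auto
    then have "cell w (Suc t) \<tau> i = cell w t \<tau> (shift (move q ss \<tau>) i)"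
      using cell_Suc_copied[OF \<tau>, of w t i] Copy_Symbol sc(3) by auto
    then show ?thesis using Copy_Symbol neg \<tau> by (simp add: run_assignment_def)
  next
    case (Initial_Symbol \<tau> s)
    then show ?thesis using sc cell_0_input[OF _ w, of \<tau> i] by (auto simp: run_assignment_def)
  next
    case Witness_Symbol
    then show ?thesis
      using sc K_pos by (auto simp: run_assignment_def init_symbol_eq_3_iff cell_0_witness split: if_splits)
  next
    case Witness_End
    then show ?thesis
      using sc neg K_pos
      by (auto simp: run_assignment_def init_symbol_eq_3_iff Suc_witness_cell witness_cell_inject
          cell_0_witness split: if_splits)
  next
    case Not_Rejecting
    then show ?thesis using sc neg not_rejecting[OF sc(2)] K_pos by (auto simp: run_assignment_def)
  qed (use sc config_0(1) in \<open>auto simp: run_assignment_def\<close>)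
qed

subsection \<open>Satisfying assignments describe accepting runs\<close>

lemma clause_holds_Horn:
  assumes "clause_holds v sc t i" "pos_lits sc = {l}" "\<And>l'. l' \<in> neg_lits sc \<Longrightarrow> v (atom l' t i)"
  shows "v (atom l t i)"
  using assms unfolding clause_holds_def by auto

lemma upward_closed_below_threshold:
  assumes "\<And>a. Q a \<Longrightarrow> Suc a < n \<Longrightarrow> Q (Suc a)"
  obtains m where "m \<le> n" "\<And>a. a < n \<Longrightarrow> Q a \<longleftrightarrow> m \<le> a"
proof -
  define m where "m = (LEAST a. a = n \<or> Q a)"
  have m: "m = n \<or> Q m" unfolding m_def by (rule LeastI[of _ n]) simp
  have "m \<le> n" unfolding m_def by (rule Least_le) simp
  moreover have "\<not> Q a" if "a < m" for a
    using not_less_Least[OF that[unfolded m_def]] by blast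
  moreover have "Q a" if "m \<le> a" "a < n" for a
    using that
  proof (induction a rule: dec_induct)
    case base
    then show ?case using m by simp
  next
    case (step b)
    then show ?case using assms[of b] by simp
  qed
  ultimately show thesis using that[of m] by (meson not_le)
qed

lemma satisfies_initial_cells:
  assumes v: "satisfies v"
  obtains w where "length w \<le> P x" "\<And>\<tau> i. \<tau> < K \<Longrightarrow> i < width \<Longrightarrow> v (0, \<tau>, i, cell w 0 \<tau> i)"
proof -
  have symbol: "v (0, 0, witness_cell a, 0) \<or> v (0, 0, witness_cell a, 1) \<or> v (0, 0, witness_cell a, 2)"
    if "a < P x" for a
    using satisfiesD[OF v, of Witness_Symbol 0 "witness_cell a"] that witness_cell_less_width
    by (auto simp: clause_holds_def init_symbol_eq_3_iff)
  have "v (0, 0, witness_cell (Suc a), 0)" if "v (0, 0, witness_cell a, 0)" "Suc a < P x" for a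
    using satisfiesD[OF v, of Witness_End 0 "witness_cell a"] that witness_cell_less_width[of a]
    by (auto simp: clause_holds_def init_symbol_eq_3_iff Suc_witness_cell witness_cell_inject)
  then obtain m where m: "m \<le> P x" "\<And>a. a < P x \<Longrightarrow> v (0, 0, witness_cell a, 0) \<longleftrightarrow> m \<le> a"
    using upward_closed_below_threshold[of "\<lambda>a. v (0, 0, witness_cell a, 0)" "P x"] by blast
  define w where "w = map (\<lambda>a. v (0, 0, witness_cell a, 2)) [0..<m]"
  have w: "length w \<le> P x" using m(1) by (simp add: w_def)
  have "v (0, \<tau>, i, cell w 0 \<tau> i)" if \<tau>: "\<tau> < K" and i: "i < width" for \<tau> i
  proof (cases "init_symbol \<tau> i = 3")
    case True
    then obtain a where "\<tau> = 0" "a < P x" "i = witness_cell a" by (auto simp: init_symbol_eq_3_iff)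
    then show ?thesis using symbol[of a] m(2)[of a] by (auto simp: cell_0_witness w_def)
  next
    case False
    then show ?thesis
      using satisfiesD[OF v, of "Initial_Symbol \<tau> (init_symbol \<tau> i)" 0 i] \<tau> i
        cell_0_input[OF \<tau> w False] init_symbol_less_3[OF False]
      by (auto simp: clause_holds_def)
  qed
  with w show thesis by (rule that)
qed

text \<open>Only cells whose distance from the border is at least \<open>t\<close> are described at time \<open>t\<close>.\<close>

definition describes :: "(nat \<times> nat \<times> nat \<times> nat \<Rightarrow> bool) \<Rightarrow> bool list \<Rightarrow> nat \<Rightarrow> bool" where
  "describes v w t \<longleftrightarrow> v (t, K, centre, state w t) \<and>
     (\<forall>\<tau><K. \<forall>i. \<bar>int i - int centre\<bar> \<le> int centre - int t \<longrightarrow> v (t, \<tau>, i, cell w t \<tau> i))"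

lemma describes_cell_Suc:
  assumes v: "satisfies v" and t: "t < T x" and describes: "describes v w t"
    and body: "\<And>l i. l \<in> body_lits (state w t) (scanned w t) \<Longrightarrow> v (atom l t i)"
    and \<tau>: "\<tau> < K" and i: "\<bar>int i - int centre\<bar> \<le> int centre - int (Suc t)"
  shows "v (Suc t, \<tau>, i, cell w (Suc t) \<tau> i)"
proof -
  let ?q = "state w t" and ?ss = "scanned w t"
  let ?d = "move ?q ?ss \<tau>"
  have d: "?d \<in> {-1, 0, 1}" using move_bounds[OF \<tau>] .
  have "i < width" "- ?d \<le> int i" using i d by (auto simp: width_def)
  note shift = int_shift[OF this(2)]
  show ?thesis
  proof (cases "shift ?d i = centre")
    case True
    then have "int (shift (- ?d) centre) = int i" using int_shift[of "- ?d" centre] shift by simp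
    then have "shift (- ?d) centre = i" by (simp only: of_nat_eq_iff)
    moreover have "clause_holds v (Write_Symbol ?q ?ss \<tau>) t 0"
      using t \<tau> state_less scanned_in_scans by (intro satisfiesD[OF v]) (auto simp: width_def)
    ultimately show ?thesis
      using clause_holds_Horn[of v "Write_Symbol ?q ?ss \<tau>" t 0] body cell_Suc_written[OF \<tau>, of w t]
      by simp
  next
    case False
    let ?s = "cell w t \<tau> (shift ?d i)"
    have "v (t, \<tau>, shift ?d i, ?s)"
      using describes \<tau> i d shift unfolding describes_def by auto
    moreover have "clause_holds v (Copy_Symbol ?q ?ss \<tau> ?s) t i"
    proof (rule satisfiesD[OF v])
      show "valid (Copy_Symbol ?q ?ss \<tau> ?s) t i"
        using t d i shift False \<open>- ?d \<le> int i\<close> by (auto simp: width_def)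
    qed (use t \<tau> state_less scanned_in_scans cell_less \<open>i < width\<close> in auto)
    ultimately have "v (Suc t, \<tau>, i, ?s)"
      using body clause_holds_Horn[of v "Copy_Symbol ?q ?ss \<tau> ?s" t i "Next \<tau> (Cell 0) ?s"] by force
    then show ?thesis using cell_Suc_copied[OF \<tau> \<open>- ?d \<le> int i\<close> False] by simp
  qed
qed

lemma describes_Suc:
  assumes v: "satisfies v" and t: "t < T x" and describes: "describes v w t"
  shows "describes v w (Suc t)"
proof -
  let ?q = "state w t" and ?ss = "scanned w t"
  have "t < centre" using t by (simp add: centre_def)
  then have body: "v (atom l t i)" if "l \<in> body_lits ?q ?ss" for l i
    using describes that by (auto simp: describes_def body_lits_def scanned_def)
  have "clause_holds v (Next_State ?q ?ss) t 0"
    using t state_less scanned_in_scans by (intro satisfiesD[OF v]) (auto simp: width_def)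
  then have "v (Suc t, K, centre, state w (Suc t))"
    using clause_holds_Horn[of v "Next_State ?q ?ss" t 0] body config_step(1)[of w t] by simp
  then show ?thesis
    using describes_cell_Suc[OF v t describes body] unfolding describes_def by blast
qed

lemma satisfies_describes_run:
  assumes v: "satisfies v"
  obtains w where "length w \<le> P x" "\<And>t. t \<le> T x \<Longrightarrow> describes v w t"
proof -
  obtain w where w: "length w \<le> P x" "\<And>\<tau> i. \<tau> < K \<Longrightarrow> i < width \<Longrightarrow> v (0, \<tau>, i, cell w 0 \<tau> i)"
    by (rule satisfies_initial_cells[OF v]) blast
  have "describes v w t" if "t \<le> T x" for t
    using that
  proof (induction t)
    case 0
    have "v (0, K, centre, state w 0)"
      using satisfiesD[OF v, of Initial_State 0 0] config_0(1) by (auto simp: clause_holds_def width_def)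
    then show ?case using w(2) by (auto simp: describes_def width_def)
  qed (use describes_Suc[OF v] in simp)
  with w(1) show thesis by (rule that)
qed

lemma tape_at_time_bound:
  assumes "\<exists>t\<le>T x. \<exists>ts. (tm_step M ^^ t) (tm_init M (pair_string x w)) = (1, ts) \<and>
     snd (hd ts) = string_tape y"
  shows "tape w (T x) 0 = string_tape y"
proof -
  obtain t ts where t: "t \<le> T x" "config w t = (1, ts)" "snd (hd ts) = string_tape y"
    using assms by (auto simp: config_def)
  have "(tm_step M ^^ d) (1, ts) = (1, ts)" for d by (induction d) (auto simp: tm_step_def)
  moreover have "config w (T x) = (tm_step M ^^ (T x - t)) (config w t)"
    using t(1) by (simp add: config_def funpow_add[symmetric, THEN fun_cong, simplified])
  ultimately have "config w (T x) = (1, ts)" using t(2) by simp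
  moreover from this have "ts \<noteq> []" using length_config[of w "T x"] K_pos by auto
  ultimately show ?thesis using t(3) by (simp add: tape_def hd_conv_nth)
qed

lemma satisfiable_iff_accepted:
  assumes "\<And>w. length w \<le> P x \<Longrightarrow> \<exists>t\<le>T x. \<exists>ts.
     (tm_step M ^^ t) (tm_init M (pair_string x w)) = (1, ts) \<and>
     snd (hd ts) = string_tape [V (pair_string x w)]"
  shows "(\<exists>v. satisfies v) \<longleftrightarrow> (\<exists>w. length w \<le> P x \<and> V (pair_string x w))"
proof
  note final = tape_at_time_bound[OF assms]
  assume "\<exists>v. satisfies v"
  then obtain v where v: "satisfies v" by blast
  obtain w where w: "length w \<le> P x" "\<And>t. t \<le> T x \<Longrightarrow> describes v w t"
    by (rule satisfies_describes_run[OF v]) blast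
  have "V (pair_string x w)"
  proof (rule ccontr)
    assume reject: "\<not> V (pair_string x w)"
    define i where "i = nat (int centre - head w (T x) 0)"
    have head: "\<bar>head w (T x) 0\<bar> \<le> int (T x)" using abs_head_le[OF K_pos] .
    then have i: "int i = int centre - head w (T x) 0" by (simp add: i_def centre_def)
    have "cell w (T x) 0 i = 1" using final[OF w(1)] reject i by (simp add: cell_def string_tape_def)
    moreover have "\<bar>int i - int centre\<bar> \<le> int centre - int (T x)"
      using head i by (auto simp: centre_def)
    then have "v (T x, 0, i, cell w (T x) 0 i)"
      using w(2)[OF order_refl] K_pos unfolding describes_def by blast
    moreover have "i < width" using head i by (auto simp: width_def centre_def)
    ultimately show False
      using satisfiesD[OF v, of Not_Rejecting "T x" i] by (auto simp: clause_holds_def)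
  qed
  with w(1) show "\<exists>w. length w \<le> P x \<and> V (pair_string x w)" by blast
next
  assume "\<exists>w. length w \<le> P x \<and> V (pair_string x w)"
  then obtain w where w: "length w \<le> P x" "V (pair_string x w)" by blast
  then have "cell w (T x) 0 i \<noteq> 1" for i
    using tape_at_time_bound[OF assms[OF w(1)]] by (auto simp: cell_def string_tape_def)
  then show "\<exists>v. satisfies v"
    using run_assignment_clause_holds[OF w(1)] unfolding satisfies_def by blast
qed

end

end

section \<open>Checking that segments do not cross\<close>

type_synonym point = "int \<times> int"
type_synonym segment = "point \<times> point"

definition complex_of_point :: "point \<Rightarrow> complex" where
  "complex_of_point p = Complex (of_int (fst p)) (of_int (snd p))"

definition segment_set :: "segment \<Rightarrow> complex set" where
  "segment_set e = closed_segment (complex_of_point (fst e)) (complex_of_point (snd e))"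

definition ends :: "'a \<times> 'a \<Rightarrow> 'a set" where
  "ends e = {fst e, snd e}"

definition meet_in_ends :: "segment \<Rightarrow> segment \<Rightarrow> bool" where
  "meet_in_ends e f \<longleftrightarrow> segment_set e \<inter> segment_set f \<subseteq> complex_of_point ` (ends e \<inter> ends f)"

lemma meet_in_ends_sym: "meet_in_ends e f \<longleftrightarrow> meet_in_ends f e"
  by (simp add: meet_in_ends_def Int_commute)

lemma inj_complex_of_point: "inj complex_of_point"
  by (auto simp: inj_def complex_of_point_def complex_eq_iff prod_eq_iff)

text \<open>
  The conditions are nested conditionals because \<open>code_simp\<close> evaluates these lazily.
\<close>

fun orientation :: "point \<Rightarrow> point \<Rightarrow> point \<Rightarrow> int" where
  "orientation (ax, ay) (bx, by) (cx, cy) = (bx - ax) * (cy - ay) - (by - ay) * (cx - ax)"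

definition same_sign :: "int \<Rightarrow> int \<Rightarrow> bool" where
  "same_sign p q \<longleftrightarrow> (if 0 < p then 0 < q else if p < 0 then q < 0 else False)"

fun noncrossing :: "segment \<Rightarrow> segment \<Rightarrow> bool" where
  "noncrossing (a, b) (c, d) \<longleftrightarrow>
     (if a = c then orientation a b d \<noteq> 0
      else if a = d then orientation a b c \<noteq> 0
      else if b = c then orientation b a d \<noteq> 0
      else if b = d then orientation b a c \<noteq> 0
      else if same_sign (orientation a b c) (orientation a b d) then True
      else same_sign (orientation c d a) (orientation c d b))"

fun left_of :: "segment \<Rightarrow> segment \<Rightarrow> bool" where
  "left_of ((ax, ay), (bx, by)) ((cx, cy), (dx, dy)) \<longleftrightarrow> bx < cx"

fun below :: "segment \<Rightarrow> segment \<Rightarrow> bool" where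
  "below ((ax, ay), (bx, by)) ((cx, cy), (dx, dy)) \<longleftrightarrow> max ay by < min cy dy"

definition compatible :: "segment \<Rightarrow> segment \<Rightarrow> bool" where
  "compatible e f \<longleftrightarrow> (if below e f then True else if below f e then True else noncrossing e f)"

text \<open>
  A sweep line moves from left to right, and \<open>fs\<close> contains the segments that it may still intersect.
\<close>

fun sweep :: "segment list \<Rightarrow> segment list \<Rightarrow> bool" where
  "sweep fs [] \<longleftrightarrow> True"
| "sweep fs (e # es) \<longleftrightarrow>
     (let active = filter (\<lambda>f. \<not> left_of f e) fs
      in if list_all (compatible e) active then sweep (e # active) es else False)"

fun rightward :: "segment \<Rightarrow> segment" where
  "rightward ((ax, ay), (bx, by)) = (if ax \<le> bx then ((ax, ay), (bx, by)) else ((bx, by), (ax, ay)))"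

definition noncrossing_segments :: "segment list \<Rightarrow> bool" where
  "noncrossing_segments es \<longleftrightarrow> sweep [] (sort_key (fst \<circ> fst) (map rightward es))"

lemma complex_segment_bounds:
  assumes "z \<in> closed_segment u v"
  shows "min (Re u) (Re v) \<le> Re z" "Re z \<le> max (Re u) (Re v)"
    "min (Im u) (Im v) \<le> Im z" "Im z \<le> max (Im u) (Im v)"
  using in_closed_segment_imp_Re_in_closed_segment[OF assms]
    in_closed_segment_imp_Im_in_closed_segment[OF assms]
  by (auto simp: closed_segment_eq_real_ivl split: if_splits)

definition side :: "point \<Rightarrow> point \<Rightarrow> complex \<Rightarrow> real" where
  "side a b z = of_int (fst b - fst a) * (Im z - of_int (snd a))
     - of_int (snd b - snd a) * (Re z - of_int (fst a))"

lemma side_in_segment: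
  assumes "z \<in> segment_set (c, d)"
  obtains s where "0 \<le> s" "s \<le> 1" "s = 0 \<Longrightarrow> z = complex_of_point c"
    "\<And>a b. side a b z = (1 - s) * of_int (orientation a b c) + s * of_int (orientation a b d)"
proof -
  obtain s where s: "0 \<le> s" "s \<le> 1" "z = (1 - s) *\<^sub>R complex_of_point c + s *\<^sub>R complex_of_point d"
    using assms by (auto simp: segment_set_def closed_segment_def)
  have "side a b z = (1 - s) * of_int (orientation a b c) + s * of_int (orientation a b d)" for a b
    unfolding s(3) by (cases a; cases b; cases c; cases d)
      (simp add: side_def complex_of_point_def algebra_simps)
  then show thesis using s by (intro that[of s]) auto
qed

lemma orientation_self [simp]: "orientation a b a = 0" "orientation a b b = 0"
  by (cases a; cases b; simp)+

lemma side_eq_0: "z \<in> segment_set (a, b) \<Longrightarrow> side a b z = 0"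
  by (elim side_in_segment) simp

lemma segment_set_flip: "segment_set (a, b) = segment_set (b, a)"
  by (simp add: segment_set_def closed_segment_commute)

lemma common_start_meet:
  assumes "orientation a b d \<noteq> 0"
  shows "segment_set (a, b) \<inter> segment_set (a, d) \<subseteq> {complex_of_point a}"
proof
  fix z assume z: "z \<in> segment_set (a, b) \<inter> segment_set (a, d)"
  then obtain s where "s = 0 \<Longrightarrow> z = complex_of_point a"
    "side a b z = (1 - s) * of_int (orientation a b a) + s * of_int (orientation a b d)"
    by (metis IntE side_in_segment)
  then show "z \<in> {complex_of_point a}" using z assms side_eq_0[of z a b] by simp
qed

lemma same_side_disjoint:
  assumes "same_sign (orientation a b c) (orientation a b d)"
  shows "segment_set (a, b) \<inter> segment_set (c, d) = {}"
proof -
  let ?p = "of_int (orientation a b c) :: real" and ?q = "of_int (orientation a b d) :: real"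
  have False if z: "z \<in> segment_set (a, b)" "z \<in> segment_set (c, d)" for z
  proof -
    obtain s where s: "0 \<le> s" "s \<le> 1" "side a b z = (1 - s) * ?p + s * ?q"
      by (rule side_in_segment[OF z(2)]) blast
    moreover have "0 < (1 - s) * ?p + s * ?q" if "0 < ?p" "0 < ?q"
      using s(1,2) that by (cases "s = 0") (auto intro: add_nonneg_pos)
    moreover have "(1 - s) * ?p + s * ?q < 0" if "?p < 0" "?q < 0"
      using s(1,2) that mult_pos_neg[of s ?q] mult_nonneg_nonpos[of "1 - s" ?p] by (cases "s = 0") auto
    ultimately show False using assms side_eq_0[OF z(1)] by (auto simp: same_sign_def split: if_splits)
  qed
  then show ?thesis by blast
qed

lemma meet_in_ends_if_noncrossing: "noncrossing (a, b) (c, d) \<Longrightarrow> meet_in_ends (a, b) (c, d)"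
  using common_start_meet[of a b d] common_start_meet[of a b c] common_start_meet[of b a d]
    common_start_meet[of b a c] same_side_disjoint[of a b c d] same_side_disjoint[of c d a b]
    segment_set_flip[of a b] segment_set_flip[of c d]
  by (auto simp: meet_in_ends_def ends_def split: if_splits)

lemma segment_set_bounds:
  assumes "z \<in> segment_set ((ax, ay), (bx, by))"
  shows "of_int (min ax bx) \<le> Re z" "Re z \<le> of_int (max ax bx)"
    "of_int (min ay by) \<le> Im z" "Im z \<le> of_int (max ay by)"
  using complex_segment_bounds[OF assms[unfolded segment_set_def]]
  by (simp_all add: complex_of_point_def)

lemma meet_in_ends_if_below:
  assumes "below e f"
  shows "meet_in_ends e f"
proof -
  obtain x1 y1 x2 y2 x3 y3 x4 y4
    where eq: "e = ((x1, y1), (x2, y2))" "f = ((x3, y3), (x4, y4))" by (metis surj_pair)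
  have "real_of_int (max y1 y2) < of_int (min y3 y4)"
    using assms by (simp only: eq below.simps of_int_less_iff)
  then have "segment_set e \<inter> segment_set f = {}" unfolding eq by (force dest: segment_set_bounds)
  then show ?thesis by (simp add: meet_in_ends_def)
qed

lemma meet_in_ends_if_left_of:
  assumes "left_of e f" "fst (fst e) \<le> fst (snd e)" "fst (fst f) \<le> fst (snd f)"
  shows "meet_in_ends e f"
proof -
  obtain x1 y1 x2 y2 x3 y3 x4 y4
    where eq: "e = ((x1, y1), (x2, y2))" "f = ((x3, y3), (x4, y4))" by (metis surj_pair)
  have "max x1 x2 < min x3 x4" using assms by (simp add: eq)
  then have "real_of_int (max x1 x2) < of_int (min x3 x4)" by (simp only: of_int_less_iff)
  then have "segment_set e \<inter> segment_set f = {}" unfolding eq by (force dest: segment_set_bounds)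
  then show ?thesis by (simp add: meet_in_ends_def)
qed

lemma meet_in_ends_if_compatible: "compatible e f \<Longrightarrow> meet_in_ends e f"
  using meet_in_ends_if_below[of e f] meet_in_ends_if_below[of f e] meet_in_ends_sym[of e f]
    meet_in_ends_if_noncrossing[of "fst e" "snd e" "fst f" "snd f"]
  by (auto simp: compatible_def split: if_splits)

lemma left_of_mono: "left_of e f \<Longrightarrow> fst (fst f) \<le> fst (fst g) \<Longrightarrow> left_of e g"
  by (cases e rule: prod.exhaust, cases f rule: prod.exhaust, cases g rule: prod.exhaust) auto

lemma sweep_meet_in_ends:
  assumes "sweep fs es" "sorted (map (fst \<circ> fst) es)"
    and "\<And>e. e \<in> set fs \<union> set es \<Longrightarrow> fst (fst e) \<le> fst (snd e)"
  shows "(\<forall>f\<in>set fs. \<forall>e\<in>set es. meet_in_ends f e) \<and> sorted_wrt meet_in_ends es"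
  using assms
proof (induction es arbitrary: fs)
  case (Cons e es)
  define active where "active = filter (\<lambda>f. \<not> left_of f e) fs"
  have step: "\<forall>f\<in>set active. compatible e f" "sweep (e # active) es"
    using Cons.prems(1) by (auto simp: active_def list_all_iff Let_def split: if_splits)
  have later: "(\<forall>f\<in>set (e # active). \<forall>g\<in>set es. meet_in_ends f g) \<and> sorted_wrt meet_in_ends es"
    using Cons.prems by (intro Cons.IH[OF step(2)]) (auto simp: active_def)
  have "meet_in_ends f g" if "f \<in> set fs" "g \<in> set (e # es)" for f g
  proof (cases "f \<in> set active")
    case True
    then have "meet_in_ends f e" using step(1) meet_in_ends_if_compatible meet_in_ends_sym by blast
    then show ?thesis using that later True by (cases "g = e") simp_all
  next
    case False
    then have "left_of f e" using that(1) by (simp add: active_def)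
    moreover have "fst (fst e) \<le> fst (fst g)" using Cons.prems(2) that(2) by auto
    ultimately have "left_of f g" by (rule left_of_mono)
    then show ?thesis
      using Cons.prems(3)[of f] Cons.prems(3)[of g] that by (intro meet_in_ends_if_left_of) auto
  qed
  then show ?case using later by simp
qed simp

lemma rightward_simps:
  "segment_set (rightward e) = segment_set e" "ends (rightward e) = ends e"
  "fst (fst (rightward e)) \<le> fst (snd (rightward e))"
  by (cases e rule: rightward.cases; auto simp: segment_set_flip ends_def)+

lemma noncrossing_segments_meet_in_ends:
  assumes "noncrossing_segments es" "e \<in> set es" "f \<in> set es" "ends e \<noteq> ends f"
  shows "meet_in_ends e f"
proof -
  let ?es = "sort_key (fst \<circ> fst) (map rightward es)"
  have "sorted_wrt meet_in_ends ?es"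
  proof (rule conjunct2[OF sweep_meet_in_ends])
    show "sweep [] ?es" using assms(1) by (simp add: noncrossing_segments_def)
    show "fst (fst e) \<le> fst (snd e)" if "e \<in> set [] \<union> set ?es" for e
      using that rightward_simps(3) by auto
  qed simp
  moreover obtain i j where ij: "i < length ?es" "?es ! i = rightward e"
    "j < length ?es" "?es ! j = rightward f"
    using assms(2,3) by (metis (no_types, lifting) in_set_conv_nth image_eqI set_map set_sort)
  moreover have "i \<noteq> j" using ij assms(4) rightward_simps(2) by metis
  ultimately have "meet_in_ends (rightward e) (rightward f) \<or> meet_in_ends (rightward f) (rightward e)"
    unfolding sorted_wrt_iff_nth_less by (metis linorder_neqE_nat)
  then show ?thesis by (auto simp: meet_in_ends_def rightward_simps Int_commute)
qed

section \<open>The boxes\<close>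

text \<open>
  A box is a plane bipartite graph with the vertices \<open>{..<108}\<close>, even ones being clauses and odd ones
  variables. Its vertices \<open>{..<8}\<close> are ports, clockwise from the top: variables enter at 0 (from above),
  2 (from the right), 4 (from below), 6 (from the left) and leave at 1, 3, 5, 7. A port has one
  neighbour outside the box.

  If every clause has exactly one true neighbour, then 0 and 5 carry a common value \<open>v\<close>, 6 and 7 a
  value \<open>h\<close>, and 2 and 3 a value \<open>h'\<close>. A cross passes \<open>h\<close> on, a positive (negative) box may in
  addition turn \<open>h = 0\<close> into \<open>h' = 1\<close> if \<open>v\<close> (if \<open>\<not> v\<close>), and a border box has \<open>h = 1\<close> and \<open>h' = 0\<close>.
  The boxes were found by a computer search over small plane graphs.
\<close>

datatype box = Cross | Positive | Negative | Border

text \<open>The variables that occur in the clauses 0, 2, 4, ..., 106.\<close>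

fun box_clauses :: "box \<Rightarrow> nat list list" where
  "box_clauses Cross =
    [[95, 107], [85, 105], [81, 103], [9, 97], [9, 11, 97], [11, 13, 97], [13, 15, 91], [15, 17, 19],
     [15, 31, 91], [17, 21, 29], [21, 23, 29], [11, 13, 25], [25, 27, 89], [25, 33, 89], [27, 91, 99],
     [27, 89, 99], [33, 35, 39], [31, 37, 41], [37, 53, 99], [35, 45, 47], [33, 35, 43], [43, 51, 53],
     [45, 95, 107], [43, 49, 95], [49, 59, 101], [51, 59, 103], [49, 55, 93], [55, 57, 93],
     [57, 93, 101], [59, 61, 75], [61, 63, 87], [63, 65, 87], [65, 67, 69], [61, 75, 77], [63, 71, 73],
     [57, 67, 101], [73, 85, 105], [75, 79, 83], [65, 67, 87], [79, 81, 83], [3, 77, 105],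
     [45, 47, 107], [79, 81, 103], [5, 19, 23], [3, 77, 83], [5, 23, 29], [7, 39, 47], [7, 9, 39],
     [71, 73, 85], [17, 19, 21], [31, 41, 51], [1, 69, 71], [37, 41, 53], [1, 55, 69]]"
| "box_clauses Positive =
    [[91, 101], [85, 107], [43, 103], [9, 17], [9, 11, 75], [11, 13, 75], [13, 15, 21], [15, 21, 105],
     [15, 19, 105], [5, 19, 87], [21, 23, 89], [23, 25, 89], [25, 27, 89], [27, 29, 45], [29, 31, 87],
     [27, 33, 45], [25, 35, 95], [29, 37, 39], [35, 95, 101], [31, 41, 43], [37, 87, 105],
     [43, 47, 103], [35, 49, 101], [47, 51, 81], [47, 81, 103], [41, 53, 99], [51, 55, 57],
     [53, 59, 97], [55, 61, 63], [49, 65, 67], [53, 69, 97], [59, 77, 99], [59, 77, 97], [65, 71, 91],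
     [61, 73, 93], [71, 91, 99], [73, 85, 93], [3, 57, 107], [63, 69, 79], [7, 23, 95], [1, 77, 83],
     [65, 67, 71], [85, 93, 107], [33, 37, 39], [33, 39, 45], [1, 73, 83], [31, 49, 67], [7, 9, 11],
     [3, 57, 81], [41, 51, 55], [69, 79, 83], [61, 63, 79], [5, 17, 19], [13, 17, 75]]"
| "box_clauses Negative =
    [[89, 107], [91, 101], [95, 97], [9, 13], [5, 9, 11], [11, 15, 17], [5, 11, 17], [15, 21, 103],
     [17, 19, 27], [15, 23, 103], [19, 25, 105], [23, 35, 103], [21, 29, 41], [25, 37, 105],
     [29, 31, 87], [19, 33, 95], [33, 39, 69], [25, 43, 89], [37, 53, 107], [29, 47, 87], [33, 45, 57],
     [39, 55, 69], [41, 49, 51], [43, 67, 89], [39, 61, 99], [45, 59, 81], [27, 63, 83], [3, 55, 99],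
     [43, 67, 83], [59, 65, 81], [61, 95, 97], [61, 97, 99], [37, 53, 105], [57, 65, 79], [69, 71, 93],
     [71, 73, 75], [71, 77, 93], [75, 91, 101], [77, 79, 93], [3, 55, 91], [73, 75, 101], [77, 79, 85],
     [45, 53, 107], [1, 73, 85], [57, 59, 65], [7, 49, 51], [27, 47, 87], [23, 31, 35], [47, 51, 63],
     [21, 31, 35], [7, 13, 49], [9, 13, 41], [63, 67, 83], [1, 81, 85]]"
| "box_clauses Border =
    [[53, 55], [25, 35], [99, 105], [9, 11], [9, 21, 23], [9, 13, 23], [13, 15, 19], [15, 17, 19],
     [15, 21, 23], [11, 13, 19], [7, 17, 21], [7, 11, 17], [25, 27, 35], [27, 29, 31], [29, 31, 33],
     [31, 33, 35], [25, 27, 29], [3, 33, 37], [37, 39, 49], [39, 41, 49], [39, 41, 43], [43, 45, 51],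
     [45, 47, 51], [43, 47, 51], [37, 45, 47], [3, 41, 49], [53, 55, 57], [53, 59, 61], [55, 57, 63],
     [57, 59, 63], [59, 61, 63], [61, 65, 67], [65, 67, 69], [65, 71, 73], [67, 69, 75], [69, 71, 75],
     [71, 73, 75], [73, 77, 79], [77, 79, 81], [5, 77, 83], [79, 81, 85], [81, 83, 85], [5, 83, 85],
     [1, 87, 89], [1, 89, 91], [87, 93, 95], [87, 95, 97], [89, 91, 97], [91, 95, 97], [93, 99, 101],
     [93, 101, 103], [99, 105, 107], [101, 103, 107], [103, 105, 107]]"

text \<open>The positions of the vertices in a straight-line drawing inside a square of side 2400.\<close>

fun box_coords :: "box \<Rightarrow> (int \<times> int) list" where
  "box_coords Cross =
    [(800, 2400), (1600, 2400), (2400, 1600), (2400, 800), (1600, 0), (800, 0), (0, 800), (0, 1600),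
     (286, 919), (108, 1063), (383, 670), (367, 937), (622, 504), (431, 673), (803, 326), (804, 326),
     (1038, 447), (602, 364), (552, 346), (1004, 283), (692, 267), (705, 285), (420, 943), (806, 170),
     (662, 931), (494, 988), (622, 1195), (722, 898), (819, 788), (536, 324), (816, 1049), (1106, 476),
     (532, 1407), (626, 1284), (1054, 636), (749, 1580), (949, 957), (1001, 796), (734, 1708),
     (304, 1481), (858, 1462), (1124, 670), (1133, 1051), (1079, 1384), (833, 1940), (812, 1831),
     (1179, 1665), (490, 1794), (1271, 1339), (1203, 1673), (1226, 726), (1203, 719), (1224, 1881),
     (1016, 992), (1384, 1848), (1352, 2002), (1341, 1584), (1438, 1697), (1509, 965), (1332, 1007),
     (1754, 1309), (1746, 1154), (1726, 1631), (1910, 1543), (1589, 1748), (1702, 1640), (1858, 1037),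
     (1487, 1541), (1926, 1548), (1639, 1967), (1483, 1543), (1833, 1840), (2115, 1517), (2011, 1503),
     (1672, 702), (1649, 845), (1589, 1444), (2076, 962), (1786, 441), (1598, 565), (2246, 1055),
     (1765, 233), (621, 1955), (1906, 608), (1573, 454), (2178, 1781), (1001, 129), (1612, 1436),
     (2138, 664), (758, 1085), (601, 203), (823, 599), (243, 1758), (1290, 1736), (117, 1346),
     (981, 2034), (2003, 1750), (232, 633), (804, 323), (945, 956), (1176, 510), (1371, 1431),
     (1735, 2128), (1423, 362), (1070, 832), (2280, 1341), (1482, 2132), (636, 2165)]"
| "box_coords Positive =
    [(800, 2400), (1600, 2400), (2400, 1600), (2400, 800), (1600, 0), (800, 0), (0, 800), (0, 1600),
     (142, 983), (60, 1058), (250, 1139), (119, 1168), (339, 988), (338, 987), (552, 903), (487, 809),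
     (636, 632), (290, 551), (913, 248), (680, 445), (435, 1136), (409, 1117), (566, 1313), (369, 1410),
     (808, 1058), (790, 1297), (969, 992), (827, 1007), (1120, 671), (1048, 882), (732, 943),
     (1168, 698), (817, 1390), (721, 907), (939, 794), (853, 1410), (648, 1716), (797, 794),
     (1226, 719), (834, 843), (807, 685), (1333, 1002), (1570, 453), (1422, 359), (942, 1535),
     (851, 960), (1671, 698), (1596, 563), (1784, 441), (966, 1540), (1269, 1332), (1649, 841),
     (1860, 1035), (1371, 1426), (1337, 1579), (1747, 1152), (1756, 1307), (2077, 962), (954, 1691),
     (1287, 1730), (1484, 1540), (1912, 1543), (1223, 1875), (1615, 1433), (1385, 1844), (983, 1710),
     (1039, 1742), (1041, 1414), (1926, 1548), (1487, 1538), (1172, 1655), (1120, 1464), (2004, 1750),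
     (1833, 1839), (2247, 1055), (268, 950), (1591, 1442), (1350, 1997), (293, 1674), (1703, 1639),
     (1480, 2131), (1906, 607), (1089, 1446), (1640, 1968), (2117, 1517), (2179, 1782), (720, 868),
     (1005, 460), (827, 901), (612, 1112), (1735, 2128), (984, 2030), (1068, 1117), (2012, 1502),
     (31, 1330), (598, 1684), (2139, 664), (1438, 1693), (1509, 961), (1198, 1664), (1591, 1747),
     (830, 1963), (1729, 1629), (1763, 235), (576, 301), (696, 688), (322, 766), (2282, 1340)]"
| "box_coords Negative =
    [(800, 2400), (1600, 2400), (2400, 1600), (2400, 800), (1600, 0), (800, 0), (0, 800), (0, 1600),
     (571, 293), (290, 550), (785, 586), (724, 432), (930, 236), (127, 1049), (614, 718), (727, 701),
     (1113, 663), (1026, 486), (818, 745), (1169, 697), (1068, 1115), (551, 809), (735, 784),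
     (826, 776), (517, 977), (965, 1539), (954, 1690), (927, 1002), (773, 951), (629, 1133),
     (1226, 717), (780, 865), (1508, 961), (1333, 1002), (941, 1532), (737, 811), (1039, 1742),
     (984, 1708), (663, 1150), (1649, 841), (1269, 1332), (505, 975), (1860, 1035), (855, 1407),
     (469, 1314), (1198, 1664), (650, 1715), (661, 1361), (1671, 698), (268, 1453), (1223, 1875),
     (443, 1657), (765, 1343), (1120, 1463), (2139, 664), (2077, 962), (825, 1399), (1370, 1426),
     (1385, 1843), (1286, 1730), (1570, 453), (1596, 562), (1784, 441), (578, 1669), (1089, 1445),
     (1438, 1693), (1483, 1540), (614, 1698), (1756, 1307), (1747, 1152), (1926, 1548), (1912, 1543),
     (1729, 1629), (1833, 1839), (2117, 1517), (2012, 1502), (1590, 1442), (1703, 1639), (2247, 1055),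
     (1487, 1538), (2003, 1750), (1350, 1996), (1591, 1747), (824, 1399), (1172, 1654), (1640, 1968),
     (1735, 2128), (798, 962), (1337, 1579), (830, 1962), (241, 1757), (2282, 1340), (799, 1062),
     (1615, 1433), (830, 797), (1422, 358), (526, 1659), (1763, 235), (659, 858), (1906, 607),
     (88, 1330), (2179, 1782), (336, 849), (715, 735), (613, 1699), (1040, 1413), (1480, 2131),
     (984, 2029)]"
| "box_coords Border =
    [(800, 2400), (1600, 2400), (2400, 1600), (2400, 800), (1600, 0), (800, 0), (0, 800), (0, 1600),
     (46, 1131), (31, 985), (130, 1013), (416, 1003), (220, 1122), (211, 1021), (266, 1257),
     (185, 1216), (127, 1220), (258, 1360), (304, 1045), (298, 1150), (65, 1418), (59, 1279),
     (419, 1398), (112, 1118), (2267, 1534), (2344, 1529), (2232, 1452), (2257, 1495), (2259, 1357),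
     (2280, 1415), (2148, 1420), (2204, 1419), (2311, 1476), (2233, 1270), (2231, 1126), (2227, 1580),
     (2211, 987), (2169, 1081), (2242, 847), (2197, 890), (2186, 794), (2257, 776), (2111, 892),
     (2138, 836), (2121, 951), (2105, 961), (2140, 900), (2137, 967), (2128, 1025), (2276, 879),
     (2325, 773), (2124, 911), (975, 2175), (1078, 2220), (1079, 1862), (832, 2229), (848, 2109),
     (951, 2085), (954, 1996), (977, 1910), (831, 1850), (797, 1680), (802, 1561), (845, 1976),
     (972, 1333), (1084, 1380), (1080, 1020), (831, 1386), (848, 1264), (952, 1248), (956, 1155),
     (975, 1069), (829, 1013), (798, 838), (801, 718), (845, 1136), (972, 493), (1084, 541),
     (1079, 180), (830, 548), (851, 428), (952, 406), (952, 316), (975, 229), (831, 168), (848, 296),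
     (1154, 2115), (1153, 1537), (1557, 2125), (1323, 2039), (1601, 1246), (1523, 1927), (1322, 1615),
     (1599, 1153), (1356, 1896), (1555, 1521), (1523, 1721), (1354, 1750), (1150, 861), (1152, 289),
     (1555, 882), (1323, 787), (1322, 365), (1520, 685), (1353, 652), (1552, 274), (1524, 468),
     (1358, 499)]"

declare box_clauses.simps [simp del] box_coords.simps [simp del]

definition box_nbrs :: "box \<Rightarrow> nat \<Rightarrow> nat list" where
  "box_nbrs b k =
     (if even k then box_clauses b ! (k div 2)
      else map ((*) 2) (filter (\<lambda>i. k \<in> set (box_clauses b ! i)) [0..<54]))"

definition opposite :: "nat \<Rightarrow> nat" where
  "opposite p = (if even p then p + 1 else p - 1)"

fun exactly_one :: "bool list \<Rightarrow> bool" where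
  "exactly_one [] \<longleftrightarrow> False"
| "exactly_one (b # bs) \<longleftrightarrow> b \<and> list_all Not bs \<or> \<not> b \<and> exactly_one bs"

declare exactly_one.simps [simp del]

text \<open>
  \<open>s\<close> selects vertices of the box, and \<open>e k\<close> tells whether the outside neighbour of port \<open>k\<close>
  is selected.
\<close>

definition exact_at :: "box \<Rightarrow> (nat \<Rightarrow> bool) \<Rightarrow> (nat \<Rightarrow> bool) \<Rightarrow> nat \<Rightarrow> bool" where
  "exact_at b s e k \<longleftrightarrow> exactly_one (map s (box_nbrs b k) @ (if k < 8 then [e k] else []))"

text \<open>
  The clauses \<open>2 * i\<close> with \<open>i\<close> in one of the following lists are connected via variables;
  \<open>2 * i + 1\<close> is a variable of the same component.
\<close>

definition inner_component :: "nat list" where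
  "inner_component = [3..<54] @ [0..<3]"

lemma set_inner_component: "set inner_component = {..<54}"
  by (simp only: inner_component_def set_append set_upt) auto

definition left_component :: "nat list" where
  "left_component = [3..<12]"

definition right_component :: "nat list" where
  "right_component = 1 # [12..<26]"

fun literal_value :: "box \<Rightarrow> bool \<Rightarrow> bool" where
  "literal_value Positive v \<longleftrightarrow> v"
| "literal_value Negative v \<longleftrightarrow> \<not> v"
| "literal_value _ v \<longleftrightarrow> False"

definition box_solution :: "box \<Rightarrow> bool \<Rightarrow> bool \<Rightarrow> bool \<Rightarrow> nat list" where
  "box_solution b v h h' =
    (case (b, v, h, h') of
      (Cross, False, False, False) \<Rightarrow>
        [9, 13, 17, 23, 27, 31, 33, 47, 53, 55, 61, 65, 71, 83, 95, 101, 103, 105]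
    | (Cross, False, True, True) \<Rightarrow>
        [3, 7, 11, 17, 23, 35, 37, 49, 51, 57, 69, 73, 75, 81, 87, 89, 91, 107]
    | (Cross, True, False, False) \<Rightarrow>
        [1, 5, 15, 21, 25, 39, 41, 43, 45, 59, 63, 67, 77, 79, 85, 93, 97, 99]
    | (Cross, True, True, True) \<Rightarrow>
        [1, 3, 5, 7, 11, 15, 21, 27, 33, 37, 45, 49, 51, 57, 61, 65, 73, 79]
    | (Positive, False, False, False) \<Rightarrow>
        [11, 15, 17, 23, 27, 35, 39, 43, 53, 55, 67, 73, 77, 79, 81, 87, 91, 107]
    | (Positive, False, True, True) \<Rightarrow>
        [3, 7, 19, 21, 25, 31, 37, 45, 51, 63, 65, 75, 83, 93, 97, 99, 101, 103]
    | (Positive, True, False, False) \<Rightarrow>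
        [1, 5, 9, 13, 29, 33, 41, 47, 49, 57, 59, 61, 69, 71, 85, 89, 95, 105]
    | (Positive, True, False, True) \<Rightarrow>
        [1, 3, 5, 9, 13, 23, 27, 31, 35, 39, 47, 55, 65, 79, 93, 97, 99, 105]
    | (Positive, True, True, True) \<Rightarrow>
        [1, 3, 5, 7, 15, 31, 35, 37, 45, 47, 55, 65, 75, 79, 89, 93, 97, 99]
    | (Negative, False, False, False) \<Rightarrow>
        [9, 17, 21, 23, 43, 49, 57, 63, 69, 73, 77, 81, 87, 91, 95, 99, 105, 107]
    | (Negative, False, False, True) \<Rightarrow>
        [3, 11, 13, 19, 21, 23, 37, 39, 45, 51, 65, 75, 83, 85, 87, 89, 93, 97]
    | (Negative, False, True, True) \<Rightarrow>
        [3, 7, 11, 19, 31, 37, 39, 41, 45, 47, 65, 75, 83, 85, 89, 93, 97, 103]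
    | (Negative, True, False, False) \<Rightarrow>
        [1, 5, 13, 15, 25, 27, 29, 33, 35, 51, 53, 55, 59, 61, 67, 71, 79, 101]
    | (Negative, True, True, True) \<Rightarrow>
        [1, 3, 5, 7, 15, 19, 35, 37, 41, 43, 45, 61, 63, 65, 69, 75, 77, 87]
    | (Border, False, True, False) \<Rightarrow>
        [7, 19, 23, 25, 31, 37, 41, 51, 55, 59, 67, 71, 79, 83, 89, 95, 101, 105]
    | (Border, True, True, False) \<Rightarrow>
        [1, 5, 7, 19, 23, 25, 31, 37, 41, 51, 57, 61, 69, 73, 81, 93, 97, 107]
    | _ \<Rightarrow> [])"

subsection \<open>Adjacency\<close>

lemma nth_entries: "xs = ys \<Longrightarrow> list_all (\<lambda>(i, y). xs ! i = y) (List.enumerate 0 ys)"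
  by (simp add: list_all_length nth_enumerate_eq)

context
  notes [simp] = numeral_2_eq_2[symmetric]
begin

lemmas box_clauses_nth = box_clauses.simps[THEN nth_entries, simplified]
lemmas box_coords_nth = box_coords.simps[THEN nth_entries, simplified]

end

definition clause_ok :: "nat \<Rightarrow> nat list \<Rightarrow> bool" where
  "clause_ok k js \<longleftrightarrow> distinct js \<and> length js = (if k < 8 then 2 else 3) \<and>
     list_all (\<lambda>j. odd j \<and> j < 108 \<and> (k < 8 \<longrightarrow> j \<noteq> opposite k)) js"

definition variable_ok :: "nat list list \<Rightarrow> nat \<Rightarrow> bool" where
  "variable_ok jss k \<longleftrightarrow> length (filter (\<lambda>js. k \<in> set js) jss) = (if k < 8 then 2 else 3)"

lemma length_box_clauses: "length (box_clauses b) = 54"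
  by (cases b) (simp_all add: box_clauses.simps)

lemma box_clauses_ok: "list_all (\<lambda>(i, js). clause_ok (2 * i) js) (List.enumerate 0 (box_clauses b))"
  by (cases b; hypsubst; code_simp)

lemma box_variables_ok: "list_all (variable_ok (box_clauses b)) (map (\<lambda>i. 2 * i + 1) [0..<54])"
  by (cases b; hypsubst; code_simp)

lemma clause_ok_nth:
  assumes "i < 54"
  shows "clause_ok (2 * i) (box_clauses b ! i)"
  using box_clauses_ok[of b] assms
  by (auto simp: list_all_length nth_enumerate_eq length_box_clauses)

lemma in_box_clauseD:
  assumes "i < 54" "j \<in> set (box_clauses b ! i)"
  shows "odd j" "j < 108" "i < 4 \<Longrightarrow> j \<noteq> Suc (2 * i)"
  using clause_ok_nth[OF assms(1), of b] assms(2) by (simp_all add: clause_ok_def list_all_iff opposite_def)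

lemma length_filter_nth: "length (filter (\<lambda>i. P (xs ! i)) [0..<length xs]) = length (filter P xs)"
  by (simp add: length_filter_conv_card cong: conj_cong)

lemma distinct_box_nbrs: "k < 108 \<Longrightarrow> distinct (box_nbrs b k)"
  using clause_ok_nth[of "k div 2" b]
  by (auto simp: box_nbrs_def clause_ok_def distinct_map inj_on_def)

lemma length_box_nbrs:
  assumes "k < 108"
  shows "length (box_nbrs b k) = (if k < 8 then 2 else 3)"
proof (cases "even k")
  case True
  then show ?thesis
    using clause_ok_nth[of "k div 2" b] assms by (auto simp: box_nbrs_def clause_ok_def elim!: evenE)
next
  case False
  then have "k \<in> set (map (\<lambda>i. 2 * i + 1) [0..<54])" using assms by (auto elim!: oddE)
  then have "variable_ok (box_clauses b) k"
    using box_variables_ok[of b] by (simp only: list_all_iff)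
  then show ?thesis
    using False length_filter_nth[of "\<lambda>js. k \<in> set js" "box_clauses b"]
    by (simp add: box_nbrs_def variable_ok_def length_box_clauses)
qed

lemma in_box_nbrs_iff:
  assumes "k < 108"
  shows "j \<in> set (box_nbrs b k) \<longleftrightarrow>
    (\<exists>i<54. k = 2 * i \<and> j \<in> set (box_clauses b ! i) \<or> j = 2 * i \<and> odd k \<and> k \<in> set (box_clauses b ! i))"
  using assms by (auto simp: box_nbrs_def elim!: evenE)

lemma box_nbr_facts:
  assumes "k < 108" "j \<in> set (box_nbrs b k)"
  shows "j < 108" "even j \<longleftrightarrow> odd k" "k \<in> set (box_nbrs b j)" "k < 8 \<Longrightarrow> j \<noteq> opposite k"
proof -
  from assms consider (clause) i where "i < 54" "k = 2 * i" "j \<in> set (box_clauses b ! i)"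
    | (variable) i where "i < 54" "j = 2 * i" "k \<in> set (box_clauses b ! i)"
    by (auto simp: in_box_nbrs_iff)
  then have "j < 108 \<and> (even j \<longleftrightarrow> odd k) \<and> k \<in> set (box_nbrs b j) \<and> (k < 8 \<longrightarrow> j \<noteq> opposite k)"
  proof cases
    case (clause i)
    note j = in_box_clauseD[OF clause(1,3)]
    have "k \<in> set (box_nbrs b j)" using clause j by (auto simp: in_box_nbrs_iff)
    then show ?thesis using clause j by (simp add: opposite_def)
  next
    case (variable i)
    note k = in_box_clauseD[OF variable(1,3)]
    have "k \<in> set (box_nbrs b j)" using variable by (auto simp: in_box_nbrs_iff)
    then show ?thesis using variable k by (cases "i < 4") (auto simp: opposite_def)
  qed
  then show "j < 108" "even j \<longleftrightarrow> odd k" "k \<in> set (box_nbrs b j)" "k < 8 \<Longrightarrow> j \<noteq> opposite k" by simp_all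
qed

subsection \<open>Connectivity\<close>

fun joined :: "(nat \<Rightarrow> nat list) \<Rightarrow> nat list \<Rightarrow> nat list \<Rightarrow> bool" where
  "joined f ks [] \<longleftrightarrow> True"
| "joined f ks (i # is) \<longleftrightarrow> (if list_ex (\<lambda>k. k \<in> set ks) (f i) then joined f (f i @ ks) is else False)"

lemma joined_propagates:
  assumes "joined f ks is" "\<And>k. k \<in> set ks \<Longrightarrow> P k"
    and "\<And>i j k. i \<in> set is \<Longrightarrow> j \<in> set (f i) \<Longrightarrow> k \<in> set (f i) \<Longrightarrow> P j \<Longrightarrow> P k"
    and "i \<in> set is" "k \<in> set (f i)"
  shows "P k"
  using assms
proof (induction "is" arbitrary: ks)
  case (Cons j js)
  obtain k0 where k0: "k0 \<in> set (f j)" "k0 \<in> set ks" and js: "joined f (f j @ ks) js"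
    using Cons.prems(1) by (auto simp: list_ex_iff split: if_splits)
  have new: "P k" if "k \<in> set (f j)" for k
    using Cons.prems(3)[of j k0 k] Cons.prems(2)[OF k0(2)] k0(1) that by simp
  show ?case
  proof (cases "i = j")
    case False
    show ?thesis
    proof (rule Cons.IH[OF js])
      show "P k" if "k \<in> set (f j @ ks)" for k
        using that new Cons.prems(2) by auto
      show "P k'" if "i \<in> set js" "j \<in> set (f i)" "k' \<in> set (f i)" "P j" for i j k'
        using that Cons.prems(3)[of i j k'] by simp
    qed (use Cons.prems False in auto)
  qed (use new Cons.prems in blast)
qed simp

lemma upt_numeral: "[a..<numeral b] = (if a < numeral b then a # [Suc a..<numeral b] else [])"
  by (simp add: upt_rec)

lemmas component_simps = inner_component_def left_component_def right_component_def box_clauses_nth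
  upt_rec_numeral upt_numeral numeral_2_eq_2[symmetric]

lemma inner_joined: "b \<noteq> Border \<Longrightarrow> joined ((!) (box_clauses b)) (box_clauses b ! 3) inner_component"
  by (cases b; simp add: component_simps)

lemma left_joined: "joined ((!) (box_clauses Border)) (box_clauses Border ! 3) left_component"
  by (simp add: component_simps)

lemma right_joined: "joined ((!) (box_clauses Border)) (box_clauses Border ! 1) right_component"
  by (simp add: component_simps)

lemma right_variables_occur:
  "list_all (\<lambda>i. list_ex (\<lambda>i'. 2 * i + 1 \<in> set (box_clauses Border ! i')) right_component) right_component"
  by (simp add: component_simps)

subsection \<open>Values of the ports\<close>

lemmas exact_simps = exact_at_def box_nbrs_def component_simps

lemma inner_box_values:
  assumes "b \<noteq> Border" "list_all (\<lambda>i. exact_at b s e (2 * i)) inner_component"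
  shows "(s 5 \<longleftrightarrow> e 0) \<and> (s 3 \<longrightarrow> e 6 \<or> literal_value b (e 0))"
proof (cases b)
  case Border
  then show ?thesis using assms(1) by simp
qed (use assms(2) in \<open>simp add: exact_simps, simp only: exactly_one.simps list.pred_inject, sat\<close>)+

lemma left_component_value: "list_all (\<lambda>i. exact_at Border s e (2 * i)) left_component \<Longrightarrow> e 6"
  by (simp add: exact_simps, simp only: exactly_one.simps list.pred_inject, sat)

lemma right_component_value: "list_all (\<lambda>i. exact_at Border s e (2 * i)) right_component \<Longrightarrow> \<not> s 3"
  by (simp add: exact_simps, simp only: exactly_one.simps list.pred_inject, sat)

lemma right_variables_not_exact: "\<not> list_all (\<lambda>i. exact_at Border s e (2 * i + 1)) right_component"
  by (simp add: exact_simps, simp only: exactly_one.simps list.pred_inject, sat)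

definition solution_ok :: "box \<Rightarrow> bool \<Rightarrow> bool \<Rightarrow> bool \<Rightarrow> nat list \<Rightarrow> bool" where
  "solution_ok b v h h' ks \<longleftrightarrow> list_all odd ks \<and>
     (1 \<in> set ks) = v \<and> (5 \<in> set ks) = v \<and> (3 \<in> set ks) = h' \<and> (7 \<in> set ks) = h \<and>
     list_all (\<lambda>i. exact_at b (\<lambda>j. j \<in> set ks) (\<lambda>k. if k = 2 then h' else if k = 6 then h else v) (2 * i))
       [0..<54]"

lemma inner_box_solution:
  assumes "b \<noteq> Border" "h \<longrightarrow> h'" "h' \<longrightarrow> h \<or> literal_value b v"
  shows "solution_ok b v h h' (box_solution b v h h')"
  using assms
  by (cases b; cases v; cases h; cases h';
      simp add: solution_ok_def box_solution_def exact_simps exactly_one.simps)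

lemma border_box_solution: "solution_ok Border v True False (box_solution Border v True False)"
  by (cases v; simp add: solution_ok_def box_solution_def exact_simps exactly_one.simps)

subsection \<open>The drawing of a box\<close>

text \<open>Neighbouring ports of a box on the border of the grid are joined by edges.\<close>

definition box_edges :: "box \<Rightarrow> (nat \<times> nat) list" where
  "box_edges b = concat (map (\<lambda>(i, js). map (Pair (2 * i)) js) (List.enumerate 0 (box_clauses b)))
     @ [(0, 1), (2, 3), (4, 5), (6, 7)]"

definition box_segment :: "box \<Rightarrow> nat \<times> nat \<Rightarrow> segment" where
  "box_segment b e = map_prod ((!) (box_coords b)) ((!) (box_coords b)) e"

lemma noncrossing_box_segments: "noncrossing_segments (map (box_segment b) (box_edges b))"
  by (cases b; simp add: box_edges_def box_segment_def box_clauses.simps box_coords_nth; code_simp)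

lemma length_box_coords: "length (box_coords b) = 108"
  by (cases b) (simp_all add: box_coords.simps)

lemma distinct_box_coords: "distinct (box_coords b)"
  by (cases b; simp add: box_coords.simps)

lemma box_coords_bounds: "list_all (\<lambda>(x, y). x \<in> {0..2400} \<and> y \<in> {0..2400}) (box_coords b)"
  by (cases b; simp add: box_coords.simps)

lemma box_port_coords:
  "box_coords b ! 0 = (800, 2400)" "box_coords b ! Suc 0 = (1600, 2400)" "box_coords b ! 2 = (2400, 1600)"
  "box_coords b ! 3 = (2400, 800)" "box_coords b ! 4 = (1600, 0)" "box_coords b ! 5 = (800, 0)"
  "box_coords b ! 6 = (0, 800)" "box_coords b ! 7 = (0, 1600)"
  by (cases b; simp add: box_coords_nth)+

lemma set_box_edges:
  "set (box_edges b) =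
     (\<Union>i<54. Pair (2 * i) ` set (box_clauses b ! i)) \<union> {(0, 1), (2, 3), (4, 5), (6, 7)}"
proof -
  have "set (List.enumerate 0 (box_clauses b)) = (\<lambda>i. (i, box_clauses b ! i)) ` {..<54}"
    by (auto simp: in_set_enumerate_eq length_box_clauses image_iff)
  then show ?thesis by (simp add: box_edges_def)
qed

lemma box_edge_if_nbr:
  assumes "k < 108" "j \<in> set (box_nbrs b k)"
  shows "\<exists>e\<in>set (box_edges b). ends e = {k, j}"
proof -
  obtain i l where il: "i < 54" "l \<in> set (box_clauses b ! i)" "{2 * i, l} = {k, j}"
    using assms by (auto simp: in_box_nbrs_iff)
  have "(2 * i, l) \<in> set (box_edges b)" unfolding set_box_edges using il(1,2) by blast
  then show ?thesis using il(3) by (intro bexI[of _ "(2 * i, l)"]) (simp_all add: ends_def)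
qed

lemma box_edge_opposite:
  assumes "p < 8"
  shows "\<exists>e\<in>set (box_edges b). ends e = {p, opposite p}"
proof -
  have "p \<in> {0, 1, 2, 3, 4, 5, 6, 7}" using assms by auto
  then show ?thesis unfolding set_box_edges ends_def
    by (elim insertE emptyE) (auto simp: opposite_def insert_commute)
qed

lemma box_edges_less:
  assumes "(k, j) \<in> set (box_edges b)"
  shows "k < 108 \<and> j < 108"
  using assms unfolding set_box_edges by (auto dest: in_box_clauseD)

lemma box_coord_in_square:
  assumes "k < 108"
  shows "fst (box_coords b ! k) \<in> {0..2400}" "snd (box_coords b ! k) \<in> {0..2400}"
  using box_coords_bounds[of b] assms by (auto simp: list_all_length length_box_coords case_prod_beta)

lemma inj_on_box_coords: "inj_on ((!) (box_coords b)) {..<108}"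
  by (rule inj_on_nth[OF distinct_box_coords]) (simp add: length_box_coords)

lemma box_edges_meet:
  assumes "e \<in> set (box_edges b)" "f \<in> set (box_edges b)" "ends e \<noteq> ends f"
  shows "segment_set (box_segment b e) \<inter> segment_set (box_segment b f) \<subseteq>
    (\<lambda>k. complex_of_point (box_coords b ! k)) ` (ends e \<inter> ends f)"
proof -
  have less: "ends e \<subseteq> {..<108}" "ends f \<subseteq> {..<108}"
    using box_edges_less[of "fst e" "snd e" b] box_edges_less[of "fst f" "snd f" b] assms(1,2)
    by (simp_all add: ends_def)
  have ends: "ends (box_segment b e) = (!) (box_coords b) ` ends e" for e
    by (simp add: ends_def box_segment_def)
  have "ends (box_segment b e) \<noteq> ends (box_segment b f)"
    using inj_on_image_eq_iff[OF inj_on_box_coords less] assms(3) by (simp add: ends)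
  with assms(1,2) have "meet_in_ends (box_segment b e) (box_segment b f)"
    by (intro noncrossing_segments_meet_in_ends[OF noncrossing_box_segments]) auto
  then show ?thesis
    by (simp add: meet_in_ends_def ends image_image inj_on_image_Int[OF inj_on_box_coords less, symmetric])
qed

section \<open>The grid\<close>

type_synonym vertex = "nat \<times> nat \<times> nat"

text \<open>
  Vertex \<open>(r, c, k)\<close> is vertex \<open>k\<close> of the box in row \<open>r\<close> and column \<open>c\<close>. The boxes of a row
  pass \<open>h\<close> on from left to right, those of a column pass \<open>v\<close> on from top to bottom.
\<close>

locale grid =
  fixes R C :: nat and type :: "nat \<Rightarrow> nat \<Rightarrow> box"
  assumes R_pos: "R > 0" and C_gt_1: "C > 1"
    and Border_iff: "c < C \<Longrightarrow> type r c = Border \<longleftrightarrow> c = 0 \<or> c = C - 1"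
begin

definition grid_verts :: "vertex set" where
  "grid_verts = {..<R} \<times> {..<C} \<times> {..<108}"

text \<open>The port that faces \<open>p\<close>, or the other port on the same side at the border of the grid.\<close>

fun partner :: "vertex \<Rightarrow> vertex" where
  "partner (r, c, p) =
     (if p < 2 then if r = 0 then (r, c, opposite p) else (r - 1, c, 5 - p)
      else if p < 4 then if Suc c = C then (r, c, opposite p) else (r, Suc c, 9 - p)
      else if p < 6 then if Suc r = R then (r, c, opposite p) else (Suc r, c, 5 - p)
      else if c = 0 then (r, c, opposite p) else (r, c - 1, 9 - p))"

declare partner.simps [simp del]

fun nbrs :: "vertex \<Rightarrow> vertex list" where
  "nbrs (r, c, k) =
     map (\<lambda>j. (r, c, j)) (box_nbrs (type r c) k) @ (if k < 8 then [partner (r, c, k)] else [])"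

declare nbrs.simps [simp del]

definition grid_graph :: "vertex pair_pre_digraph" where
  "grid_graph = \<lparr>pverts = grid_verts, parcs = {(u, v). u \<in> grid_verts \<and> v \<in> set (nbrs u)}\<rparr>"

lemma in_grid_verts_iff: "(r, c, k) \<in> grid_verts \<longleftrightarrow> r < R \<and> c < C \<and> k < 108"
  by (simp add: grid_verts_def)

lemma less_8_cases:
  "p < 8 \<longleftrightarrow> p = 0 \<or> p = 1 \<or> p = 2 \<or> p = 3 \<or> p = 4 \<or> p = 5 \<or> p = 6 \<or> p = (7 :: nat)"
  by auto

lemma partner_facts:
  assumes "r < R" "c < C" "p < 8"
  obtains r' c' p' where "partner (r, c, p) = (r', c', p')" "(r', c', p') \<in> grid_verts" "p' < 8"
    "even p' \<longleftrightarrow> odd p" "partner (r', c', p') = (r, c, p)" "r' = r \<Longrightarrow> c' = c \<Longrightarrow> p' = opposite p"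
proof -
  have "case partner (r, c, p) of (r', c', p') \<Rightarrow> (r', c', p') \<in> grid_verts \<and> p' < 8 \<and> (even p' \<longleftrightarrow> odd p) \<and>
      partner (r', c', p') = (r, c, p) \<and> (r' = r \<longrightarrow> c' = c \<longrightarrow> p' = opposite p)"
    using assms(3)[unfolded less_8_cases] assms(1,2) R_pos C_gt_1
    by (elim disjE; auto simp: partner.simps opposite_def in_grid_verts_iff)
  then show thesis using that by (auto split: prod.splits)
qed

lemma nbrs_cases:
  assumes "u \<in> grid_verts" "v \<in> set (nbrs u)"
  obtains (inside) r c k j where "u = (r, c, k)" "v = (r, c, j)" "j \<in> set (box_nbrs (type r c) k)"
  | (outside) r c p where "u = (r, c, p)" "v = partner (r, c, p)" "p < 8"
  using assms by (cases u rule: nbrs.cases) (auto simp: nbrs.simps split: if_splits)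

lemma nbrs_facts:
  assumes u: "u \<in> grid_verts" and v: "v \<in> set (nbrs u)"
  shows "v \<in> grid_verts" "u \<in> set (nbrs v)" "even (snd (snd v)) \<longleftrightarrow> odd (snd (snd u))"
proof -
  from u v have "v \<in> grid_verts \<and> u \<in> set (nbrs v) \<and> (even (snd (snd v)) \<longleftrightarrow> odd (snd (snd u)))"
  proof (cases rule: nbrs_cases)
    case (inside r c k j)
    then show ?thesis
      using u box_nbr_facts[of k j "type r c"] by (simp add: in_grid_verts_iff nbrs.simps)
  next
    case (outside r c p)
    moreover from this obtain r' c' p' where "partner (r, c, p) = (r', c', p')" "(r', c', p') \<in> grid_verts"
      "p' < 8" "even p' \<longleftrightarrow> odd p" "partner (r', c', p') = (r, c, p)"
      using u by (auto simp: in_grid_verts_iff elim: partner_facts[of r c p])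
    ultimately show ?thesis by (simp add: nbrs.simps)
  qed
  then show "v \<in> grid_verts" "u \<in> set (nbrs v)" "even (snd (snd v)) \<longleftrightarrow> odd (snd (snd u))" by simp_all
qed

lemma distinct_nbrs:
  assumes "u \<in> grid_verts"
  shows "distinct (nbrs u)" "length (nbrs u) = 3"
proof -
  obtain r c k where u: "u = (r, c, k)" "r < R" "c < C" "k < 108"
    using assms by (auto simp: grid_verts_def)
  have "partner (r, c, k) \<notin> (\<lambda>j. (r, c, j)) ` set (box_nbrs (type r c) k)" if k: "k < 8"
  proof
    assume "partner (r, c, k) \<in> (\<lambda>j. (r, c, j)) ` set (box_nbrs (type r c) k)"
    then obtain j where j: "partner (r, c, k) = (r, c, j)" "j \<in> set (box_nbrs (type r c) k)" by blast
    then have "j = opposite k" using partner_facts[OF u(2,3) k] by (metis prod.inject)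
    then show False using box_nbr_facts(4)[OF u(4) j(2) k] by simp
  qed
  then show "distinct (nbrs u)" "length (nbrs u) = 3"
    using distinct_box_nbrs[OF u(4)] length_box_nbrs[OF u(4)]
    by (simp_all add: u(1) nbrs.simps distinct_map inj_on_def)
qed

lemma pverts_grid_graph [simp]: "pverts grid_graph = grid_verts"
  by (simp add: grid_graph_def)

lemma arc_iff: "(u, v) \<in> parcs grid_graph \<longleftrightarrow> u \<in> grid_verts \<and> v \<in> set (nbrs u)"
  by (simp add: grid_graph_def)

lemma neighbors_grid_graph: "u \<in> grid_verts \<Longrightarrow> neighbors grid_graph u = set (nbrs u)"
  by (simp add: neighbors_def arc_iff)

lemma pair_graph_grid_graph: "pair_graph grid_graph"
proof (rule pair_graphI)
  show "finite (pverts grid_graph)" by (simp add: grid_verts_def)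
  show "parcs grid_graph \<subseteq> pverts grid_graph \<times> pverts grid_graph" using nbrs_facts(1) by (auto simp: arc_iff)
  show "(v, u) \<in> parcs grid_graph" if "(u, v) \<in> parcs grid_graph" for u v
    using that nbrs_facts(1,2)[of u v] by (simp add: arc_iff)
  show "(v, v) \<notin> parcs grid_graph" for v
    using nbrs_facts(3)[of v v] by (auto simp: arc_iff)
qed

sublocale regular_pair_graph grid_graph 3
proof -
  have "card (set (nbrs u)) = 3" if "u \<in> grid_verts" for u
    using distinct_nbrs[OF that] by (simp add: distinct_card)
  then have "regular_graph 3 grid_graph"
    by (simp add: regular_graph_def out_degree_eq_card_neighbors neighbors_grid_graph)
  then show "regular_pair_graph grid_graph 3"
    by (intro regular_pair_graph.intro pair_graph_grid_graph regular_pair_graph_axioms.intro) simp_all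
qed

lemma bipartite_grid_graph: "bipartite grid_graph"
  unfolding bipartite_def
proof (intro exI)
  show "\<forall>(u, v)\<in>parcs grid_graph. even (snd (snd u)) \<noteq> even (snd (snd v))"
    using nbrs_facts(3) by (auto simp: arc_iff)
qed

lemma grid_verts_nonempty: "grid_verts \<noteq> {}"
proof -
  have "(0, 0, 0) \<in> grid_verts" using R_pos C_gt_1 by (simp add: in_grid_verts_iff)
  then show ?thesis by blast
qed

lemma exactly_one_iff_card:
  "distinct xs \<Longrightarrow> exactly_one (map (\<lambda>x. x \<in> S) xs) \<longleftrightarrow> card (set xs \<inter> S) = 1"
proof (induction xs)
  case (Cons x xs)
  then show ?case by (cases "x \<in> S") (auto simp: exactly_one.simps list_all_iff)
qed (simp add: exactly_one.simps)

lemma nbr_count_eq_1_iff: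
  assumes "(r, c, k) \<in> grid_verts"
  shows "nbr_count grid_graph S (r, c, k) = 1 \<longleftrightarrow>
    exact_at (type r c) (\<lambda>j. (r, c, j) \<in> S) (\<lambda>p. partner (r, c, p) \<in> S) k"
  using exactly_one_iff_card[OF distinct_nbrs(1)[OF assms], of S]
  by (simp add: nbr_count_def neighbors_grid_graph[OF assms] exact_at_def nbrs.simps comp_def
      split: if_splits)

subsection \<open>Exact covers yield satisfying assignments\<close>

definition satisfies_row :: "(nat \<Rightarrow> bool) \<Rightarrow> nat \<Rightarrow> bool" where
  "satisfies_row v r \<longleftrightarrow> (\<exists>c<C. literal_value (type r c) (v c))"

text \<open>In an exact cover, all vertices that are connected within a box are good, or none is.\<close>

definition good :: "vertex set \<Rightarrow> vertex \<Rightarrow> bool" where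
  "good S u \<longleftrightarrow> nbr_count grid_graph S u = (if even (snd (snd u)) then 1 else 0)"

context
  fixes S assumes exact: "exact_cover grid_graph S"
begin

lemma good_nbr_iff:
  assumes "u \<in> grid_verts" "v \<in> set (nbrs u)"
  shows "good S v \<longleftrightarrow> good S u"
proof -
  have "nbr_count grid_graph S u \<le> 1" "nbr_count grid_graph S v \<le> 1"
    "nbr_count grid_graph S u \<noteq> nbr_count grid_graph S v"
    using exact assms nbrs_facts(1)[OF assms] nbr_separatingD[of grid_graph S u v]
    by (auto simp: exact_cover_def arc_iff)
  then show ?thesis using nbrs_facts(3)[OF assms] by (auto simp: good_def)
qed

lemma good_box_nbr_iff:
  assumes "r < R" "c < C" "k < 108" "j \<in> set (box_nbrs (type r c) k)"
  shows "good S (r, c, j) \<longleftrightarrow> good S (r, c, k)"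
  using assms by (intro good_nbr_iff) (auto simp: in_grid_verts_iff nbrs.simps)

lemma good_component_iff:
  assumes "r < R" "c < C" "joined ((!) (box_clauses (type r c))) (box_clauses (type r c) ! i) is"
    and "i < 54" "set is \<subseteq> {..<54}" "i' \<in> set is"
  shows "good S (r, c, 2 * i') \<longleftrightarrow> good S (r, c, 2 * i)"
proof -
  let ?b = "type r c"
  have clause: "good S (r, c, k) \<longleftrightarrow> good S (r, c, 2 * j)" if "j < 54" "k \<in> set (box_clauses ?b ! j)" for j k
    using that assms(1,2) by (intro good_box_nbr_iff) (auto simp: box_nbrs_def)
  have "i' < 54" using assms(5,6) by auto
  then have "box_clauses ?b ! i' \<noteq> []"
    using clause_ok_nth[of i' ?b] by (auto simp: clause_ok_def split: if_splits)
  then obtain k where k: "k \<in> set (box_clauses ?b ! i')" by (meson list.set_sel(1))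
  have "good S (r, c, k) \<longleftrightarrow> good S (r, c, 2 * i)"
  proof (rule joined_propagates[OF assms(3) _ _ assms(6) k])
    show "good S (r, c, l) \<longleftrightarrow> good S (r, c, 2 * i)" if "l \<in> set (box_clauses ?b ! i)" for l
      using clause[OF assms(4) that] .
    show "good S (r, c, l') \<longleftrightarrow> good S (r, c, 2 * i)"
      if "j \<in> set is" "l \<in> set (box_clauses ?b ! j)" "l' \<in> set (box_clauses ?b ! j)"
        "good S (r, c, l) \<longleftrightarrow> good S (r, c, 2 * i)" for j l l'
      using that assms(5) clause[of j l] clause[of j l'] by auto
  qed
  then show ?thesis using clause[OF \<open>i' < 54\<close> k] by simp
qed

lemma exact_at_clause_if_good:
  assumes "(r, c, 2 * i) \<in> grid_verts" "good S (r, c, 2 * i)"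
  shows "exact_at (type r c) (\<lambda>j. (r, c, j) \<in> S) (\<lambda>p. partner (r, c, p) \<in> S) (2 * i)"
  using assms nbr_count_eq_1_iff[OF assms(1), of S] by (simp add: good_def)

lemma exact_at_variable_if_not_good:
  assumes "(r, c, 2 * i + 1) \<in> grid_verts" "\<not> good S (r, c, 2 * i + 1)"
  shows "exact_at (type r c) (\<lambda>j. (r, c, j) \<in> S) (\<lambda>p. partner (r, c, p) \<in> S) (2 * i + 1)"
proof -
  have "nbr_count grid_graph S (r, c, 2 * i + 1) \<le> 1" using exact assms(1) by (simp add: exact_cover_def)
  then show ?thesis
    using assms(2) nbr_count_eq_1_iff[OF assms(1), of S] by (simp add: good_def)
qed

lemma right_variable_good_iff:
  assumes "r < R" "i \<in> set right_component"
  shows "good S (r, 0, 2 * i + 1) \<longleftrightarrow> good S (r, 0, 2)"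
proof -
  have Border: "type r 0 = Border" and "0 < C" using Border_iff[of 0 r] C_gt_1 by simp_all
  have component: "set right_component \<subseteq> {..<54}" by (simp add: right_component_def)
  obtain i' where i': "i' \<in> set right_component" "2 * i + 1 \<in> set (box_clauses Border ! i')"
    using right_variables_occur assms(2) unfolding list_all_iff list_ex_iff by blast
  then have "i' < 54" using component by auto
  then have "good S (r, 0, 2 * i + 1) \<longleftrightarrow> good S (r, 0, 2 * i')"
    using assms(1) \<open>0 < C\<close> i'(2) Border by (intro good_box_nbr_iff) (auto simp: box_nbrs_def)
  also have "\<dots> \<longleftrightarrow> good S (r, 0, 2)"
    using good_component_iff[OF assms(1) \<open>0 < C\<close>, of 1] right_joined component i'(1) Border by simp
  finally show ?thesis .
qed

lemma right_component_good:
  assumes "r < R"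
  shows "good S (r, 0, 2)"
proof (rule ccontr)
  assume "\<not> good S (r, 0, 2)"
  then have "exact_at (type r 0) (\<lambda>j. (r, 0, j) \<in> S) (\<lambda>p. partner (r, 0, p) \<in> S) (2 * i + 1)"
    if "i \<in> set right_component" for i
    using that assms C_gt_1 right_variable_good_iff[OF assms that]
    by (intro exact_at_variable_if_not_good) (auto simp: in_grid_verts_iff right_component_def)
  then show False
    using right_variables_not_exact Border_iff[of 0 r] C_gt_1 unfolding list_all_iff by fastforce
qed

lemma right_component_exit:
  assumes "r < R"
  shows "(r, 0, 3) \<notin> S" "good S (r, 0, 3)"
proof -
  have Border: "type r 0 = Border" and "0 < C" using Border_iff[of 0 r] C_gt_1 by simp_all
  have component: "set right_component \<subseteq> {..<54}" by (simp add: right_component_def)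
  have "exact_at Border (\<lambda>j. (r, 0, j) \<in> S) (\<lambda>p. partner (r, 0, p) \<in> S) (2 * i)"
    if "i \<in> set right_component" for i
  proof (rule exact_at_clause_if_good[of r 0, unfolded Border])
    show "(r, 0, 2 * i) \<in> grid_verts" using that component assms \<open>0 < C\<close> by (auto simp: in_grid_verts_iff)
    show "good S (r, 0, 2 * i)"
      using good_component_iff[OF assms \<open>0 < C\<close>, of 1] right_joined component that Border
        right_component_good[OF assms] by simp
  qed
  then show "(r, 0, 3) \<notin> S"
    by (intro right_component_value) (simp only: list_all_iff, blast)
  show "good S (r, 0, 3)"
    using right_variable_good_iff[OF assms, of 1] right_component_good[OF assms]
    by (simp add: right_component_def)
qed

lemma inner_good_iff:
  assumes "r < R" "c < C" "type r c \<noteq> Border" "k < 108"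
  shows "good S (r, c, k) \<longleftrightarrow> good S (r, c, 6)"
proof -
  have clause: "good S (r, c, 2 * i) \<longleftrightarrow> good S (r, c, 6)" if "i < 54" for i
    using good_component_iff[OF assms(1,2) inner_joined[OF assms(3)]] that set_inner_component by simp
  show ?thesis
  proof (cases "even k")
    case True
    then show ?thesis using clause assms(4) by (auto elim!: evenE)
  next
    case False
    have "box_nbrs (type r c) k \<noteq> []"
      using length_box_nbrs[OF assms(4), of "type r c"] by (auto split: if_splits)
    then obtain j where j: "j \<in> set (box_nbrs (type r c) k)" by (meson list.set_sel(1))
    then have "even j" "j < 108" using box_nbr_facts[OF assms(4) j] False by simp_all
    then show ?thesis using clause good_box_nbr_iff[OF assms(1,2,4) j] by (auto elim!: evenE)
  qed
qed

lemma good_enter_iff: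
  assumes "r < R" "Suc c < C"
  shows "good S (r, Suc c, 6) \<longleftrightarrow> good S (r, c, 3)"
  using assms by (intro good_nbr_iff) (simp_all add: in_grid_verts_iff nbrs.simps partner.simps)

lemma good_enter:
  assumes "r < R" "Suc c < C"
  shows "good S (r, Suc c, 6)"
  using assms(2)
proof (induction c)
  case 0
  then show ?case using good_enter_iff[OF assms(1)] right_component_exit(2)[OF assms(1)] by simp
next
  case (Suc c)
  then have "type r (Suc c) \<noteq> Border" using Border_iff[of "Suc c" r] by simp
  then show ?case using good_enter_iff[OF assms(1)] inner_good_iff[OF assms(1), of "Suc c" 3] Suc by simp
qed

lemma inner_values:
  assumes "r < R" "0 < c" "c < C - 1"
  shows "(r, c, 5) \<in> S \<longleftrightarrow> partner (r, c, 0) \<in> S"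
    "(r, c, 3) \<in> S \<Longrightarrow> partner (r, c, 6) \<in> S \<or> literal_value (type r c) (partner (r, c, 0) \<in> S)"
proof -
  have inner: "type r c \<noteq> Border" and "c < C" using Border_iff[of c r] assms by simp_all
  have "good S (r, c, 6)" using good_enter[OF assms(1), of "c - 1"] assms by simp
  then have "good S (r, c, k)" if "k < 108" for k
    using inner_good_iff[OF assms(1) \<open>c < C\<close> inner that] by blast
  then have "list_all (\<lambda>i. exact_at (type r c) (\<lambda>j. (r, c, j) \<in> S) (\<lambda>p. partner (r, c, p) \<in> S) (2 * i))
      inner_component"
    using assms(1) \<open>c < C\<close>
    by (auto simp: list_all_iff set_inner_component in_grid_verts_iff intro!: exact_at_clause_if_good)
  from inner_box_values[OF inner this]
  show "(r, c, 5) \<in> S \<longleftrightarrow> partner (r, c, 0) \<in> S"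
    "(r, c, 3) \<in> S \<Longrightarrow> partner (r, c, 6) \<in> S \<or> literal_value (type r c) (partner (r, c, 0) \<in> S)"
    by blast+
qed

lemma left_component_entry:
  assumes "r < R"
  shows "(r, C - 2, 3) \<in> S"
proof -
  let ?c = "C - 1"
  have Border: "type r ?c = Border" and "?c < C" using Border_iff[of ?c r] C_gt_1 by simp_all
  have component: "set left_component \<subseteq> {..<54}" by (simp add: left_component_def)
  have "Suc (C - 2) = ?c" using C_gt_1 by simp
  then have "good S (r, ?c, 6)" using good_enter[OF assms, of "C - 2"] C_gt_1 by simp
  then have "good S (r, ?c, 2 * i)" if "i \<in> set left_component" for i
    using good_component_iff[OF assms \<open>?c < C\<close>, of 3] left_joined component that Border by simp
  then have "list_all (\<lambda>i. exact_at Border (\<lambda>j. (r, ?c, j) \<in> S) (\<lambda>p. partner (r, ?c, p) \<in> S) (2 * i))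
      left_component"
    using exact_at_clause_if_good[of r ?c] Border assms \<open>?c < C\<close> component
    by (auto simp: list_all_iff in_grid_verts_iff)
  then have "partner (r, ?c, 6) \<in> S" by (rule left_component_value)
  moreover have "partner (r, ?c, 6) = (r, C - 2, 3)" using C_gt_1 by (simp add: partner.simps)
  ultimately show ?thesis by simp
qed

lemma column_value:
  assumes "r < R" "0 < c" "c < C - 1"
  shows "partner (r, c, 0) \<in> S \<longleftrightarrow> partner (0, c, 0) \<in> S"
  using assms(1)
proof (induction r)
  case (Suc r)
  have "partner (Suc r, c, 0) = (r, c, 5)" by (simp add: partner.simps)
  then show ?case using Suc inner_values(1)[of r c] assms(2,3) by simp
qed simp

lemma exact_cover_satisfies_row:
  assumes "r < R"
  shows "satisfies_row (\<lambda>c. partner (0, c, 0) \<in> S) r"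
proof (rule ccontr)
  assume unsatisfied: "\<not> satisfies_row (\<lambda>c. partner (0, c, 0) \<in> S) r"
  have "(r, c, 3) \<notin> S" if "c < C - 1" for c
    using that
  proof (induction c)
    case (Suc c)
    have "partner (r, Suc c, 6) = (r, c, 3)" by (simp add: partner.simps)
    then show ?case
      using Suc unsatisfied inner_values(2)[OF assms, of "Suc c"] column_value[OF assms, of "Suc c"]
      by (auto simp: satisfies_row_def)
  qed (use right_component_exit(1)[OF assms] in simp)
  then show False using left_component_entry[OF assms] C_gt_1 by simp
qed

end

subsection \<open>Satisfying assignments yield exact covers\<close>

context
  fixes v assumes satisfies: "\<And>r. r < R \<Longrightarrow> satisfies_row v r"
begin

text \<open>The value \<open>h\<close> that enters the box from the left.\<close>

definition row_value :: "nat \<Rightarrow> nat \<Rightarrow> bool" where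
  "row_value r c \<longleftrightarrow> c = 0 \<or> c < C \<and> (\<exists>c'<c. literal_value (type r c') (v c'))"

definition solution :: "nat \<Rightarrow> nat \<Rightarrow> nat list" where
  "solution r c = box_solution (type r c) (v c) (row_value r c) (row_value r (Suc c))"

definition cover :: "vertex set" where
  "cover = {(r, c, k) \<in> grid_verts. k \<in> set (solution r c)}"

lemma row_value_border:
  assumes "r < R" "c < C" "type r c = Border"
  shows "row_value r c" "\<not> row_value r (Suc c)"
proof -
  have "c = 0 \<or> c = C - 1" using Border_iff assms(2,3) by simp
  moreover obtain c' where c': "c' < C" "literal_value (type r c') (v c')"
    using satisfies[OF assms(1)] by (auto simp: satisfies_row_def)
  moreover from this have "c' \<noteq> C - 1" using Border_iff[of "C - 1" r] C_gt_1 by auto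
  ultimately show "row_value r c" using assms(2) by (auto simp: row_value_def)
  show "\<not> row_value r (Suc c)"
    using \<open>c = 0 \<or> c = C - 1\<close> assms(3) C_gt_1 by (auto simp: row_value_def)
qed

lemma solution_ok_solution:
  assumes "r < R" "c < C"
  shows "solution_ok (type r c) (v c) (row_value r c) (row_value r (Suc c)) (solution r c)"
proof (cases "type r c = Border")
  case True
  then show ?thesis
    using row_value_border[OF assms] border_box_solution[of "v c"] by (simp add: solution_def)
next
  case False
  then have "Suc c < C" using Border_iff[OF assms(2), of r] assms(2) by auto
  then show ?thesis
    unfolding solution_def using False Border_iff[OF assms(2), of r]
    by (intro inner_box_solution) (auto simp: row_value_def less_Suc_eq)
qed

lemma in_cover_iff: "(r, c, k) \<in> cover \<longleftrightarrow> r < R \<and> c < C \<and> k < 108 \<and> k \<in> set (solution r c)"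
  by (simp add: cover_def in_grid_verts_iff)

lemma odd_if_in_cover: "(r, c, k) \<in> cover \<Longrightarrow> odd k"
  using solution_ok_solution[of r c] by (auto simp: in_cover_iff solution_ok_def list_all_iff)

lemma cover_port_values:
  assumes "r < R" "c < C"
  shows "(r, c, 1) \<in> cover \<longleftrightarrow> v c" "(r, c, 5) \<in> cover \<longleftrightarrow> v c"
    "(r, c, 3) \<in> cover \<longleftrightarrow> row_value r (Suc c)" "(r, c, 7) \<in> cover \<longleftrightarrow> row_value r c"
  using solution_ok_solution[OF assms] assms by (simp_all add: in_cover_iff solution_ok_def)

lemma partner_in_cover_iff:
  assumes "r < R" "c < C" "p < 8" "even p"
  shows "partner (r, c, p) \<in> cover \<longleftrightarrow>
    (if p = 2 then row_value r (Suc c) else if p = 6 then row_value r c else v c)"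
proof -
  have "p = 0 \<or> p = 2 \<or> p = 4 \<or> p = 6" using assms(3,4) unfolding less_8_cases by auto
  then show ?thesis
    using assms(1,2) cover_port_values[of r c] cover_port_values[of "r - 1" c]
      cover_port_values[of "Suc r" c]
      cover_port_values[of r "Suc c"] cover_port_values[of r "c - 1"]
    by (elim disjE) (auto simp: partner.simps opposite_def)
qed

lemma exact_at_cong:
  assumes "\<And>j. j \<in> set (box_nbrs b k) \<Longrightarrow> s j = s' j" "k < 8 \<Longrightarrow> e k = e' k"
  shows "exact_at b s e k = exact_at b s' e' k"
  using assms by (simp add: exact_at_def cong: map_cong)

lemma nbr_count_cover:
  assumes "(r, c, k) \<in> grid_verts"
  shows "nbr_count grid_graph cover (r, c, k) = (if even k then 1 else 0)"
proof (cases "even k")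
  case True
  have rc: "r < R" "c < C" and k: "k < 108" using assms by (simp_all add: in_grid_verts_iff)
  let ?e = "\<lambda>p. if p = 2 then row_value r (Suc c) else if p = 6 then row_value r c else v c"
  obtain i where i: "k = 2 * i" "i < 54" using True k by (auto elim!: evenE)
  then have "exact_at (type r c) (\<lambda>j. j \<in> set (solution r c)) ?e k"
    using solution_ok_solution[OF rc] by (simp add: solution_ok_def list_all_iff)
  moreover have "exact_at (type r c) (\<lambda>j. j \<in> set (solution r c)) ?e k =
      exact_at (type r c) (\<lambda>j. (r, c, j) \<in> cover) (\<lambda>p. partner (r, c, p) \<in> cover) k"
  proof (rule exact_at_cong)
    show "(j \<in> set (solution r c)) = ((r, c, j) \<in> cover)" if "j \<in> set (box_nbrs (type r c) k)" for j
      using box_nbr_facts(1)[OF k that] rc by (simp add: in_cover_iff)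
    show "?e k = (partner (r, c, k) \<in> cover)" if "k < 8"
      using partner_in_cover_iff[OF rc that True] by simp
  qed
  ultimately show ?thesis using True nbr_count_eq_1_iff[OF assms] by simp
next
  case False
  have "u \<notin> cover" if "u \<in> set (nbrs (r, c, k))" for u
    using nbrs_facts(3)[OF assms that] False odd_if_in_cover[of "fst u" "fst (snd u)" "snd (snd u)"] by auto
  then have "set (nbrs (r, c, k)) \<inter> cover = {}" by blast
  then show ?thesis using False by (simp add: nbr_count_def neighbors_grid_graph[OF assms])
qed

lemma exact_cover_cover: "exact_cover grid_graph cover"
proof -
  have count: "nbr_count grid_graph cover u = (if even (snd (snd u)) then 1 else 0)" if "u \<in> grid_verts" for u
    using nbr_count_cover[of "fst u" "fst (snd u)" "snd (snd u)"] that by simp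
  have "nbr_count grid_graph cover u \<noteq> nbr_count grid_graph cover v" if "(u, v) \<in> parcs grid_graph" for u v
    using that nbrs_facts(1,3)[of u v] count[of u] count[of v] by (simp add: arc_iff)
  moreover have "cover \<subseteq> grid_verts" by (auto simp: cover_def)
  ultimately show ?thesis using count by (auto simp: exact_cover_def nbr_separating_def)
qed

end

theorem ex_exact_cover_iff: "(\<exists>S. exact_cover grid_graph S) \<longleftrightarrow> (\<exists>v. \<forall>r<R. satisfies_row v r)"
  using exact_cover_satisfies_row exact_cover_cover by meson

end

section \<open>A plane drawing of the grid\<close>

text \<open>
  The squares of the boxes are arranged with pitch 3000. The edges \<open>Inner\<close> lie in one square, whereas
  \<open>Across\<close> and \<open>Down\<close> join a port on the right or lower side to the facing port.
\<close>

datatype edge = Inner nat nat "nat \<times> nat" | Across nat nat nat | Down nat nat nat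

context grid
begin

definition origin :: "nat \<Rightarrow> nat \<Rightarrow> complex" where
  "origin r c = Complex (3000 * real c) (- 3000 * real r)"

fun point_of :: "vertex \<Rightarrow> complex" where
  "point_of (r, c, k) = origin r c + complex_of_point (box_coords (type r c) ! k)"

declare point_of.simps [simp del]

fun endpoints :: "edge \<Rightarrow> vertex \<times> vertex" where
  "endpoints (Inner r c e) = ((r, c, fst e), (r, c, snd e))"
| "endpoints (Across r c p) = ((r, c, p), (r, Suc c, 9 - p))"
| "endpoints (Down r c p) = ((r, c, p), (Suc r, c, 5 - p))"

fun valid_edge :: "edge \<Rightarrow> bool" where
  "valid_edge (Inner r c e) \<longleftrightarrow> r < R \<and> c < C \<and> e \<in> set (box_edges (type r c))"
| "valid_edge (Across r c p) \<longleftrightarrow> r < R \<and> Suc c < C \<and> p \<in> {2, 3}"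
| "valid_edge (Down r c p) \<longleftrightarrow> Suc r < R \<and> c < C \<and> p \<in> {4, 5}"

definition vertices :: "edge \<Rightarrow> vertex set" where
  "vertices e = ends (endpoints e)"

definition drawing :: "edge \<Rightarrow> complex set" where
  "drawing e = closed_segment (point_of (fst (endpoints e))) (point_of (snd (endpoints e)))"

lemma Re_point_of: "Re (point_of (r, c, k)) = 3000 * real c + of_int (fst (box_coords (type r c) ! k))"
  and Im_point_of: "Im (point_of (r, c, k)) = of_int (snd (box_coords (type r c) ! k)) - 3000 * real r"
  by (simp_all add: point_of.simps origin_def complex_of_point_def)

lemma point_of_in_square:
  assumes "k < 108"
  shows "3000 * real c \<le> Re (point_of (r, c, k))" "Re (point_of (r, c, k)) \<le> 3000 * real c + 2400"
    "- 3000 * real r \<le> Im (point_of (r, c, k))" "Im (point_of (r, c, k)) \<le> 2400 - 3000 * real r"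
  using box_coord_in_square[OF assms, of "type r c"] by (simp_all add: Re_point_of Im_point_of)

lemma inj_on_point_of: "inj_on point_of grid_verts"
proof (rule inj_onI)
  fix u v assume uv: "u \<in> grid_verts" "v \<in> grid_verts" "point_of u = point_of v"
  obtain r c k r' c' k' where eq: "u = (r, c, k)" "v = (r', c', k')" by (metis surj_pair)
  have k: "k < 108" "k' < 108" using uv(1,2) by (simp_all add: eq in_grid_verts_iff)
  have "real c < real c' + 1" "real c' < real c + 1" "real r < real r' + 1" "real r' < real r + 1"
    using point_of_in_square[OF k(1), where c = c and r = r]
      point_of_in_square[OF k(2), where c = c' and r = r'] uv(3)
    by (simp_all add: eq)
  then have box: "r = r'" "c = c'" by linarith+
  then have "box_coords (type r c) ! k = box_coords (type r c) ! k'"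
    using uv(3) injD[OF inj_complex_of_point] by (simp add: eq point_of.simps)
  then show "u = v" using inj_onD[OF inj_on_box_coords] k box by (simp add: eq)
qed

lemma arc_edge:
  assumes "(u, v) \<in> parcs grid_graph"
  obtains e where "valid_edge e" "vertices e = {u, v}"
proof -
  have u: "u \<in> grid_verts" "v \<in> set (nbrs u)" using assms by (simp_all add: arc_iff)
  then have "\<exists>e. valid_edge e \<and> vertices e = {u, v}"
  proof (cases rule: nbrs_cases)
    case (inside r c k j)
    then obtain e where "e \<in> set (box_edges (type r c))" "ends e = {k, j}"
      using u box_edge_if_nbr[of k j "type r c"] by (auto simp: in_grid_verts_iff)
    then show ?thesis
      using u inside by (intro exI[of _ "Inner r c e"]) (auto simp: in_grid_verts_iff vertices_def ends_def)
  next
    case (outside r c p)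
    obtain e where "e \<in> set (box_edges (type r c))" "ends e = {p, opposite p}"
      using box_edge_opposite[OF outside(3), of "type r c"] by blast
    then have border: ?thesis if "v = (r, c, opposite p)"
      using that u outside
      by (intro exI[of _ "Inner r c e"]) (auto simp: in_grid_verts_iff vertices_def ends_def)
    show ?thesis
    proof (cases "v = (r, c, opposite p)")
      case False
      let ?e = "if p < 2 then Down (r - 1) c (5 - p) else if p < 4 then Across r c p
        else if p < 6 then Down r c p else Across r (c - 1) (9 - p)"
      have "valid_edge ?e \<and> vertices ?e = {u, v}"
        using outside(3)[unfolded less_8_cases] outside(1,2) u False
        by (elim disjE; auto simp: partner.simps in_grid_verts_iff vertices_def ends_def split: if_splits)
      then show ?thesis by blast
    qed (rule border)
  qed
  then show thesis using that by blast
qed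

lemma drawing_Inner:
  "drawing (Inner r c e) = (+) (origin r c) ` segment_set (box_segment (type r c) e)"
  by (simp add: drawing_def segment_set_def box_segment_def point_of.simps closed_segment_translation)

lemma Inner_bounds:
  assumes "valid_edge (Inner r c e)" "z \<in> drawing (Inner r c e)"
  shows "3000 * real c \<le> Re z" "Re z \<le> 3000 * real c + 2400"
    "- 3000 * real r \<le> Im z" "Im z \<le> 2400 - 3000 * real r"
proof -
  have less: "fst e < 108" "snd e < 108"
    using assms(1) box_edges_less[of "fst e" "snd e" "type r c"] by simp_all
  have "z \<in> closed_segment (point_of (r, c, fst e)) (point_of (r, c, snd e))"
    using assms(2) by (simp add: drawing_def)
  from complex_segment_bounds[OF this]
  show "3000 * real c \<le> Re z" "Re z \<le> 3000 * real c + 2400"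
    "- 3000 * real r \<le> Im z" "Im z \<le> 2400 - 3000 * real r"
    using point_of_in_square[OF less(1), where c = c and r = r]
      point_of_in_square[OF less(2), where c = c and r = r] by linarith+
qed

lemma Across_bounds:
  assumes "valid_edge (Across r c p)" "z \<in> drawing (Across r c p)"
  shows "3000 * real c + 2400 \<le> Re z" "Re z \<le> 3000 * real c + 3000"
    "Im z = (if p = 2 then 1600 else 800) - 3000 * real r"
proof -
  have "z \<in> closed_segment (point_of (r, c, p)) (point_of (r, Suc c, 9 - p))"
    using assms(2) by (simp add: drawing_def)
  from complex_segment_bounds[OF this] assms(1)
  show "3000 * real c + 2400 \<le> Re z" "Re z \<le> 3000 * real c + 3000"
    "Im z = (if p = 2 then 1600 else 800) - 3000 * real r"
    by (auto simp: Re_point_of Im_point_of box_port_coords)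
qed

lemma Down_bounds:
  assumes "valid_edge (Down r c p)" "z \<in> drawing (Down r c p)"
  shows "- 3000 * real r - 600 \<le> Im z" "Im z \<le> - 3000 * real r"
    "Re z = 3000 * real c + (if p = 4 then 1600 else 800)"
proof -
  have "z \<in> closed_segment (point_of (r, c, p)) (point_of (Suc r, c, 5 - p))"
    using assms(2) by (simp add: drawing_def)
  from complex_segment_bounds[OF this] assms(1)
  show "- 3000 * real r - 600 \<le> Im z" "Im z \<le> - 3000 * real r"
    "Re z = 3000 * real c + (if p = 4 then 1600 else 800)"
    by (auto simp: Re_point_of Im_point_of box_port_coords)
qed

definition meet_in_vertices :: "edge \<Rightarrow> edge \<Rightarrow> bool" where
  "meet_in_vertices e f \<longleftrightarrow> drawing e \<inter> drawing f \<subseteq> point_of ` (vertices e \<inter> vertices f)"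

lemma meet_in_vertices_sym: "meet_in_vertices e f \<longleftrightarrow> meet_in_vertices f e"
  by (simp add: meet_in_vertices_def Int_commute)

lemma meet_in_vertices_if_disjoint:
  assumes "\<And>z. z \<in> drawing e \<Longrightarrow> z \<in> drawing f \<Longrightarrow> False"
  shows "meet_in_vertices e f"
  using assms by (auto simp: meet_in_vertices_def)

lemma Inner_Inner_same_box:
  assumes "valid_edge (Inner r c e)" "valid_edge (Inner r c f)" "ends e \<noteq> ends f"
  shows "meet_in_vertices (Inner r c e) (Inner r c f)"
proof -
  let ?b = "type r c"
  have "drawing (Inner r c e) \<inter> drawing (Inner r c f) =
      (+) (origin r c) ` (segment_set (box_segment ?b e) \<inter> segment_set (box_segment ?b f))"
    by (simp add: drawing_Inner image_Int)
  also have "\<dots> \<subseteq> (+) (origin r c) ` (\<lambda>k. complex_of_point (box_coords ?b ! k)) ` (ends e \<inter> ends f)"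
    using box_edges_meet[OF _ _ assms(3)] assms(1,2) by (intro image_mono) simp
  also have "\<dots> = point_of ` (\<lambda>k. (r, c, k)) ` (ends e \<inter> ends f)"
    by (simp add: image_image point_of.simps)
  also have "\<dots> \<subseteq> point_of ` (vertices (Inner r c e) \<inter> vertices (Inner r c f))"
    by (intro image_mono) (auto simp: vertices_def ends_def)
  finally show ?thesis by (simp add: meet_in_vertices_def)
qed

lemma vertex_on_Inner:
  assumes "valid_edge (Inner r c e)" "k < 108" "point_of (r, c, k) \<in> drawing (Inner r c e)"
  shows "(r, c, k) \<in> vertices (Inner r c e)"
proof -
  have rc: "r < R" "c < C" using assms(1) by simp_all
  have "box_nbrs (type r c) k \<noteq> []"
    using length_box_nbrs[OF assms(2), of "type r c"] by (auto split: if_splits)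
  then obtain j where "j \<in> set (box_nbrs (type r c) k)" by (meson list.set_sel(1))
  then obtain f where f: "f \<in> set (box_edges (type r c))" "k \<in> ends f"
    using box_edge_if_nbr[OF assms(2)] by (fastforce simp: ends_def)
  show ?thesis
  proof (cases "ends e = ends f")
    case True
    then show ?thesis using f(2) by (auto simp: vertices_def ends_def)
  next
    case False
    have "point_of (r, c, k) \<in> drawing (Inner r c f)" using f(2) by (auto simp: drawing_def ends_def)
    then have "point_of (r, c, k) \<in> point_of ` (vertices (Inner r c e) \<inter> vertices (Inner r c f))"
      using Inner_Inner_same_box[OF assms(1) _ False] f(1) rc assms(3)
      by (auto simp: meet_in_vertices_def)
    then obtain u where u: "point_of (r, c, k) = point_of u" "u \<in> vertices (Inner r c e)" by blast
    moreover have "u \<in> grid_verts" "(r, c, k) \<in> grid_verts"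
      using u(2) assms(1,2) box_edges_less[of "fst e" "snd e" "type r c"]
      by (auto simp: vertices_def ends_def in_grid_verts_iff)
    ultimately show ?thesis using inj_onD[OF inj_on_point_of] by metis
  qed
qed

lemma meet_in_vertices_if_point_of:
  assumes "valid_edge (Inner r c e)"
    and "\<And>z. z \<in> drawing (Inner r c e) \<Longrightarrow> z \<in> drawing f \<Longrightarrow>
      \<exists>k<108. z = point_of (r, c, k) \<and> (r, c, k) \<in> vertices f"
  shows "meet_in_vertices (Inner r c e) f"
  unfolding meet_in_vertices_def
proof
  fix z assume "z \<in> drawing (Inner r c e) \<inter> drawing f"
  with assms(2) obtain k where "k < 108" "z = point_of (r, c, k)" "(r, c, k) \<in> vertices f"
    and "z \<in> drawing (Inner r c e)" by blast
  then show "z \<in> point_of ` (vertices (Inner r c e) \<inter> vertices f)"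
    using vertex_on_Inner[OF assms(1)] by blast
qed

lemma Inner_Across:
  assumes "valid_edge (Inner r c e)" "valid_edge (Across r' c' p)"
  shows "meet_in_vertices (Inner r c e) (Across r' c' p)"
proof (rule meet_in_vertices_if_point_of[OF assms(1)])
  fix z assume "z \<in> drawing (Inner r c e)" "z \<in> drawing (Across r' c' p)"
  note inner = Inner_bounds[OF assms(1) this(1)] and across = Across_bounds[OF assms(2) this(2)]
  have "real r < real r' + 1" "real r' < real r + 1" "real c' < real c + 1" "real c \<le> real c' + 1"
    using inner across by (auto split: if_splits)
  then have row: "r = r'" and "c = c' \<or> c = Suc c'" by linarith+
  from this(2) show "\<exists>k<108. z = point_of (r, c, k) \<and> (r, c, k) \<in> vertices (Across r' c' p)"
  proof
    assume col: "c = c'"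
    then have "z = point_of (r, c, p)"
      using inner across row assms(2) by (auto simp: complex_eq_iff Re_point_of Im_point_of box_port_coords)
    then show ?thesis using row col assms(2) by (intro exI[of _ p]) (auto simp: vertices_def ends_def)
  next
    assume col: "c = Suc c'"
    then have "z = point_of (r, c, 9 - p)"
      using inner across row assms(2) by (auto simp: complex_eq_iff Re_point_of Im_point_of box_port_coords)
    then show ?thesis using row col assms(2) by (intro exI[of _ "9 - p"]) (auto simp: vertices_def ends_def)
  qed
qed

lemma Inner_Down:
  assumes "valid_edge (Inner r c e)" "valid_edge (Down r' c' p)"
  shows "meet_in_vertices (Inner r c e) (Down r' c' p)"
proof (rule meet_in_vertices_if_point_of[OF assms(1)])
  fix z assume "z \<in> drawing (Inner r c e)" "z \<in> drawing (Down r' c' p)"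
  note inner = Inner_bounds[OF assms(1) this(1)] and down = Down_bounds[OF assms(2) this(2)]
  have "real c < real c' + 1" "real c' < real c + 1" "real r' < real r + 1" "real r \<le> real r' + 1"
    using inner down by (auto split: if_splits)
  then have col: "c = c'" and "r = r' \<or> r = Suc r'" by linarith+
  from this(2) show "\<exists>k<108. z = point_of (r, c, k) \<and> (r, c, k) \<in> vertices (Down r' c' p)"
  proof
    assume row: "r = r'"
    then have "z = point_of (r, c, p)"
      using inner down col assms(2) by (auto simp: complex_eq_iff Re_point_of Im_point_of box_port_coords)
    then show ?thesis using row col assms(2) by (intro exI[of _ p]) (auto simp: vertices_def ends_def)
  next
    assume row: "r = Suc r'"
    then have "z = point_of (r, c, 5 - p)"
      using inner down col assms(2)
      by (auto simp: complex_eq_iff Re_point_of Im_point_of box_port_coords)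
    then show ?thesis using row col assms(2) by (intro exI[of _ "5 - p"]) (auto simp: vertices_def ends_def)
  qed
qed

lemma Inner_Inner:
  assumes "valid_edge (Inner r c e)" "valid_edge (Inner r' c' f)"
    "vertices (Inner r c e) \<noteq> vertices (Inner r' c' f)"
  shows "meet_in_vertices (Inner r c e) (Inner r' c' f)"
proof (cases "r = r' \<and> c = c'")
  case True
  moreover from this have "ends e \<noteq> ends f" using assms(3) by (auto simp: vertices_def ends_def)
  ultimately show ?thesis using Inner_Inner_same_box assms(1,2) by simp
next
  case False
  show ?thesis
  proof (rule meet_in_vertices_if_disjoint)
    fix z assume "z \<in> drawing (Inner r c e)" "z \<in> drawing (Inner r' c' f)"
    note bounds = Inner_bounds[OF assms(1) this(1)] Inner_bounds[OF assms(2) this(2)]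
    have "real c < real c' + 1" "real c' < real c + 1" "real r < real r' + 1" "real r' < real r + 1"
      using bounds by linarith+
    then have "r = r'" "c = c'" by linarith+
    then show False using False by simp
  qed
qed

lemma Across_Across:
  assumes "valid_edge (Across r c p)" "valid_edge (Across r' c' q)"
    "vertices (Across r c p) \<noteq> vertices (Across r' c' q)"
  shows "meet_in_vertices (Across r c p) (Across r' c' q)"
proof (rule meet_in_vertices_if_disjoint)
  fix z assume "z \<in> drawing (Across r c p)" "z \<in> drawing (Across r' c' q)"
  note bounds = Across_bounds[OF assms(1) this(1)] Across_bounds[OF assms(2) this(2)]
  have "real c < real c' + 1" "real c' < real c + 1" "real r < real r' + 1" "real r' < real r + 1"
    using bounds by (auto split: if_splits)
  then have box: "r = r'" "c = c'" by linarith+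
  then have "p = q" using bounds(3,6) assms(1,2) by (auto split: if_splits)
  then show False using assms(3) box by simp
qed

lemma Down_Down:
  assumes "valid_edge (Down r c p)" "valid_edge (Down r' c' q)"
    "vertices (Down r c p) \<noteq> vertices (Down r' c' q)"
  shows "meet_in_vertices (Down r c p) (Down r' c' q)"
proof (rule meet_in_vertices_if_disjoint)
  fix z assume "z \<in> drawing (Down r c p)" "z \<in> drawing (Down r' c' q)"
  note bounds = Down_bounds[OF assms(1) this(1)] Down_bounds[OF assms(2) this(2)]
  have "real c < real c' + 1" "real c' < real c + 1" "real r < real r' + 1" "real r' < real r + 1"
    using bounds by (auto split: if_splits)
  then have box: "r = r'" "c = c'" by linarith+
  then have "p = q" using bounds(3,6) assms(1,2) by (auto split: if_splits)
  then show False using assms(3) box by simp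
qed

lemma Across_Down:
  assumes "valid_edge (Across r c p)" "valid_edge (Down r' c' q)"
  shows "meet_in_vertices (Across r c p) (Down r' c' q)"
proof (rule meet_in_vertices_if_disjoint)
  fix z assume "z \<in> drawing (Across r c p)" "z \<in> drawing (Down r' c' q)"
  note bounds = Across_bounds[OF assms(1) this(1)] Down_bounds[OF assms(2) this(2)]
  have "real c < real c'" "real c' < real c + 1" using bounds by (auto split: if_splits)
  then have "c < c'" "c' < c + 1" by linarith+
  then show False by simp
qed

lemma edges_meet_in_vertices:
  assumes "valid_edge e" "valid_edge f" "vertices e \<noteq> vertices f"
  shows "meet_in_vertices e f"
proof (cases e)
  case (Inner r c g)
  then show ?thesis using assms Inner_Inner Inner_Across Inner_Down by (cases f) blast+
next
  case (Across r c p)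
  then show ?thesis
    using assms Inner_Across[THEN meet_in_vertices_sym[THEN iffD1]] Across_Across Across_Down
    by (cases f) blast+
next
  case (Down r c p)
  then show ?thesis
    using assms Inner_Down[THEN meet_in_vertices_sym[THEN iffD1]]
      Across_Down[THEN meet_in_vertices_sym[THEN iffD1]] Down_Down by (cases f) blast+
qed

lemma planar_grid_graph: "planar_graph grid_graph"
proof (rule planar_graph_straight_line)
  show "inj_on point_of (pverts grid_graph)" using inj_on_point_of by simp
  fix u v x y
  assume "(u, v) \<in> parcs grid_graph" "(x, y) \<in> parcs grid_graph" and distinct: "{u, v} \<noteq> {x, y}"
  then obtain e f where e: "valid_edge e" "vertices e = {u, v}" and f: "valid_edge f" "vertices f = {x, y}"
    by (metis arc_edge)
  have "drawing e = closed_segment (point_of u) (point_of v)"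
    "drawing f = closed_segment (point_of x) (point_of y)"
    using e(2) f(2) by (auto simp: drawing_def vertices_def ends_def doubleton_eq_iff closed_segment_commute)
  then show "closed_segment (point_of u) (point_of v) \<inter> closed_segment (point_of x) (point_of y) \<subseteq>
      point_of ` ({u, v} \<inter> {x, y})"
    using edges_meet_in_vertices[OF e(1) f(1)] distinct by (simp add: e f meet_in_vertices_def)
qed (rule neighbors_nonempty)

end

section \<open>The graph of the grid\<close>

lemma mult_add_div_mod:
  fixes a b n :: nat
  assumes "b < n"
  shows "(a * n + b) div n = a" "(a * n + b) mod n = b"
  using assms by auto

context grid
begin

definition code :: "vertex \<Rightarrow> nat" where
  "code = (\<lambda>(r, c, k). (r * C + c) * 108 + k)"

definition vertex_of :: "nat \<Rightarrow> vertex" where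
  "vertex_of u = (u div 108 div C, u div 108 mod C, u mod 108)"

definition numbered_graph :: "nat pair_pre_digraph" where
  "numbered_graph = relabel code grid_graph"

lemma vertex_of_code: "u \<in> grid_verts \<Longrightarrow> vertex_of (code u) = u"
  by (auto simp only: grid_verts_def code_def vertex_of_def mult_add_div_mod lessThan_iff
      mem_Sigma_iff prod.case)

lemma code_vertex_of: "code (vertex_of u) = u"
  by (simp only: code_def vertex_of_def prod.case div_mult_mod_eq)

lemma vertex_of_in_grid_verts_iff: "vertex_of u \<in> grid_verts \<longleftrightarrow> u < R * C * 108"
  using C_gt_1 by (simp add: vertex_of_def in_grid_verts_iff less_mult_imp_div_less div_less_iff_less_mult)

lemma code_grid_verts: "code ` grid_verts = {..<R * C * 108}"
proof (intro equalityI subsetI)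
  fix n assume "n \<in> code ` grid_verts"
  then obtain u where u: "u \<in> grid_verts" "n = code u" by blast
  then have "vertex_of n \<in> grid_verts" by (simp add: vertex_of_code)
  then show "n \<in> {..<R * C * 108}" by (simp add: vertex_of_in_grid_verts_iff)
next
  fix n assume "n \<in> {..<R * C * 108}"
  then have "vertex_of n \<in> grid_verts" by (simp add: vertex_of_in_grid_verts_iff)
  then show "n \<in> code ` grid_verts" by (metis code_vertex_of image_eqI)
qed

lemma relabelling_code: "relabelling grid_graph code"
proof (intro relabelling.intro relabelling_axioms.intro pair_graph_grid_graph)
  show "inj_on code (pverts grid_graph)"
    by (rule inj_on_inverseI[of _ vertex_of]) (simp add: vertex_of_code)
qed

lemma pverts_numbered_graph: "pverts numbered_graph = {..<R * C * 108}"
  by (simp add: numbered_graph_def relabelling.pverts_relabel[OF relabelling_code] code_grid_verts)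

lemma numbered_arc_iff:
  "(u, v) \<in> parcs numbered_graph \<longleftrightarrow> u < R * C * 108 \<and> vertex_of v \<in> set (nbrs (vertex_of u))"
proof
  assume "(u, v) \<in> parcs numbered_graph"
  then obtain u' v' where "u = code u'" "v = code v'" "(u', v') \<in> parcs grid_graph"
    "u' \<in> grid_verts" "v' \<in> grid_verts"
    unfolding numbered_graph_def by (rule relabelling.arc_relabelE[OF relabelling_code]) simp
  then show "u < R * C * 108 \<and> vertex_of v \<in> set (nbrs (vertex_of u))"
    using vertex_of_in_grid_verts_iff[of u] by (simp add: vertex_of_code arc_iff)
next
  assume "u < R * C * 108 \<and> vertex_of v \<in> set (nbrs (vertex_of u))"
  then have "(vertex_of u, vertex_of v) \<in> parcs grid_graph"
    by (simp add: arc_iff vertex_of_in_grid_verts_iff)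
  then have "(code (vertex_of u), code (vertex_of v)) \<in> parcs numbered_graph"
    by (auto simp: numbered_graph_def relabel_def)
  then show "(u, v) \<in> parcs numbered_graph" by (simp only: code_vertex_of)
qed

lemma numbered_graph_properties:
  "pair_graph numbered_graph" "regular_graph 3 numbered_graph" "planar_graph numbered_graph"
  "bipartite numbered_graph" "pverts numbered_graph \<noteq> {}"
  "(\<exists>S. exact_cover numbered_graph S) \<longleftrightarrow> (\<exists>S. exact_cover grid_graph S)"
proof -
  interpret relabelling grid_graph code by (rule relabelling_code)
  show "pair_graph numbered_graph" "regular_graph 3 numbered_graph" "planar_graph numbered_graph"
    "bipartite numbered_graph" "pverts numbered_graph \<noteq> {}"
    "(\<exists>S. exact_cover numbered_graph S) \<longleftrightarrow> (\<exists>S. exact_cover grid_graph S)"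
    using pair_graph_relabel regular_graph_relabel[OF regular] planar_graph_relabel[OF planar_grid_graph]
      bipartite_relabel[OF bipartite_grid_graph] grid_verts_nonempty ex_exact_cover_relabel
    by (simp_all add: numbered_graph_def)
qed

lemma Theta_instance_numbered_graph: "Theta_instance numbered_graph (1 / 6)"
  using numbered_graph_properties by (simp add: Theta_instance_def)

lemma regular_numbered_graph: "regular_pair_graph numbered_graph 3"
  using numbered_graph_properties by (simp add: regular_pair_graph_def regular_pair_graph_axioms_def)

lemma sigma_chromatic_number_numbered_graph: "sigma_chromatic_number numbered_graph = 2"
  by (rule regular_pair_graph.sigma_chromatic_number_bipartite[OF regular_numbered_graph])
    (rule numbered_graph_properties)+

lemma Theta_question_numbered_graph:
  "Theta_question numbered_graph (1 / 6) \<longleftrightarrow> (\<exists>v. \<forall>r<R. satisfies_row v r)"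
  using Theta_question_sixth_iff[OF regular_numbered_graph _ sigma_chromatic_number_numbered_graph]
    numbered_graph_properties(5,6) ex_exact_cover_iff by simp

end

section \<open>The grid of a tableau\<close>

lemma mult_add_inject:
  fixes a b n :: nat
  assumes "b < n" "b' < n" "a * n + b = a' * n + b'"
  shows "a = a'" "b = b'"
  using assms mult_add_div_mod by metis+

lemma mult_add_less:
  fixes a b m n :: nat
  assumes "a < m" "b < n"
  shows "a * n + b < m * n"
proof -
  have "a * n + b < Suc a * n" using assms(2) by simp
  also have "\<dots> \<le> m * n" using assms(1) by (intro mult_right_mono) auto
  finally show ?thesis .
qed

context tm_schemas
begin

definition schema_list :: "schema list" where
  "schema_list = (SOME scs. set scs = schemas)"

lemma set_schema_list: "set schema_list = schemas"
  unfolding schema_list_def by (rule someI_ex) (rule finite_list[OF finite_schemas])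

abbreviation N where "N \<equiv> tm_states M + tm_symbols M"

end

text \<open>
  Each row of the grid is a clause, given by a schema, a time and a cell, and each column between the
  border columns is a variable. Column 1 is a dummy that occurs, positively, in the clauses of invalid
  schema instances.
\<close>

context tableau
begin

definition atoms :: "bool list \<Rightarrow> (nat \<times> nat \<times> nat \<times> nat) set" where
  "atoms x = {..T x} \<times> {..K} \<times> {..<width x} \<times> {..<N}"

fun column :: "bool list \<Rightarrow> nat \<times> nat \<times> nat \<times> nat \<Rightarrow> nat" where
  "column x (t, \<tau>, i, s) = ((t * Suc K + \<tau>) * width x + i) * N + s + 2"

definition rows :: "bool list \<Rightarrow> nat" where
  "rows x = length schema_list * Suc (T x) * width x"

definition cols :: "bool list \<Rightarrow> nat" where
  "cols x = Suc (T x) * Suc K * width x * N + 3"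

definition row_schema :: "bool list \<Rightarrow> nat \<Rightarrow> nat" where
  "row_schema x r = r div width x div Suc (T x)"

definition row_time :: "bool list \<Rightarrow> nat \<Rightarrow> nat" where
  "row_time x r = r div width x mod Suc (T x)"

definition row_cell :: "bool list \<Rightarrow> nat \<Rightarrow> nat" where
  "row_cell x r = r mod width x"

definition valid_row :: "bool list \<Rightarrow> nat \<Rightarrow> bool" where
  "valid_row x r \<longleftrightarrow> (\<exists>e<length schema_list. row_schema x r = e \<and>
     valid x (schema_list ! e) (row_time x r) (row_cell x r))"

definition occurs :: "(schema \<Rightarrow> literal set) \<Rightarrow> bool list \<Rightarrow> nat \<Rightarrow> nat \<Rightarrow> bool" where
  "occurs lits x r c \<longleftrightarrow> valid_row x r \<and> (\<exists>e<length schema_list. row_schema x r = e \<and>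
     (\<exists>l\<in>lits (schema_list ! e). c = column x (atom x l (row_time x r) (row_cell x r))))"

definition box_type :: "bool list \<Rightarrow> nat \<Rightarrow> nat \<Rightarrow> box" where
  "box_type x r c =
     (if c = 0 \<or> c = cols x - 1 then Border
      else if c = 1 \<and> \<not> valid_row x r \<or> occurs pos_lits x r c then Positive
      else if occurs neg_lits x r c then Negative
      else Cross)"

lemma rows_pos: "rows x > 0"
proof -
  have "Initial_State \<in> set schema_list" by (simp add: set_schema_list)
  then show ?thesis by (cases schema_list) (auto simp: rows_def width_def)
qed

lemma grid_tableau: "grid (rows x) (cols x) (box_type x)"
  by unfold_locales (auto simp: rows_pos cols_def box_type_def)

lemma inj_on_column: "inj_on (column x) (atoms x)"
proof (rule inj_onI)
  fix a b assume "a \<in> atoms x" "b \<in> atoms x" and eq: "column x a = column x b"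
  then obtain t \<tau> i s t' \<tau>' i' s' where a: "a = (t, \<tau>, i, s)" "\<tau> < Suc K" "i < width x" "s < N"
    and b: "b = (t', \<tau>', i', s')" "\<tau>' < Suc K" "i' < width x" "s' < N"
    by (auto simp: atoms_def)
  have "((t * Suc K + \<tau>) * width x + i) * N + s = ((t' * Suc K + \<tau>') * width x + i') * N + s'"
    using eq by (simp only: a b column.simps add_right_cancel)
  note symbol = mult_add_inject[OF a(4) b(4) this]
  note cell = mult_add_inject[OF a(3) b(3) symbol(1)]
  note tape = mult_add_inject[OF a(2) b(2) cell(1)]
  show "a = b" using a(1) b(1) symbol cell tape by simp
qed

lemma column_bounds:
  assumes "a \<in> atoms x"
  shows "1 < column x a" "column x a < cols x - 1"
proof -
  obtain t \<tau> i s where a: "a = (t, \<tau>, i, s)" "t < Suc (T x)" "\<tau> < Suc K" "i < width x" "s < N"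
    using assms by (auto simp: atoms_def)
  show "1 < column x a" by (simp add: a)
  have "((t * Suc K + \<tau>) * width x + i) * N + s < Suc (T x) * Suc K * width x * N"
    using a by (intro mult_add_less)
  then show "column x a < cols x - 1" by (simp add: a cols_def)
qed

lemma row_of_clause:
  assumes "e < length schema_list" "t \<le> T x" "i < width x"
  obtains r where "r < rows x" "row_schema x r = e" "row_time x r = t" "row_cell x r = i"
proof -
  let ?r = "(e * Suc (T x) + t) * width x + i"
  have t: "t < Suc (T x)" using assms(2) by simp
  have "?r < rows x" unfolding rows_def using assms(1,3) t by (intro mult_add_less)
  moreover have "row_schema x ?r = e" "row_time x ?r = t" "row_cell x ?r = i"
    by (simp_all only: row_schema_def row_time_def row_cell_def
        mult_add_div_mod[OF assms(3)] mult_add_div_mod[OF t])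
  ultimately show thesis by (rule that)
qed

lemma row_bounds:
  assumes "r < rows x"
  shows "row_schema x r < length schema_list" "row_time x r \<le> T x" "row_cell x r < width x"
proof -
  have "r div width x < length schema_list * Suc (T x)"
    using assms by (simp add: rows_def less_mult_imp_div_less)
  then show "row_schema x r < length schema_list"
    unfolding row_schema_def by (rule less_mult_imp_div_less)
  show "row_time x r \<le> T x"
    using mod_less_divisor[of "Suc (T x)" "r div width x"] by (simp add: row_time_def)
  show "row_cell x r < width x" by (simp add: row_cell_def width_def)
qed

context
  fixes x r t i sc
  assumes r: "r < rows x" and sc: "schema_list ! row_schema x r = sc"
    and time: "row_time x r = t" and cell: "row_cell x r = i" and valid: "valid x sc t i"
begin

lemma schema_of_row: "sc \<in> schemas" "t \<le> T x" "i < width x"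
  using row_bounds[OF r] nth_mem[of "row_schema x r" schema_list]
  by (auto simp: sc time cell set_schema_list)

lemma valid_row_if_valid: "valid_row x r"
  using row_bounds(1)[OF r] valid by (auto simp: valid_row_def sc time cell)

lemma occurs_iff: "occurs lits x r c \<longleftrightarrow> (\<exists>l\<in>lits sc. c = column x (atom x l t i))"
  using row_bounds(1)[OF r] valid_row_if_valid by (auto simp: occurs_def sc time cell)

lemma atom_in_atoms: "l \<in> pos_lits sc \<union> neg_lits sc \<Longrightarrow> atom x l t i \<in> atoms x"
  unfolding atoms_def by (rule atom_in_range[OF schema_of_row valid])

lemma literal_value_box_type_iff:
  "literal_value (box_type x r c) b \<longleftrightarrow> occurs pos_lits x r c \<and> b \<or> occurs neg_lits x r c \<and> \<not> b"
proof -
  have inner: "c \<noteq> 0 \<and> c \<noteq> cols x - 1" if "occurs pos_lits x r c \<or> occurs neg_lits x r c"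
    using that column_bounds[OF atom_in_atoms] unfolding occurs_iff by fastforce
  have disjoint: "\<not> occurs neg_lits x r c" if "occurs pos_lits x r c"
    using that inj_onD[OF inj_on_column] atom_in_atoms pos_neg_atoms_disjoint
    unfolding occurs_iff by (metis UnI1 UnI2)
  show ?thesis using inner disjoint valid_row_if_valid by (auto simp: box_type_def)
qed

lemma satisfies_row_iff_clause:
  "grid.satisfies_row (cols x) (box_type x) v r \<longleftrightarrow> clause_holds x (\<lambda>a. v (column x a)) sc t i"
proof -
  have "column x (atom x l t i) < cols x" if "l \<in> pos_lits sc \<union> neg_lits sc" for l
    using column_bounds(2)[OF atom_in_atoms[OF that]] by simp
  then show ?thesis
    unfolding grid.satisfies_row_def[OF grid_tableau] literal_value_box_type_iff occurs_iff
      clause_holds_def by blast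
qed

end

lemma satisfies_row_invalid:
  assumes "v 1" "\<not> valid_row x r"
  shows "grid.satisfies_row (cols x) (box_type x) v r"
  unfolding grid.satisfies_row_def[OF grid_tableau]
  using assms by (intro exI[of _ 1]) (simp add: box_type_def cols_def)

lemma clause_holds_cong:
  assumes "\<And>l. l \<in> pos_lits sc \<union> neg_lits sc \<Longrightarrow> v (atom x l t i) = v' (atom x l t i)"
  shows "clause_holds x v sc t i = clause_holds x v' sc t i"
  using assms by (auto simp: clause_holds_def)

lemma rows_satisfiable_iff:
  "(\<exists>v. \<forall>r<rows x. grid.satisfies_row (cols x) (box_type x) v r) \<longleftrightarrow> (\<exists>v. satisfies x v)"
proof
  assume "\<exists>v. \<forall>r<rows x. grid.satisfies_row (cols x) (box_type x) v r"
  then obtain v where v: "\<And>r. r < rows x \<Longrightarrow> grid.satisfies_row (cols x) (box_type x) v r" by blast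
  have "clause_holds x (\<lambda>a. v (column x a)) sc t i"
    if clause: "sc \<in> schemas" "t \<le> T x" "i < width x" "valid x sc t i" for sc t i
  proof -
    have "sc \<in> set schema_list" using clause(1) by (simp only: set_schema_list)
    then obtain e where e: "e < length schema_list" "schema_list ! e = sc" by (auto simp: in_set_conv_nth)
    obtain r where r: "r < rows x" "row_schema x r = e" "row_time x r = t" "row_cell x r = i"
      by (rule row_of_clause[OF e(1) clause(2,3)])
    show ?thesis using v[OF r(1)] satisfies_row_iff_clause[of r x sc t i v] r e clause(4) by simp
  qed
  then show "\<exists>v. satisfies x v" unfolding satisfies_def by blast
next
  assume "\<exists>v. satisfies x v"
  then obtain v where v: "satisfies x v" by blast
  define v' where "v' c \<longleftrightarrow> c = 1 \<or> (\<exists>a\<in>atoms x. c = column x a \<and> v a)" for c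
  have v'_column: "v' (column x a) \<longleftrightarrow> v a" if "a \<in> atoms x" for a
    using column_bounds(1)[OF that] inj_onD[OF inj_on_column _ that] that by (auto simp: v'_def)
  have "grid.satisfies_row (cols x) (box_type x) v' r" if r: "r < rows x" for r
  proof (cases "valid_row x r")
    case True
    define sc where "sc = schema_list ! row_schema x r"
    let ?t = "row_time x r" and ?i = "row_cell x r"
    have valid: "valid x sc ?t ?i" using True by (simp add: valid_row_def sc_def)
    note row = r sc_def[symmetric] refl refl valid
    have "clause_holds x (\<lambda>a. v' (column x a)) sc ?t ?i = clause_holds x v sc ?t ?i"
      by (rule clause_holds_cong) (rule v'_column[OF atom_in_atoms[OF row]])
    also have "\<dots>" by (rule satisfiesD[OF v schema_of_row[OF row] valid])
    finally show ?thesis using satisfies_row_iff_clause[OF row] by simp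
  next
    case False
    then show ?thesis by (intro satisfies_row_invalid) (simp_all add: v'_def)
  qed
  then show "\<exists>v. \<forall>r<rows x. grid.satisfies_row (cols x) (box_type x) v r" by blast
qed

definition reduction_graph :: "bool list \<Rightarrow> nat pair_pre_digraph" where
  "reduction_graph x = grid.numbered_graph (rows x) (cols x) (box_type x)"

lemma reduction_graph_properties:
  "Theta_instance (reduction_graph x) (1 / 6)" "sigma_chromatic_number (reduction_graph x) = 2"
  "Theta_question (reduction_graph x) (1 / 6) \<longleftrightarrow> (\<exists>v. satisfies x v)"
  unfolding reduction_graph_def rows_satisfiable_iff[symmetric]
  by (rule grid.Theta_instance_numbered_graph[OF grid_tableau]
      grid.sigma_chromatic_number_numbered_graph[OF grid_tableau]
      grid.Theta_question_numbered_graph[OF grid_tableau])+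

end

section \<open>Computing the reduction\<close>

lemma poly_time_computable_adjacency_string:
  assumes n: "\<And>k. ptime_fun k (\<lambda>x E. n x)"
    and arc: "\<And>k f g. ptime_fun k f \<Longrightarrow> ptime_fun k g \<Longrightarrow> ptime_pred k (\<lambda>x E. (f x E, g x E) \<in> A x)"
  shows "poly_time_computable (\<lambda>x. pair_string (adjacency_string (n x) (A x)) y)"
proof -
  define suffix where "suffix = pair_string [] y"
  define set_bits where "set_bits = {i. i < length suffix \<and> suffix ! i}"
  let ?m = "\<lambda>x. 2 * (n x * n x)"
  define b where "b x i \<longleftrightarrow> (if i < ?m x then (i div 2 div n x, i div 2 mod n x) \<in> A x
    else \<exists>a\<in>set_bits. i - ?m x = a)" for x i
  have bits: "ptime_pred 1 (\<lambda>x E. b x (E 0))"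
    unfolding b_def by (intro ptime_intros ptime_pred_finite_ex arc n) (simp_all add: set_bits_def)
  have "pair_string (adjacency_string (n x) (A x)) y = map (b x) [0..<?m x + length suffix]" for x
  proof (rule nth_equalityI)
    show "length (pair_string (adjacency_string (n x) (A x)) y) =
        length (map (b x) [0..<?m x + length suffix])"
      by (simp add: suffix_def length_pair_string length_adjacency_string)
    fix i assume "i < length (pair_string (adjacency_string (n x) (A x)) y)"
    then have i: "i < ?m x + length suffix"
      by (simp add: suffix_def length_pair_string length_adjacency_string)
    have "pair_string (adjacency_string (n x) (A x)) y ! i = b x i"
    proof (cases "i < ?m x")
      case True
      then have "i div 2 < n x * n x" by simp
      then show ?thesis using True
        by (simp add: b_def nth_pair_string length_adjacency_string) (simp add: adjacency_string_def)
    next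
      case False
      then have "pair_string (adjacency_string (n x) (A x)) y ! i = suffix ! (i - ?m x)"
        by (auto simp: suffix_def nth_pair_string length_adjacency_string)
      moreover have "i - ?m x < length suffix" using False i by linarith
      ultimately show ?thesis using False by (simp add: b_def set_bits_def)
    qed
    then show "pair_string (adjacency_string (n x) (A x)) y ! i = map (b x) [0..<?m x + length suffix] ! i"
      using i by simp
  qed
  then show ?thesis
    using poly_time_computable_map_upt[OF _ bits, of "\<lambda>x. ?m x + length suffix"]
    by (simp add: ptime_fun_add ptime_fun_mult ptime_fun_const n)
qed

context grid
begin

lemma partner_eq_iff:
  "(r', c', k) = partner (r, c, p) \<longleftrightarrow>
     (if p < 2 then if r = 0 then r' = r \<and> c' = c \<and> k = opposite p else r' = r - 1 \<and> c' = c \<and> k = 5 - p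
      else if p < 4 then if Suc c = C then r' = r \<and> c' = c \<and> k = opposite p
        else r' = r \<and> c' = Suc c \<and> k = 9 - p
      else if p < 6 then if Suc r = R then r' = r \<and> c' = c \<and> k = opposite p
        else r' = Suc r \<and> c' = c \<and> k = 5 - p
      else if c = 0 then r' = r \<and> c' = c \<and> k = opposite p else r' = r \<and> c' = c - 1 \<and> k = 9 - p)"
  by (simp add: partner.simps)

lemma numbered_arc_iff_finite:
  "(u, v) \<in> parcs numbered_graph \<longleftrightarrow> u < R * C * 108 \<and>
     (\<exists>(b, k)\<in>{Cross, Positive, Negative, Border} \<times> {..<108}.
        type (u div 108 div C) (u div 108 mod C) = b \<and> u mod 108 = k \<and>
        ((\<exists>j\<in>set (box_nbrs b k). v div 108 div C = u div 108 div C \<and>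
            v div 108 mod C = u div 108 mod C \<and> v mod 108 = j) \<or>
         k < 8 \<and> (v div 108 div C, v div 108 mod C, v mod 108) =
           partner (u div 108 div C, u div 108 mod C, k)))"
proof -
  have "b \<in> {Cross, Positive, Negative, Border}" for b by (cases b) simp_all
  then show ?thesis
    unfolding numbered_arc_iff by (auto simp: vertex_of_def nbrs.simps)
qed

end

locale reduction = tableau +
  assumes ptime_T: "\<And>n. ptime_fun n (\<lambda>x E. T x)" and ptime_P: "\<And>n. ptime_fun n (\<lambda>x E. P x)"
begin

lemma ptime_centre: "ptime_fun n (\<lambda>x E. centre x)"
  unfolding centre_def by (intro ptime_intros ptime_T ptime_P)

lemma ptime_width: "ptime_fun n (\<lambda>x E. width x)"
  unfolding width_def by (intro ptime_intros ptime_centre)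

lemma ptime_rows: "ptime_fun n (\<lambda>x E. rows x)"
  unfolding rows_def by (intro ptime_intros ptime_T ptime_width)

lemma ptime_cols: "ptime_fun n (\<lambda>x E. cols x)"
  unfolding cols_def by (intro ptime_intros ptime_T ptime_width)

lemmas ptime_sizes = ptime_T ptime_P ptime_centre ptime_width ptime_rows ptime_cols

lemma ptime_init_symbol:
  assumes "ptime_fun n f"
  shows "ptime_fun n (\<lambda>x E. init_symbol x \<tau> (f x E))"
proof -
  have "ptime_fun n (\<lambda>x E. if \<tau> \<noteq> 0 \<or> f x E < centre x then 0
      else if f x E - centre x < 2 * length x then
        1 + of_bool ((f x E - centre x) div 2 < length x \<and> x ! ((f x E - centre x) div 2))
      else if f x E - centre x = 2 * length x then 1
      else if f x E - centre x = 2 * length x + 1 then 2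
      else if f x E - centre x < 2 * length x + 2 + P x then 3 else 0)"
    by (intro ptime_intros ptime_sizes assms ptime_pred_const)
  then show ?thesis by (rule ptime_fun_cong) (auto simp: init_symbol_def)
qed

lemma ptime_shift: "ptime_fun n f \<Longrightarrow> ptime_fun n (\<lambda>x E. shift d (f x E))"
  unfolding shift_def by (intro ptime_intros)

lemma ptime_valid:
  assumes "ptime_fun n t" "ptime_fun n i"
  shows "ptime_pred n (\<lambda>x E. valid x sc (t x E) (i x E))"
  by (cases sc; simp only: valid.simps)
    (intro ptime_intros ptime_shift ptime_sizes assms ptime_init_symbol ptime_pred_const)+

lemma ptime_column_atom:
  assumes "ptime_fun n t" "ptime_fun n i"
  shows "ptime_fun n (\<lambda>x E. column x (atom x l (t x E) (i x E)))"
proof -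
  have position: "ptime_fun n (\<lambda>x E. position x p (i x E))" for p
    by (cases p; simp only: position.simps) (intro ptime_shift ptime_sizes assms)+
  show ?thesis
    by (cases l; simp only: atom.simps column.simps) (intro ptime_intros ptime_sizes position assms)+
qed

lemma ptime_row:
  assumes "ptime_fun n r"
  shows "ptime_fun n (\<lambda>x E. row_schema x (r x E))" "ptime_fun n (\<lambda>x E. row_time x (r x E))"
    "ptime_fun n (\<lambda>x E. row_cell x (r x E))"
  unfolding row_schema_def row_time_def row_cell_def by (intro ptime_intros ptime_sizes assms)+

lemma ptime_valid_row:
  assumes "ptime_fun n r"
  shows "ptime_pred n (\<lambda>x E. valid_row x (r x E))"
proof -
  have "ptime_pred n (\<lambda>x E. \<exists>e\<in>{..<length schema_list}. row_schema x (r x E) = e \<and>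
      valid x (schema_list ! e) (row_time x (r x E)) (row_cell x (r x E)))"
    by (intro ptime_pred_finite_ex finite_lessThan ptime_intros ptime_valid ptime_row assms)
  then show ?thesis by (simp only: valid_row_def lessThan_iff Bex_def)
qed

lemma ptime_occurs:
  assumes "ptime_fun n r" "ptime_fun n c" and "\<And>sc. finite (lits sc)"
  shows "ptime_pred n (\<lambda>x E. occurs lits x (r x E) (c x E))"
proof -
  have "ptime_pred n (\<lambda>x E. valid_row x (r x E) \<and>
      (\<exists>e\<in>{..<length schema_list}. row_schema x (r x E) = e \<and>
        (\<exists>l\<in>lits (schema_list ! e).
           c x E = column x (atom x l (row_time x (r x E)) (row_cell x (r x E))))))"
    by (intro ptime_pred_conj ptime_pred_finite_ex finite_lessThan ptime_pred_eq ptime_fun_const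
        ptime_valid_row ptime_column_atom ptime_row assms)
  then show ?thesis by (simp only: occurs_def lessThan_iff Bex_def)
qed

lemma ptime_box_type:
  assumes "ptime_fun n r" "ptime_fun n c"
  shows "ptime_pred n (\<lambda>x E. box_type x (r x E) (c x E) = b)"
proof -
  have "ptime_pred n (\<lambda>x E. if c x E = 0 \<or> c x E = cols x - 1 then b = Border
      else if c x E = 1 \<and> \<not> valid_row x (r x E) \<or> occurs pos_lits x (r x E) (c x E) then b = Positive
      else if occurs neg_lits x (r x E) (c x E) then b = Negative
      else b = Cross)"
    by (intro ptime_pred_if ptime_pred_disj ptime_pred_conj ptime_pred_not ptime_pred_eq ptime_pred_const
        ptime_valid_row ptime_occurs ptime_fun_diff ptime_fun_const ptime_sizes finite_lits assms)
  then show ?thesis by (rule ptime_fun_cong) (auto simp: box_type_def)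
qed

lemma ptime_arc:
  assumes u: "ptime_fun n u" and v: "ptime_fun n v"
  shows "ptime_pred n (\<lambda>x E. (u x E, v x E) \<in> parcs (reduction_graph x))"
  unfolding reduction_graph_def grid.numbered_arc_iff_finite[OF grid_tableau]
    grid.partner_eq_iff[OF grid_tableau] case_prod_beta
  by (intro ptime_pred_finite_ex ptime_intros ptime_pred_const ptime_box_type ptime_sizes u v
      finite_cartesian_product finite_lessThan finite_set finite.intros)

definition reduce :: "bool list \<Rightarrow> bool list" where
  "reduce x = pair_string (adjacency_string (rows x * cols x * 108) (parcs (reduction_graph x)))
     (pair_string (nat_string 1) (nat_string 6))"

lemma poly_time_computable_reduce: "poly_time_computable reduce"
  unfolding reduce_def
  by (intro poly_time_computable_adjacency_string ptime_arc ptime_intros ptime_sizes)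

lemma reduce_encodes: "encodes (reduce x) (reduction_graph x) (1 / 6)"
proof -
  have "pverts (reduction_graph x) = {..<rows x * cols x * 108}"
    unfolding reduction_graph_def by (rule grid.pverts_numbered_graph[OF grid_tableau])
  then show ?thesis
    unfolding encodes_def reduce_def
    by (intro exI[of _ "rows x * cols x * 108"] exI[of _ 1] exI[of _ 6]) simp
qed

end

lemma poly_nat_mono: "a \<le> b \<Longrightarrow> poly p a \<le> poly p (b :: nat)"
  by (induction p) (auto intro: mult_mono)

theorem NP_hard_Theta: "NP_hard_promise Theta"
  unfolding NP_hard_promise_def Theta_def prod.case
proof
  fix L assume "L \<in> NP"
  then obtain V and q :: "nat poly" where V: "poly_time_decidable V"
    and L: "\<And>x. x \<in> L \<longleftrightarrow> (\<exists>w. length w \<le> poly q (length x) \<and> V (pair_string x w))"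
    unfolding NP_def promise_NP_def by auto
  from V obtain M and p :: "nat poly" where M: "wf_tm M" "tm_computes_within M (\<lambda>y. [V y]) (poly p)"
    unfolding poly_time_decidable_def poly_time_computable_def by blast
  define P where "P x = poly q (length x)" for x :: "bool list"
  define T where "T x = poly p (2 * length x + 2 + P x)" for x
  interpret reduction M T P
  proof
    show "wf_tm M" by (rule M(1))
    show P: "ptime_fun n (\<lambda>x E. P x)" for n unfolding P_def by (intro ptime_fun_poly ptime_fun_length)
    show "ptime_fun n (\<lambda>x E. T x)" for n unfolding T_def by (intro ptime_fun_poly ptime_intros P)
  qed
  have halts: "\<exists>t\<le>T x. \<exists>ts. (tm_step M ^^ t) (tm_init M (pair_string x w)) = (1, ts) \<and>
      snd (hd ts) = string_tape [V (pair_string x w)]" if "length w \<le> P x" for x w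
  proof -
    have "poly p (length (pair_string x w)) \<le> T x"
      unfolding T_def length_pair_string using that by (intro poly_nat_mono) simp
    then show ?thesis using M(2) le_trans unfolding tm_computes_within_def by meson
  qed
  have "x \<in> L \<longleftrightarrow> Theta_question (reduction_graph x) (1 / 6)" for x
    using reduction_graph_properties(3)[of x] satisfiable_iff_accepted[of x V, OF halts] L[of x]
    by (simp add: P_def)
  then show "\<exists>f. poly_time_computable f \<and>
      (\<forall>x. f x \<in> {x. \<exists>G r. encodes x G r \<and> Theta_instance G r \<and> sigma_chromatic_number G = 2} \<and>
        (x \<in> L \<longleftrightarrow> f x \<in> {x. \<exists>G r. encodes x G r \<and> Theta_instance G r \<and> Theta_question G r}))"
    using poly_time_computable_reduce reduce_encodes reduction_graph_properties(1,2)
      Theta_yes_iff[OF reduce_encodes reduction_graph_properties(1)]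
    by (intro exI[of _ reduce]) blast
qed

theorem theorem4:
  shows "NP_complete_promise Theta"
  unfolding NP_complete_promise_def using Theta_in_promise_NP NP_hard_Theta by blast

end
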